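(* Let $\mathsf G=(\mathsf V,\mathsf E,\partial)$ be a countable graph and let $(e^{t\Delta})_{t\ge 0}$ be the heat semigroup on $L^2(\mathsf G)$. The number of non-trivial, minimal invariant ideals of $L^2(\mathsf G)$ (with respect to $(e^{t\Delta})_{t\ge0}$) is the number of different finite spans $S_{\rm fin}(\mathsf e)$, $\mathsf e\in\mathsf E$, contained in the graph.
   Context: Graphs. An oriented graph is a triple $\mathsf G=(\mathsf V,\mathsf E,\partial)$ with sets $\mathsf V$ (nodes) and $\mathsf E$ (edges) and a map $\partial=(\partial_1,\partial_2):\mathsf E\to\mathsf V\times\mathsf V$; the edge $\mathsf e$ starts at $\partial_1\mathsf e$ and ends at $\partial_2\mathsf e$. It is countable if $\mathsf V,\mathsf E$ are countable (finite or countably infinite). $\Gamma^+(\mathsf v)$ (resp. $\Gamma^-(\mathsf v)$) is the set of edges ending (resp. starting) at $\mathsf v$, and $\deg(\mathsf v)=|\Gamma^+(\mathsf v)|+|\Gamma^-(\mathsf v)|\in\{0,1,\dots,\infty\}$. An edge is incident to its start and end nodes. Heat semigroup. $L^2(\mathsf G):=\bigoplus_{\mathsf e\in\mathsf E}L^2(0,1)$ (Hilbert direct sum, complex-valued functions), with elements $\psi=(\psi_{\mathsf e})_{\mathsf e\in\mathsf E}$; it is identified with $L^2$ of the disjoint union of one copy of $[0,1]$ for each edge. Let $V$ be the set of all $\psi\in\bigoplus_{\mathsf e\in\mathsf E}H^1(0,1)$ (Hilbert direct sum) for which there is $d^\psi\in\ell^2(\mathsf V)$ with $\psi_{\mathsf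 e}(0)=d^\psi_{\partial_1\mathsf e}$ and $\psi_{\mathsf e}(1)=d^\psi_{\partial_2\mathsf e}$ for all $\mathsf e\in\mathsf E$. The Laplace operator $\Delta$ on $L^2(\mathsf G)$ is the operator associated with the form $a(f,g)=\sum_{\mathsf e\in\mathsf E}\int_0^1 f_{\mathsf e}'(x)\overline{g_{\mathsf e}'(x)}\,dx$ with form domain $V$: $f\in D(\Delta)$ and $\Delta f=h$ iff $f\in V$, $h\in L^2(\mathsf G)$ and $a(f,g)=-(h\mid g)_{L^2(\mathsf G)}$ for all $g\in V$. The semigroup $(e^{t\Delta})_{t\ge0}$ generated by $\Delta$ is the heat semigroup. Ideals. For a measurable subset $\omega$ of the disjoint union of the edge intervals, $L^2(\omega)$ is the ideal of functions in $L^2(\mathsf G)$ vanishing a.e. outside $\omega$; all ideals considered have this form. It is non-trivial if $\omega$ has positive measure, invariant if $e^{t\Delta}L^2(\omega)\subset L^2(\omega)$ for all $t\ge0$, and a minimal invariant ideal if it is a minimal element, with respect to inclusion, among the non-trivial invariant ideals. Finite span. A path from $\mathsf e$ to $\mathsf e'$ is a finite sequence of edges $\mathsf e=\mathsf e_0,\dots,\mathsf e_n=\mathsf e'$ ($n\ge0$) together with nodes $\mathsf v_1,\dots,\mathsf v_n$ such that $\mathsf v_i$ is incident to both $\mathsf e_{i-1}$ and $\mathsf e_i$ (orientation is irrelevant); it contains no infinite stars (has finite weight) if $\deg(\mathsf v_i)<\infty$ for all $i$. The finite span $S_{\rm fin}(\mathsf e)$ is the subgraph consisting of all edges $\mathsf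 e'$ for which there is a path of finite weight from $\mathsf e$ to $\mathsf e'$, together with their endpoints. "Number" means cardinality. *)

theory Defs
  imports "HOL-Analysis.Analysis" "HOL-Library.Equipollence" "Graph_Theory.Digraph"
begin

text \<open>
  Oriented graphs are the well-formed digraphs of \<^theory>\<open>Graph_Theory.Digraph\<close>: the edge \<open>e\<close>
  starts at \<open>tail G e\<close> and ends at \<open>head G e\<close>; loops, multiple edges, isolated nodes and
  infinitely many nodes and edges are allowed.
\<close>

locale countable_digraph = wf_digraph G for G :: "('v, 'e) pre_digraph" (structure) +
  assumes countable_verts: "countable (verts G)"
    and countable_arcs: "countable (arcs G)"

text \<open>
  The degrees of the digraph library are cardinalities in \<^typ>\<open>nat\<close>, which are \<open>0\<close> for infinite
  sets; hence the explicit \<open>\<infinity>\<close> here. A loop counts twice.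
\<close>

definition edegree :: "('v, 'e) pre_digraph \<Rightarrow> 'v \<Rightarrow> enat" where
  "edegree G v = (if finite (in_arcs G v) \<and> finite (out_arcs G v)
     then enat (in_degree G v + out_degree G v) else \<infinity>)"

definition incident :: "('v, 'e) pre_digraph \<Rightarrow> 'v \<Rightarrow> 'e \<Rightarrow> bool" where
  "incident G v e \<longleftrightarrow> v = tail G e \<or> v = head G e"

text \<open>The list \<open>es\<close> is \<open>e\<^sub>0, \<dots>, e\<^sub>n\<close> and the list \<open>vs\<close> is \<open>v\<^sub>1, \<dots>, v\<^sub>n\<close>.\<close>

definition edge_path ::
  "('v, 'e) pre_digraph \<Rightarrow> 'e \<Rightarrow> 'e list \<Rightarrow> 'v list \<Rightarrow> 'e \<Rightarrow> bool" where
  "edge_path G e es vs e' \<longleftrightarrow>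
     length es = Suc (length vs) \<and> set es \<subseteq> arcs G \<and> set vs \<subseteq> verts G \<and>
     hd es = e \<and> last es = e' \<and>
     (\<forall>i<length vs. incident G (vs ! i) (es ! i) \<and> incident G (vs ! i) (es ! Suc i))"

definition finite_weight :: "('v, 'e) pre_digraph \<Rightarrow> 'v list \<Rightarrow> bool" where
  "finite_weight G vs \<longleftrightarrow> (\<forall>v\<in>set vs. edegree G v < \<infinity>)"

definition finite_span :: "('v, 'e) pre_digraph \<Rightarrow> 'e \<Rightarrow> ('v, 'e) pre_digraph" where
  "finite_span G e =
     (let A = {e'. \<exists>es vs. edge_path G e es vs e' \<and> finite_weight G vs}
      in \<lparr>verts = tail G ` A \<union> head G ` A, arcs = A, tail = tail G, head = head G\<rparr>)"

text \<open>
  Elements of \<open>L\<^sup>2(0,1)\<close> are represented by functions on \<open>\<real>\<close> of which only the values on \<open>[0,1]\<close>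
  matter, up to null sets.
\<close>

abbreviation unit_interval :: "real measure" where
  "unit_interval \<equiv> lebesgue_on {0..1}"

definition L2_interval :: "(real \<Rightarrow> complex) set" where
  "L2_interval = {f. f \<in> borel_measurable unit_interval \<and>
     integrable unit_interval (\<lambda>x. (cmod (f x))\<^sup>2)}"

definition sqnorm_interval :: "(real \<Rightarrow> complex) \<Rightarrow> real" where
  "sqnorm_interval f = (LINT x|unit_interval. (cmod (f x))\<^sup>2)"

text \<open>Test functions are taken from \<open>C\<^sub>c\<^sup>1(0,1)\<close>; \<open>\<phi>'\<close> is the derivative of \<open>\<phi>\<close>.\<close>

definition test_function :: "(real \<Rightarrow> real) \<Rightarrow> (real \<Rightarrow> real) \<Rightarrow> bool" where
  "test_function \<phi> \<phi>' \<longleftrightarrow>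
     (\<forall>x. (\<phi> has_real_derivative \<phi>' x) (at x)) \<and> continuous_on UNIV \<phi>' \<and>
     (\<exists>a b. 0 < a \<and> b < 1 \<and> (\<forall>x. x \<notin> {a..b} \<longrightarrow> \<phi> x = 0))"

definition has_weak_deriv :: "(real \<Rightarrow> complex) \<Rightarrow> (real \<Rightarrow> complex) \<Rightarrow> bool" where
  "has_weak_deriv f g \<longleftrightarrow> f \<in> L2_interval \<and> g \<in> L2_interval \<and>
     (\<forall>\<phi> \<phi>'. test_function \<phi> \<phi>' \<longrightarrow>
        (LINT x|unit_interval. f x * of_real (\<phi>' x)) =
        - (LINT x|unit_interval. g x * of_real (\<phi> x)))"

definition H1_interval :: "(real \<Rightarrow> complex) set" where
  "H1_interval = {f. \<exists>g. has_weak_deriv f g}"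

text \<open>
  For \<open>f \<in> H\<^sup>1(0,1)\<close> the weak derivative is unique up to null sets and the continuous
  representative is unique on \<open>[0,1]\<close>, so that the following choices do not matter.
\<close>

definition weak_deriv :: "(real \<Rightarrow> complex) \<Rightarrow> real \<Rightarrow> complex" where
  "weak_deriv f = (SOME g. has_weak_deriv f g)"

definition continuous_rep :: "(real \<Rightarrow> complex) \<Rightarrow> real \<Rightarrow> complex" where
  "continuous_rep f = (SOME u. continuous_on {0..1} u \<and> (AE x in unit_interval. f x = u x))"

text \<open>
  The Hilbert direct sum \<open>L\<^sup>2(G)\<close> of the spaces \<open>L\<^sup>2(0,1)\<close>, one for each edge. Its elements are
  represented by functions; the values outside the edges of \<open>G\<close> and outside \<open>[0,1]\<close> are irrelevant.
\<close>

definition L2_graph :: "('v, 'e) pre_digraph \<Rightarrow> ('e \<Rightarrow> real \<Rightarrow> complex) set" where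
  "L2_graph G = {\<psi>. (\<forall>e\<in>arcs G. \<psi> e \<in> L2_interval) \<and>
     (\<lambda>e. sqnorm_interval (\<psi> e)) summable_on arcs G}"

definition L2_inner ::
  "('v, 'e) pre_digraph \<Rightarrow> ('e \<Rightarrow> real \<Rightarrow> complex) \<Rightarrow> ('e \<Rightarrow> real \<Rightarrow> complex) \<Rightarrow> complex" where
  "L2_inner G f g = (\<Sum>\<^sub>\<infinity>e\<in>arcs G. LINT x|unit_interval. f e x * cnj (g e x))"

definition L2_norm :: "('v, 'e) pre_digraph \<Rightarrow> ('e \<Rightarrow> real \<Rightarrow> complex) \<Rightarrow> real" where
  "L2_norm G f = sqrt (\<Sum>\<^sub>\<infinity>e\<in>arcs G. sqnorm_interval (f e))"

text \<open>
  The disjoint union of one copy of \<open>[0,1]\<close> for each edge, with Lebesgue measure on every copy.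
\<close>

definition edge_measure :: "('v, 'e) pre_digraph \<Rightarrow> ('e \<times> real) measure" where
  "edge_measure G = count_space (arcs G) \<Otimes>\<^sub>M unit_interval"

definition L2_eq ::
  "('v, 'e) pre_digraph \<Rightarrow> ('e \<Rightarrow> real \<Rightarrow> complex) \<Rightarrow> ('e \<Rightarrow> real \<Rightarrow> complex) \<Rightarrow> bool" where
  "L2_eq G f g \<longleftrightarrow> (AE (e, x) in edge_measure G. f e x = g e x)"

definition H1_graph :: "('v, 'e) pre_digraph \<Rightarrow> ('e \<Rightarrow> real \<Rightarrow> complex) set" where
  "H1_graph G = {\<psi>. (\<forall>e\<in>arcs G. \<psi> e \<in> H1_interval) \<and>
     (\<lambda>e. sqnorm_interval (\<psi> e) + sqnorm_interval (weak_deriv (\<psi> e))) summable_on arcs G}"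

definition form_domain :: "('v, 'e) pre_digraph \<Rightarrow> ('e \<Rightarrow> real \<Rightarrow> complex) set" where
  "form_domain G = {\<psi> \<in> H1_graph G. \<exists>d :: 'v \<Rightarrow> complex.
     (\<lambda>v. (cmod (d v))\<^sup>2) summable_on verts G \<and>
     (\<forall>e\<in>arcs G. continuous_rep (\<psi> e) 0 = d (tail G e) \<and>
                 continuous_rep (\<psi> e) 1 = d (head G e))}"

definition dirichlet_form ::
  "('v, 'e) pre_digraph \<Rightarrow> ('e \<Rightarrow> real \<Rightarrow> complex) \<Rightarrow> ('e \<Rightarrow> real \<Rightarrow> complex) \<Rightarrow> complex" where
  "dirichlet_form G f g =
     (\<Sum>\<^sub>\<infinity>e\<in>arcs G. LINT x|unit_interval. weak_deriv (f e) x * cnj (weak_deriv (g e) x))"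

text \<open>Unbounded operators are given by their graphs: \<open>laplacian G f h\<close> means \<open>f \<in> D(\<Delta>)\<close>, \<open>\<Delta>f = h\<close>.\<close>

definition laplacian ::
  "('v, 'e) pre_digraph \<Rightarrow> ('e \<Rightarrow> real \<Rightarrow> complex) \<Rightarrow> ('e \<Rightarrow> real \<Rightarrow> complex) \<Rightarrow> bool" where
  "laplacian G f h \<longleftrightarrow> f \<in> form_domain G \<and> h \<in> L2_graph G \<and>
     (\<forall>g\<in>form_domain G. dirichlet_form G f g = - L2_inner G h g)"

text \<open>
  Operators act on representatives. Linearity together with boundedness makes them
  compatible with equality almost everywhere.
\<close>

definition bounded_operator ::
  "('v, 'e) pre_digraph \<Rightarrow> (('e \<Rightarrow> real \<Rightarrow> complex) \<Rightarrow> 'e \<Rightarrow> real \<Rightarrow> complex) \<Rightarrow> bool" where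
  "bounded_operator G S \<longleftrightarrow>
     (\<forall>f\<in>L2_graph G. S f \<in> L2_graph G) \<and>
     (\<forall>f\<in>L2_graph G. \<forall>g\<in>L2_graph G.
        L2_eq G (S (\<lambda>e x. f e x + g e x)) (\<lambda>e x. S f e x + S g e x)) \<and>
     (\<forall>f\<in>L2_graph G. \<forall>c. L2_eq G (S (\<lambda>e x. c * f e x)) (\<lambda>e x. c * S f e x)) \<and>
     (\<exists>C. \<forall>f\<in>L2_graph G. L2_norm G (S f) \<le> C * L2_norm G f)"

definition C0_semigroup ::
  "('v, 'e) pre_digraph \<Rightarrow> (real \<Rightarrow> ('e \<Rightarrow> real \<Rightarrow> complex) \<Rightarrow> 'e \<Rightarrow> real \<Rightarrow> complex) \<Rightarrow> bool" where
  "C0_semigroup G T \<longleftrightarrow>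
     (\<forall>t\<ge>0. bounded_operator G (T t)) \<and>
     (\<forall>f\<in>L2_graph G. L2_eq G (T 0 f) f) \<and>
     (\<forall>s\<ge>0. \<forall>t\<ge>0. \<forall>f\<in>L2_graph G. L2_eq G (T (s + t) f) (T s (T t f))) \<and>
     (\<forall>f\<in>L2_graph G. ((\<lambda>t. L2_norm G (\<lambda>e x. T t f e x - f e x)) \<longlongrightarrow> 0) (at_right 0))"

definition generator ::
  "('v, 'e) pre_digraph \<Rightarrow> (real \<Rightarrow> ('e \<Rightarrow> real \<Rightarrow> complex) \<Rightarrow> 'e \<Rightarrow> real \<Rightarrow> complex) \<Rightarrow>
   ('e \<Rightarrow> real \<Rightarrow> complex) \<Rightarrow> ('e \<Rightarrow> real \<Rightarrow> complex) \<Rightarrow> bool" where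
  "generator G T f h \<longleftrightarrow> f \<in> L2_graph G \<and> h \<in> L2_graph G \<and>
     ((\<lambda>t. L2_norm G (\<lambda>e x. (T t f e x - f e x) / of_real t - h e x)) \<longlongrightarrow> 0) (at_right 0)"

text \<open>
  A strongly continuous semigroup is determined by its generator, so \<open>heat_semigroup G T\<close> says
  that \<open>T t\<close> is \<open>e\<^sup>t\<^sup>\<Delta>\<close> for all \<open>t \<ge> 0\<close>.
\<close>

definition heat_semigroup ::
  "('v, 'e) pre_digraph \<Rightarrow> (real \<Rightarrow> ('e \<Rightarrow> real \<Rightarrow> complex) \<Rightarrow> 'e \<Rightarrow> real \<Rightarrow> complex) \<Rightarrow> bool" where
  "heat_semigroup G T \<longleftrightarrow> C0_semigroup G T \<and> generator G T = laplacian G"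

text \<open>
  Ideals are sets of representatives closed under equality almost everywhere; thus two
  sets \<open>\<omega>\<close> yield the same ideal iff they differ by a null set.
\<close>

definition L2_ideal ::
  "('v, 'e) pre_digraph \<Rightarrow> ('e \<times> real) set \<Rightarrow> ('e \<Rightarrow> real \<Rightarrow> complex) set" where
  "L2_ideal G \<omega> =
     {f \<in> L2_graph G. AE (e, x) in edge_measure G. (e, x) \<notin> \<omega> \<longrightarrow> f e x = 0}"

definition nontrivial_ideal ::
  "('v, 'e) pre_digraph \<Rightarrow> ('e \<Rightarrow> real \<Rightarrow> complex) set \<Rightarrow> bool" where
  "nontrivial_ideal G I \<longleftrightarrow>
     (\<exists>\<omega>\<in>sets (edge_measure G). emeasure (edge_measure G) \<omega> > 0 \<and> I = L2_ideal G \<omega>)"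

definition invariant ::
  "(real \<Rightarrow> ('e \<Rightarrow> real \<Rightarrow> complex) \<Rightarrow> 'e \<Rightarrow> real \<Rightarrow> complex) \<Rightarrow>
   ('e \<Rightarrow> real \<Rightarrow> complex) set \<Rightarrow> bool" where
  "invariant T I \<longleftrightarrow> (\<forall>t\<ge>0. T t ` I \<subseteq> I)"

definition minimal_invariant_ideal ::
  "('v, 'e) pre_digraph \<Rightarrow> (real \<Rightarrow> ('e \<Rightarrow> real \<Rightarrow> complex) \<Rightarrow> 'e \<Rightarrow> real \<Rightarrow> complex) \<Rightarrow>
   ('e \<Rightarrow> real \<Rightarrow> complex) set \<Rightarrow> bool" where
  "minimal_invariant_ideal G T I \<longleftrightarrow>
     nontrivial_ideal G I \<and> invariant T I \<and>
     (\<forall>J. nontrivial_ideal G J \<and> invariant T J \<and> J \<subseteq> I \<longrightarrow> J = I)"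

end

theory Submission
  imports Defs
begin

text \<open>
  Let \<open>P\<close> be multiplication by the indicator function of a union of edges. If the set of edges is
  closed under passing through nodes of finite degree, then \<open>P\<close> maps the form domain into itself,
  because its elements vanish at nodes of infinite degree; hence \<open>P\<close> commutes with \<open>\<Delta>\<close> and with the
  semigroup. Taking all edges, the semigroup is symmetric. Conversely, by symmetry the
  projection \<open>P\<close> onto an invariant ideal \<open>L\<^sup>2(\<omega>)\<close> commutes with the semigroup and thus preserves
  \<open>D(\<Delta>)\<close>. Applying it to bumps inside an edge shows that \<open>\<omega>\<close> is a union of edges up to a null set,
  and applying it to functions equal to \<open>1\<close> near a node of finite degree shows that either all or
  none of the edges at this node belong to \<open>\<omega>\<close>. So the invariant ideals correspond to the closed
  sets of edges, and the minimal ones to the equivalence classes, which are the finite spans.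
\<close>

section \<open>Square integrable functions\<close>

text \<open>Nothing is given about \<open>T\<close> beyond the laws of a strongly continuous
  semigroup and its generator. Its symmetry therefore has to be recovered from the symmetry of the
  form, and this shapes the middle of the proof: time is shifted from one factor of an inner product
  to the other in many small steps, and the errors vanish in the limit only if the operators
  \<open>T s\<close>, \<open>s \<le> t\<close>, are bounded uniformly. Strong continuity at
  \<open>0\<close> is assumed vector by vector, so such a bound is an instance of the uniform
  boundedness principle and rests on the completeness of L^2. One argument yields both symmetry (cut
  by all edges) and invariance (cut by the complement of a closed set).

  The domain of the Laplacian is never described. It suffices to know fields that are constant near
  both ends of every edge: their derivatives have compact support in the open edges, so integration
  by parts leaves no boundary terms and no Kirchhoff condition has to be checked. They are dense,
  and they include every bump used to probe an ideal.\<close>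

definition sqint :: "'a measure \<Rightarrow> ('a \<Rightarrow> complex) set" where
  "sqint M = {f. f \<in> borel_measurable M \<and> integrable M (\<lambda>x. (cmod (f x))\<^sup>2)}"

text \<open>The measure stays a parameter, so that one calculus serves both a single edge
  (\<open>unit_interval\<close>) and the whole graph (\<open>edge_measure G\<close>).\<close>

definition nrm2 :: "'a measure \<Rightarrow> ('a \<Rightarrow> complex) \<Rightarrow> real" where
  "nrm2 M f = sqrt (LINT x|M. (cmod (f x))\<^sup>2)"

lemma sqint_measurable: "f \<in> sqint M \<Longrightarrow> f \<in> borel_measurable M"
  by (simp add: sqint_def)

lemma sqint_integrable: "f \<in> sqint M \<Longrightarrow> integrable M (\<lambda>x. (cmod (f x))\<^sup>2)"
  by (simp add: sqint_def)

lemma nrm2_nonneg: "0 \<le> nrm2 M f"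
  by (simp add: nrm2_def)

lemma nrm2_power2: "(nrm2 M f)\<^sup>2 = (LINT x|M. (cmod (f x))\<^sup>2)"
  by (simp add: nrm2_def)

lemma sqint_bound:
  assumes "f \<in> borel_measurable M" "integrable M g"
    and "AE x in M. (cmod (f x))\<^sup>2 \<le> g x"
  shows "f \<in> sqint M"
  unfolding sqint_def
proof (safe)
  show "integrable M (\<lambda>x. (cmod (f x))\<^sup>2)"
    by (rule Bochner_Integration.integrable_bound[OF assms(2)]) (use assms in auto)
qed (use assms in auto)

lemma cmod_add_power2_le: "(cmod (a + b))\<^sup>2 \<le> 2 * (cmod a)\<^sup>2 + 2 * (cmod b)\<^sup>2"
proof -
  have "(cmod (a + b))\<^sup>2 \<le> (cmod a + cmod b)\<^sup>2"
    by (simp add: norm_triangle_ineq power_mono)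
  also have "\<dots> \<le> 2 * (cmod a)\<^sup>2 + 2 * (cmod b)\<^sup>2"
    using sum_squares_bound[of "cmod a" "cmod b"] by (simp add: power2_sum)
  finally show ?thesis .
qed

lemma sqint_add:
  assumes "f \<in> sqint M" "g \<in> sqint M"
  shows "(\<lambda>x. f x + g x) \<in> sqint M"
proof (rule sqint_bound)
  show "(\<lambda>x. f x + g x) \<in> borel_measurable M"
    using assms by (auto dest!: sqint_measurable)
  show "integrable M (\<lambda>x. 2 * (cmod (f x))\<^sup>2 + 2 * (cmod (g x))\<^sup>2)"
    using assms by (auto dest!: sqint_integrable)
qed (simp add: cmod_add_power2_le)

lemma sqint_cmult:
  assumes "f \<in> sqint M"
  shows "(\<lambda>x. c * f x) \<in> sqint M"
  using assms by (auto simp: sqint_def norm_mult power_mult_distrib)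

lemma sqint_diff:
  assumes "f \<in> sqint M" "g \<in> sqint M"
  shows "(\<lambda>x. f x - g x) \<in> sqint M"
  using sqint_add[OF assms(1) sqint_cmult[OF assms(2), of "-1"]] by simp

lemma sqint_zero: "(\<lambda>x. 0) \<in> sqint M"
  by (simp add: sqint_def)

lemma sqint_restrict:
  assumes "f \<in> sqint M" "{x \<in> space M. P x} \<in> sets M"
  shows "(\<lambda>x. if P x then f x else 0) \<in> sqint M"
proof (rule sqint_bound)
  show "(\<lambda>x. if P x then f x else 0) \<in> borel_measurable M"
    using assms(2) sqint_measurable[OF assms(1)] by (intro measurable_If) auto
  show "integrable M (\<lambda>x. (cmod (f x))\<^sup>2)"
    using assms by (auto dest!: sqint_integrable)
qed auto

lemma nrm2_zero_iff:
  assumes "f \<in> sqint M"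
  shows "nrm2 M f = 0 \<longleftrightarrow> (AE x in M. f x = 0)"
  using integral_nonneg_eq_0_iff_AE[OF sqint_integrable[OF assms]] by (simp add: nrm2_def)

lemma nrm2_mono_AE:
  assumes "g \<in> sqint M" "f \<in> borel_measurable M" "AE x in M. cmod (f x) \<le> cmod (g x)"
  shows "nrm2 M f \<le> nrm2 M g"
proof -
  have AE: "AE x in M. (cmod (f x))\<^sup>2 \<le> (cmod (g x))\<^sup>2"
    using assms(3) by eventually_elim (simp add: power_mono)
  have "f \<in> sqint M"
    by (rule sqint_bound[OF assms(2) sqint_integrable[OF assms(1)] AE])
  then show ?thesis
    unfolding nrm2_def using AE sqint_integrable assms(1)
    by (intro real_sqrt_le_mono integral_mono_AE) auto
qed

lemma nrm2_cmult: "nrm2 M (\<lambda>x. c * f x) = cmod c * nrm2 M f"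
  by (simp add: nrm2_def norm_mult power_mult_distrib real_sqrt_mult)

lemma integrable_mult_sqint:
  assumes "f \<in> sqint M" "g \<in> sqint M"
  shows "integrable M (\<lambda>x. f x * g x)"
proof (rule Bochner_Integration.integrable_bound)
  show "integrable M (\<lambda>x. (cmod (f x))\<^sup>2 + (cmod (g x))\<^sup>2)"
    using assms by (auto dest!: sqint_integrable)
  show "(\<lambda>x. f x * g x) \<in> borel_measurable M"
    using assms by (auto dest!: sqint_measurable)
  have "2 * (cmod a * cmod b) \<le> (cmod a)\<^sup>2 + (cmod b)\<^sup>2" for a b
    using sum_squares_bound[of "cmod a" "cmod b"] by simp
  moreover have "0 \<le> cmod a * cmod b" for a b by simp
  ultimately have "cmod a * cmod b \<le> (cmod a)\<^sup>2 + (cmod b)\<^sup>2" for a b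
    by (smt (verit))
  then show "AE x in M. norm (f x * g x) \<le> norm ((cmod (f x))\<^sup>2 + (cmod (g x))\<^sup>2)"
    by (simp add: norm_mult)
qed

lemma cnj_sqint: "f \<in> sqint M \<Longrightarrow> (\<lambda>x. cnj (f x)) \<in> sqint M"
  by (auto simp: sqint_def intro!: borel_measurable_continuous_on[of cnj] continuous_intros)

lemma integrable_inner_sqint:
  assumes "f \<in> sqint M" "g \<in> sqint M"
  shows "integrable M (\<lambda>x. f x * cnj (g x))"
  using integrable_mult_sqint[OF assms(1) cnj_sqint[OF assms(2)]] .

text \<open>Integration of the inequality of arithmetic and geometric means, weighted so that both
  terms on the right integrate to the same number. The weights are quotients of the norms, so
  vanishing norms are treated apart.\<close>

lemma Cauchy_Schwarz_nrm2:
  assumes f: "f \<in> sqint M" and g: "g \<in> sqint M"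
  shows "cmod (LINT x|M. f x * g x) \<le> nrm2 M f * nrm2 M g"
proof (cases "nrm2 M f = 0 \<or> nrm2 M g = 0")
  case True
  then have "AE x in M. f x * g x = 0"
    using nrm2_zero_iff[OF f] nrm2_zero_iff[OF g] by (auto elim!: eventually_mono)
  then have "(LINT x|M. f x * g x) = (LINT x|M. 0)"
    using f g by (intro integral_cong_AE) (auto dest!: sqint_measurable)
  then show ?thesis using True by auto
next
  case False
  define a b where "a = nrm2 M f" and "b = nrm2 M g"
  have ab: "a > 0" "b > 0"
    using False nrm2_nonneg[of M f] nrm2_nonneg[of M g] by (auto simp: a_def b_def)
  have amgm: "u * v \<le> (b / a * u\<^sup>2 + a / b * v\<^sup>2) / 2" for u v :: real
  proof -
    have "0 \<le> (b * u - a * v)\<^sup>2 / (a * b)" using ab by auto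
    also have "\<dots> = b / a * u\<^sup>2 + a / b * v\<^sup>2 - 2 * u * v"
      using ab by (simp add: power2_diff field_simps power2_eq_square)
    finally show ?thesis by simp
  qed
  have amgm': "norm (f x * g x) \<le> (b / a * (cmod (f x))\<^sup>2 + a / b * (cmod (g x))\<^sup>2) / 2" for x
    unfolding norm_mult by (rule amgm)
  have "cmod (LINT x|M. f x * g x) \<le> (LINT x|M. (b / a * (cmod (f x))\<^sup>2 + a / b * (cmod (g x))\<^sup>2) / 2)"
    using integrable_norm[OF integrable_mult_sqint[OF f g]] sqint_integrable[OF f] sqint_integrable[OF g]
    by (intro order_trans[OF integral_norm_bound] integral_mono amgm') auto
  also have "\<dots> = (b / a * (nrm2 M f)\<^sup>2 + a / b * (nrm2 M g)\<^sup>2) / 2"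
    using sqint_integrable[OF f] sqint_integrable[OF g] by (simp add: nrm2_power2)
  also have "\<dots> = a * b"
    using ab by (simp add: a_def[symmetric] b_def[symmetric] power2_eq_square)
  finally show ?thesis by (simp add: a_def b_def)
qed

lemma nrm2_cnj: "nrm2 M (\<lambda>x. cnj (f x)) = nrm2 M f"
  by (simp add: nrm2_def)

lemma Cauchy_Schwarz_inner_nrm2:
  assumes f: "f \<in> sqint M" and g: "g \<in> sqint M"
  shows "cmod (LINT x|M. f x * cnj (g x)) \<le> nrm2 M f * nrm2 M g"
  using Cauchy_Schwarz_nrm2[OF f cnj_sqint[OF g]] by (simp add: nrm2_cnj)

lemma nrm2_triangle:
  assumes f: "f \<in> sqint M" and g: "g \<in> sqint M"
  shows "nrm2 M (\<lambda>x. f x + g x) \<le> nrm2 M f + nrm2 M g"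
proof (rule power2_le_imp_le)
  have eq: "(cmod (f x + g x))\<^sup>2 = (cmod (f x))\<^sup>2 + 2 * Re (f x * cnj (g x)) + (cmod (g x))\<^sup>2" for x
    by (simp add: cmod_power2 power2_sum algebra_simps)
  have "(nrm2 M (\<lambda>x. f x + g x))\<^sup>2 =
      (nrm2 M f)\<^sup>2 + 2 * Re (LINT x|M. f x * cnj (g x)) + (nrm2 M g)\<^sup>2"
    using sqint_integrable[OF f] sqint_integrable[OF g] integrable_inner_sqint[OF f g]
    by (simp add: nrm2_power2 eq del: times_complex.simps)
  also have "\<dots> \<le> (nrm2 M f)\<^sup>2 + 2 * (nrm2 M f * nrm2 M g) + (nrm2 M g)\<^sup>2"
    using Cauchy_Schwarz_inner_nrm2[OF f g] complex_Re_le_cmod[of "LINT x|M. f x * cnj (g x)"]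
    by linarith
  finally show "(nrm2 M (\<lambda>x. f x + g x))\<^sup>2 \<le> (nrm2 M f + nrm2 M g)\<^sup>2"
    by (simp add: power2_sum algebra_simps)
qed (simp add: nrm2_nonneg)

text \<open>The almost everywhere limit is dominated by \<open>\<Sum>\<^sub>k 4\<^sup>k \<bar>g\<^sub>k\<bar>\<^sup>2\<close>, which is integrable.\<close>

lemma sqint_series_converges:
  fixes g :: "nat \<Rightarrow> 'a \<Rightarrow> complex"
  assumes g: "\<And>k. g k \<in> sqint M" and le: "\<And>k. nrm2 M (g k) \<le> (1/4)^k"
  obtains s where "s \<in> sqint M" "(\<lambda>n. nrm2 M (\<lambda>x. s x - (\<Sum>k<n. g k x))) \<longlonglongrightarrow> 0"
proof -
  note [measurable] = sqint_measurable[OF g]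
  have four: "(2::real)^k * 2^k = 4^k" for k
    by (simp add: power_mult_distrib[symmetric])
  have single_le: "F k \<le> (\<Sum>k. F k)" for F :: "nat \<Rightarrow> ennreal" and k
    using sum_le_suminf[of F "{k}"] by simp
  \<comment> \<open>By hypothesis the \<open>k\<close>-th square integral is at most
    \<open>16^-k\<close>. The weight \<open>4^k\<close> spends half of this decay: the series
    \<open>H\<close> still has a finite integral, and its finiteness at a point forces geometric
    decay of the terms there.\<close>
  define H where "H x = (\<Sum>k. ennreal (4^k * (cmod (g k x))\<^sup>2))" for x
  have [measurable]: "H \<in> borel_measurable M" unfolding H_def by measurable
  have "(\<integral>\<^sup>+x. H x \<partial>M) = (\<Sum>k. \<integral>\<^sup>+x. ennreal (4^k * (cmod (g k x))\<^sup>2) \<partial>M)"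
    unfolding H_def by (intro nn_integral_suminf) auto
  also have "\<dots> = (\<Sum>k. ennreal (4^k * (nrm2 M (g k))\<^sup>2))"
    unfolding nrm2_power2 using sqint_integrable[OF g]
    by (subst nn_integral_eq_integral) auto
  also have "\<dots> \<le> (\<Sum>k. ennreal ((1/4)^k))"
  proof (intro suminf_le allI ennreal_leI)
    fix k
    have "4^k * (nrm2 M (g k))\<^sup>2 \<le> 4^k * ((1/4::real)^k)\<^sup>2"
      using le[of k] nrm2_nonneg[of M "g k"] by (intro mult_left_mono power_mono) auto
    also have "\<dots> = (1/4)^k" by (simp add: power2_eq_square flip: power_mult_distrib)
    finally show "4^k * (nrm2 M (g k))\<^sup>2 \<le> (1/4)^k" .
  qed auto
  also have "\<dots> = ennreal (\<Sum>k. (1/4)^k)"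
    by (subst suminf_ennreal2) (auto intro: summable_geometric)
  also have "\<dots> < \<infinity>" by simp
  finally have Hfin: "(\<integral>\<^sup>+x. H x \<partial>M) < \<infinity>" .
  have AEfin: "AE x in M. H x \<noteq> \<infinity>"
    by (rule nn_integral_PInf_AE) (use Hfin in auto)
  define h where "h x = enn2real (H x)" for x
  have [measurable]: "h \<in> borel_measurable M" unfolding h_def by measurable
  have hint: "integrable M h"
  proof (rule integrableI_nonneg)
    have "(\<integral>\<^sup>+x. ennreal (h x) \<partial>M) = (\<integral>\<^sup>+x. H x \<partial>M)"
      by (rule nn_integral_cong_AE, use AEfin in eventually_elim)
        (simp add: h_def less_top)
    then show "(\<integral>\<^sup>+x. ennreal (h x) \<partial>M) < \<infinity>" using Hfin by simp
  qed (auto simp: h_def)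
  define s where "s x = (\<Sum>k. g k x)" for x
  have [measurable]: "s \<in> borel_measurable M" unfolding s_def by measurable
  \<comment> \<open>Each term is at most \<open>2^-k * sqrt (h x)\<close>, so the tail from
    \<open>n\<close> on is a geometric series, which accounts for the factor \<open>2\<close>. The
    case \<open>n = 0\<close> bounds \<open>s\<close> itself.\<close>
  have bound: "AE x in M. \<forall>n. cmod (s x - (\<Sum>k<n. g k x)) \<le> (1/2)^n * (2 * sqrt (h x))"
    using AEfin
  proof eventually_elim
    fix x assume fin: "H x \<noteq> \<infinity>"
    have t: "cmod (g k x) \<le> (1/2)^k * sqrt (h x)" for k
    proof -
      have "ennreal (4^k * (cmod (g k x))\<^sup>2) \<le> H x"
        unfolding H_def by (rule single_le)
      then have "4^k * (cmod (g k x))\<^sup>2 \<le> h x"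
        using fin unfolding h_def
        by (metis ennreal_enn2real enn2real_nonneg ennreal_le_iff infinity_ennreal_def less_top)
      then have "(2^k * cmod (g k x))\<^sup>2 \<le> h x"
        by (simp add: power_mult_distrib power2_eq_square[of "2^k"] four)
      then have "2^k * cmod (g k x) \<le> sqrt (h x)" by (rule real_le_rsqrt)
      then show ?thesis by (simp add: field_simps power_one_over)
    qed
    have geo: "summable (\<lambda>k. (1/2::real)^k * sqrt (h x))"
      by (intro summable_mult2 summable_geometric) auto
    have sm: "summable (\<lambda>k. norm (g k x))"
      by (rule summable_comparison_test[OF _ geo]) (use t in auto)
    show "\<forall>n. cmod (s x - (\<Sum>k<n. g k x)) \<le> (1/2)^n * (2 * sqrt (h x))"
    proof
      fix n
      have "s x - (\<Sum>k<n. g k x) = (\<Sum>k. g (k + n) x)"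
        unfolding s_def by (rule suminf_minus_initial_segment[symmetric])
          (rule summable_norm_cancel[OF sm])
      also have "cmod \<dots> \<le> (\<Sum>k. (1/2)^(k + n) * sqrt (h x))"
        using geo by (intro norm_suminf_le) (auto simp: t summable_ignore_initial_segment[of "\<lambda>k. (1/2::real)^k * sqrt (h x)"])
      also have "\<dots> = (\<Sum>k. (1/2)^k * ((1/2)^n * sqrt (h x)))"
        by (simp add: power_add mult_ac)
      also have "\<dots> = (1/2)^n * (2 * sqrt (h x))"
        by (subst suminf_mult2[symmetric]) (auto intro: summable_geometric simp: suminf_geometric)
      finally show "cmod (s x - (\<Sum>k<n. g k x)) \<le> (1/2)^n * (2 * sqrt (h x))" .
    qed
  qed
  have sums: "(\<lambda>x. \<Sum>k<n. g k x) \<in> sqint M" for n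
    by (induction n) (auto simp: sqint_zero intro: sqint_add g)
  have hpos: "h x \<ge> 0" for x by (simp add: h_def)
  have s: "s \<in> sqint M"
  proof (rule sqint_bound[where g="\<lambda>x. 4 * h x"])
    show "AE x in M. (cmod (s x))\<^sup>2 \<le> 4 * h x"
      using bound
    proof eventually_elim
      fix x assume "\<forall>n. cmod (s x - (\<Sum>k<n. g k x)) \<le> (1/2)^n * (2 * sqrt (h x))"
      from this[rule_format, of 0] have "(cmod (s x))\<^sup>2 \<le> (2 * sqrt (h x))\<^sup>2"
        by (intro power_mono) auto
      then show "(cmod (s x))\<^sup>2 \<le> 4 * h x" by (simp add: power_mult_distrib hpos)
    qed
  qed (use hint in auto)
  let ?c = "sqrt (4 * (LINT x|M. h x))"
  have "nrm2 M (\<lambda>x. s x - (\<Sum>k<n. g k x)) \<le> (1/2)^n * ?c" for n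
  proof -
    let ?r = "\<lambda>x. complex_of_real ((1/2)^n * (2 * sqrt (h x)))"
    have sq: "(cmod (?r x))\<^sup>2 = ((1/2)^n)\<^sup>2 * (4 * h x)" for x
      using hpos[of x] by (simp only: norm_of_real) (simp add: power_mult_distrib)
    have "nrm2 M (\<lambda>x. s x - (\<Sum>k<n. g k x)) \<le> nrm2 M ?r"
    proof (rule nrm2_mono_AE)
      show "?r \<in> sqint M"
        by (rule sqint_bound[where g="\<lambda>x. ((1/2)^n)\<^sup>2 * (4 * h x)"]) (use hint sq in auto)
      show "AE x in M. cmod (s x - (\<Sum>k<n. g k x)) \<le> cmod (?r x)"
        using bound by eventually_elim (simp add: hpos norm_mult norm_power del: of_real_mult of_real_power)
    qed measurable
    also have "nrm2 M ?r = (1/2)^n * ?c"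
      unfolding nrm2_def sq by (simp add: real_sqrt_mult)
    finally show ?thesis .
  qed
  moreover have "(\<lambda>n. (1/2::real)^n * ?c) \<longlonglongrightarrow> 0"
    by (intro tendsto_mult_left_zero LIMSEQ_power_zero) auto
  ultimately have "(\<lambda>n. nrm2 M (\<lambda>x. s x - (\<Sum>k<n. g k x))) \<longlonglongrightarrow> 0"
    by (rule_tac Lim_null_comparison[rotated]) (auto simp: nrm2_nonneg)
  with s show thesis by (rule that)
qed

section \<open>Test functions on the unit interval\<close>

lemma unit_interval_finite: "finite_measure unit_interval"
  by (rule finite_measure_lebesgue_on) (simp add: lmeasurable_interval)

lemma measure_unit_interval: "measure unit_interval {0..1} = 1"
  by (simp add: measure_restrict_space)

lemma AE_unit_interval_negligible:
  assumes "negligible N"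
  shows "AE x in unit_interval. x \<notin> N"
  using assms by (auto simp: AE_restrict_space_iff negligible_iff_null_sets dest: AE_not_in)

lemma negligible_AE_unit_interval:
  assumes "AE x in unit_interval. P x"
  shows "negligible {x \<in> {0..1}. \<not> P x}"
proof -
  have "AE x in lebesgue. x \<in> {0..1} \<longrightarrow> P x"
    using assms by (simp add: AE_restrict_space_iff)
  then show ?thesis
    by (auto simp: AE_iff_null_sets negligible_iff_null_sets eventually_ae_filter elim!: completion.complete2[rotated] intro!: null_sets_completion_subset)
qed

lemma L2_interval_eq_sqint: "L2_interval = sqint unit_interval"
  by (simp add: L2_interval_def sqint_def)

lemma sqnorm_interval_eq_nrm2: "sqnorm_interval f = (nrm2 unit_interval f)\<^sup>2"
  by (simp add: sqnorm_interval_def nrm2_power2)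

lemma continuous_on_measurable_unit_interval:
  fixes f :: "real \<Rightarrow> 'b::real_normed_vector"
  assumes "continuous_on {0..1} f"
  shows "f \<in> borel_measurable unit_interval"
  using assms by (intro continuous_imp_measurable_on_sets_lebesgue) auto

lemma continuous_on_sqint:
  assumes "continuous_on {0..1} f"
  shows "f \<in> sqint unit_interval"
  unfolding sqint_def
  using continuous_on_measurable_unit_interval[OF assms]
  by (auto intro!: continuous_imp_integrable_real continuous_intros assms)

lemma sqint_integrable_unit_interval:
  assumes "f \<in> sqint unit_interval"
  shows "integrable unit_interval f"
  using integrable_mult_sqint[OF assms continuous_on_sqint[of "\<lambda>x. 1"]] by simp

section \<open>Twice differentiable cutoff functions\<close>

lemma has_real_derivative_max0_power:
  "((\<lambda>y. (max 0 y) ^ Suc (Suc n)) has_real_derivative (of_nat (n + 2)) * (max 0 y) ^ Suc n) (at y)"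
proof -
  consider "y < 0" | "y = 0" | "y > 0" by linarith
  then show ?thesis
  proof cases
    case 1
    have "((\<lambda>y. 0) has_real_derivative of_nat (n + 2) * (max 0 y) ^ Suc n) (at y)"
      using 1 by (auto simp: max_def)
    then show ?thesis
      by (rule has_field_derivative_transform_within_open[of _ _ _ "{..<0}"]) (use 1 in \<open>auto simp: max_def\<close>)
  next
    case 2
    \<comment> \<open>Caratheodory's form of the derivative handles the kink:
      \<open>(max 0 z) ^ (n + 2)\<close> equals \<open>(max 0 z) ^ (n + 1) * z\<close> for every
      \<open>z\<close>, with a continuous first factor.\<close>
    have "isCont (\<lambda>z::real. (max 0 z) ^ Suc n) 0" by (intro continuous_intros)
    then show ?thesis unfolding CARAT_DERIV
      using 2 by (intro exI[of _ "\<lambda>z. (max 0 z) ^ Suc n"]) (auto simp: max_def)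
  next
    case 3
    have "((\<lambda>y. y ^ Suc (Suc n)) has_real_derivative of_nat (n + 2) * (max 0 y) ^ Suc n) (at y)"
      by (rule DERIV_cong[OF DERIV_pow]) (use 3 in \<open>auto simp: max_def\<close>)
    then show ?thesis
      by (rule has_field_derivative_transform_within_open[of _ _ _ "{0<..}"]) (use 3 in \<open>auto simp: max_def\<close>)
  qed
qed

text \<open>A transition from 0 on the left of \<open>0\<close> to 1 on the right of
  \<open>1\<close>. The cube of a positive part is twice continuously differentiable, so cubes at
  both joints give the two continuous derivatives that a field with its \<open>\<phi>\<close> and
  \<open>\<phi>'\<close> requires.\<close>

definition smooth_step :: "real \<Rightarrow> real" where
  "smooth_step y = 1 - (max 0 (1 - (max 0 y) ^ 3)) ^ 3"

definition smooth_step' :: "real \<Rightarrow> real" where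
  "smooth_step' y = 9 * (max 0 (1 - (max 0 y) ^ 3))\<^sup>2 * (max 0 y)\<^sup>2"

definition smooth_step'' :: "real \<Rightarrow> real" where
  "smooth_step'' y = 18 * (max 0 (1 - (max 0 y) ^ 3))\<^sup>2 * max 0 y
     - 54 * max 0 (1 - (max 0 y) ^ 3) * (max 0 y) ^ 4"

lemma max0_cube_deriv: "((\<lambda>y. (max 0 y) ^ 3) has_real_derivative 3 * (max 0 y)\<^sup>2) (at y)"
  using has_real_derivative_max0_power[of 1 y] by (simp add: numeral_eq_Suc)

lemma max0_square_deriv: "((\<lambda>y. (max 0 y)\<^sup>2) has_real_derivative 2 * (max 0 y)) (at y)"
  using has_real_derivative_max0_power[of 0 y] by (simp add: numeral_eq_Suc)

lemma smooth_step_deriv: "(smooth_step has_real_derivative smooth_step' y) (at y)"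
  unfolding smooth_step_def[abs_def] smooth_step'_def
  by (rule DERIV_cong[OF DERIV_diff[OF DERIV_const DERIV_chain2[OF max0_cube_deriv
        DERIV_diff[OF DERIV_const max0_cube_deriv]]]]) simp

lemma smooth_step'_deriv: "(smooth_step' has_real_derivative smooth_step'' y) (at y)"
  unfolding smooth_step'_def[abs_def] smooth_step''_def
  by (rule DERIV_cong[OF DERIV_mult[OF DERIV_cmult[OF DERIV_chain2[OF max0_square_deriv
        DERIV_diff[OF DERIV_const max0_cube_deriv]]] max0_square_deriv]])
    (simp add: algebra_simps numeral_eq_Suc)

lemma smooth_step''_continuous: "continuous_on UNIV smooth_step''"
  unfolding smooth_step''_def[abs_def] by (intro continuous_intros)

lemma smooth_step_nonpos: "y \<le> 0 \<Longrightarrow> smooth_step y = 0"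
  by (simp add: smooth_step_def max_def)

lemma smooth_step'_nonpos: "y \<le> 0 \<Longrightarrow> smooth_step' y = 0"
  by (simp add: smooth_step'_def max_def)

lemma smooth_step_ge1: "y \<ge> 1 \<Longrightarrow> smooth_step y = 1"
  using one_le_power[of y 3] by (simp add: smooth_step_def)

lemma smooth_step'_ge1: "y \<ge> 1 \<Longrightarrow> smooth_step' y = 0"
  using one_le_power[of y 3] by (simp add: smooth_step'_def)

lemma smooth_step_bounds: "0 \<le> smooth_step y" "smooth_step y \<le> 1"
proof -
  have "max 0 (1 - (max 0 y) ^ 3) \<le> 1" by auto
  then have "(max 0 (1 - (max 0 y) ^ 3)) ^ 3 \<le> (1::real) ^ 3" by (intro power_mono) auto
  then show "0 \<le> smooth_step y" "smooth_step y \<le> 1" by (auto simp: smooth_step_def)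
qed

lemma smooth_step_pos: "0 < y \<Longrightarrow> 0 < smooth_step y"
proof -
  assume "0 < y"
  then have "max 0 (1 - (max 0 y) ^ 3) < 1" by auto
  then have "(max 0 (1 - (max 0 y) ^ 3)) ^ 3 < (1::real) ^ 3" by (intro power_strict_mono) auto
  then show "0 < smooth_step y" by (auto simp: smooth_step_def)
qed

lemma smooth_step_continuous: "continuous_on S smooth_step" "continuous_on S smooth_step'"
  by (rule DERIV_continuous_on, rule DERIV_subset[OF smooth_step_deriv], simp)
    (rule DERIV_continuous_on, rule DERIV_subset[OF smooth_step'_deriv], simp)

lemma has_vector_derivative_of_realI:
  assumes "(f has_real_derivative d) (at x)"
  shows "((\<lambda>x. complex_of_real (f x)) has_vector_derivative of_real d) (at x)"
  using assms
  by (simp add: has_real_derivative_iff_has_vector_derivative has_vector_derivative_of_real)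

text \<open>Complex counterpart of \<open>test_function\<close>, introduced because derivatives of
  complex fields serve as test functions. \<open>has_weak_deriv_complex_test\<close> reduces it to
  real and imaginary parts.\<close>

definition complex_test :: "(real \<Rightarrow> complex) \<Rightarrow> (real \<Rightarrow> complex) \<Rightarrow> bool" where
  "complex_test \<phi> \<phi>' \<longleftrightarrow>
     (\<forall>x. (\<phi> has_vector_derivative \<phi>' x) (at x)) \<and> continuous_on UNIV \<phi>' \<and>
     (\<exists>a b. 0 < a \<and> b < 1 \<and> (\<forall>x. x \<notin> {a..b} \<longrightarrow> \<phi> x = 0))"

lemma complex_test_deriv: "complex_test \<phi> \<phi>' \<Longrightarrow> (\<phi> has_vector_derivative \<phi>' x) (at x)"
  by (simp add: complex_test_def)

lemma vector_derivative_imp_continuous_on: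
  assumes "\<And>x. (f has_vector_derivative f' x) (at x)"
  shows "continuous_on S f"
  by (rule continuous_on_vector_derivative) (use assms has_vector_derivative_at_within in blast)

lemma complex_test_continuous:
  assumes "complex_test \<phi> \<phi>'"
  shows "continuous_on S \<phi>" "continuous_on S \<phi>'"
  using assms by (auto simp: complex_test_def intro: vector_derivative_imp_continuous_on continuous_on_subset)

lemma complex_test_sqint:
  assumes "complex_test \<phi> \<phi>'"
  shows "\<phi> \<in> sqint unit_interval" "\<phi>' \<in> sqint unit_interval"
  using complex_test_continuous[OF assms] by (auto intro: continuous_on_sqint)

lemma complex_test_of_real:
  assumes "test_function \<phi> \<phi>'"
  shows "complex_test (\<lambda>x. of_real (\<phi> x)) (\<lambda>x. of_real (\<phi>' x))"
  using assms unfolding complex_test_def test_function_def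
  by (auto intro!: continuous_intros has_vector_derivative_of_real simp: has_real_derivative_iff_has_vector_derivative)

lemma complex_test_Re_Im:
  assumes "complex_test \<phi> \<phi>'"
  shows "test_function (\<lambda>x. Re (\<phi> x)) (\<lambda>x. Re (\<phi>' x))" "test_function (\<lambda>x. Im (\<phi> x)) (\<lambda>x. Im (\<phi>' x))"
  using assms unfolding complex_test_def test_function_def
  by (auto intro!: continuous_intros bounded_linear.has_vector_derivative[OF bounded_linear_Re]
      bounded_linear.has_vector_derivative[OF bounded_linear_Im]
      simp: has_real_derivative_iff_has_vector_derivative) (metis complex.sel zero_complex.sel)+

lemma has_weak_deriv_complex_test:
  assumes "has_weak_deriv f g" "complex_test \<phi> \<phi>'"
  shows "(LINT x|unit_interval. f x * \<phi>' x) = - (LINT x|unit_interval. g x * \<phi> x)"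
proof -
  have f: "f \<in> sqint unit_interval" and g: "g \<in> sqint unit_interval"
    using assms(1) by (auto simp: has_weak_deriv_def L2_interval_eq_sqint)
  have split: "(LINT x|unit_interval. h x * \<psi> x) =
      (LINT x|unit_interval. h x * of_real (Re (\<psi> x))) + \<i> * (LINT x|unit_interval. h x * of_real (Im (\<psi> x)))"
    if h: "h \<in> sqint unit_interval" and c: "continuous_on UNIV \<psi>" for h \<psi>
  proof -
    have "continuous_on {0..1} \<psi>" using c continuous_on_subset by blast
    then have "integrable unit_interval (\<lambda>x. h x * of_real (Re (\<psi> x)))"
      "integrable unit_interval (\<lambda>x. h x * of_real (Im (\<psi> x)))"
      by (auto intro!: integrable_mult_sqint h continuous_on_sqint continuous_intros)
    moreover have "h x * \<psi> x = h x * of_real (Re (\<psi> x)) + \<i> * (h x * of_real (Im (\<psi> x)))" for x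
      by (subst (1) complex_eq[of "\<psi> x"]) (simp add: algebra_simps)
    ultimately show ?thesis by simp
  qed
  show ?thesis
    using assms(1) complex_test_Re_Im[OF assms(2)] split[OF f, of \<phi>'] split[OF g, of \<phi>]
      complex_test_continuous[OF assms(2)]
    unfolding has_weak_deriv_def by (simp add: algebra_simps)
qed

section \<open>Density of test functions in L^2(0,1)\<close>

lemma nrm2_dominated_convergence:
  assumes f: "f \<in> borel_measurable M" and s: "\<And>n. s n \<in> borel_measurable M" and w: "w \<in> sqint M"
    and lim: "AE x in M. (\<lambda>n. s n x) \<longlonglongrightarrow> f x"
    and bound: "\<And>n. AE x in M. cmod (f x - s n x) \<le> cmod (w x)"
  shows "(\<lambda>n. nrm2 M (\<lambda>x. f x - s n x)) \<longlonglongrightarrow> 0"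
proof -
  have "(\<lambda>n. LINT x|M. (cmod (f x - s n x))\<^sup>2) \<longlonglongrightarrow> (LINT x|M. 0)"
  proof (rule integral_dominated_convergence[where w="\<lambda>x. (cmod (w x))\<^sup>2"])
    show "AE x in M. (\<lambda>n. (cmod (f x - s n x))\<^sup>2) \<longlonglongrightarrow> 0"
      using lim
    proof eventually_elim
      fix x assume "(\<lambda>n. s n x) \<longlonglongrightarrow> f x"
      then have "(\<lambda>n. (cmod (f x - s n x))\<^sup>2) \<longlonglongrightarrow> (cmod (f x - f x))\<^sup>2"
        by (intro tendsto_intros)
      then show "(\<lambda>n. (cmod (f x - s n x))\<^sup>2) \<longlonglongrightarrow> 0" by simp
    qed
    show "AE x in M. norm ((cmod (f x - s n x))\<^sup>2) \<le> (cmod (w x))\<^sup>2" for n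
      using bound[of n] by eventually_elim (auto intro: power_mono)
  qed (use f s w sqint_integrable in auto)
  then have "(\<lambda>n. sqrt (LINT x|M. (cmod (f x - s n x))\<^sup>2)) \<longlonglongrightarrow> sqrt 0"
    by (intro tendsto_intros) simp
  then show ?thesis by (simp add: nrm2_def)
qed

text \<open>The parabola \<open>x * (1 - x)\<close> is positive exactly on the open interval. The
  cutoff therefore vanishes near both ends, while at a fixed interior point it equals
  \<open>1\<close> as soon as \<open>n * (x * (1 - x)) \<ge> 2\<close>. The polynomial factor has
  derivatives of all orders, the cutoff two.\<close>

lemma complex_test_cutoff_polynomial:
  assumes "polynomial_function p" "0 \<le> (n::real)"
  obtains F' F'' where
    "complex_test (\<lambda>x. of_real (smooth_step (n * (x * (1 - x)) - 1)) * p x) F'" "complex_test F' F''"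
proof -
  obtain p' where p': "polynomial_function p'" "\<And>x. (p has_vector_derivative p' x) (at x)"
    using has_vector_derivative_polynomial_function[OF assms(1)] by blast
  obtain p'' where p'': "polynomial_function p''" "\<And>x. (p' has_vector_derivative p'' x) (at x)"
    using has_vector_derivative_polynomial_function[OF p'(1)] by blast
  let ?q = "\<lambda>x::real. n * (x * (1 - x)) - 1" and ?q' = "\<lambda>x::real. n * (1 - 2 * x)"
  have q: "(?q has_real_derivative ?q' x) (at x)" for x
    by (auto intro!: derivative_eq_intros simp: algebra_simps)
  have q': "(?q' has_real_derivative - 2 * n) (at x)" for x
    by (auto intro!: derivative_eq_intros simp: algebra_simps)
  define S' where "S' x = smooth_step' (?q x) * ?q' x" for x
  define S'' where "S'' x = smooth_step'' (?q x) * ?q' x * ?q' x + smooth_step' (?q x) * (- 2 * n)" for x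
  have S: "((\<lambda>x. complex_of_real (smooth_step (?q x))) has_vector_derivative of_real (S' x)) (at x)" for x
    unfolding S'_def
    by (rule has_vector_derivative_of_realI[OF DERIV_chain2[OF smooth_step_deriv q]])
  have S1: "((\<lambda>x. complex_of_real (S' x)) has_vector_derivative of_real (S'' x)) (at x)" for x
    unfolding S'_def[abs_def] S''_def
    by (rule has_vector_derivative_of_realI, rule DERIV_cong[OF DERIV_mult[OF DERIV_chain2[OF smooth_step'_deriv q] q']]) simp
  define F' where "F' x = of_real (S' x) * p x + of_real (smooth_step (?q x)) * p' x" for x
  define F'' where "F'' x = of_real (S'' x) * p x + 2 * of_real (S' x) * p' x + of_real (smooth_step (?q x)) * p'' x" for x
  have F: "((\<lambda>x. of_real (smooth_step (?q x)) * p x) has_vector_derivative F' x) (at x)" for x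
    using has_vector_derivative_mult[OF S p'(2), of x] by (simp add: F'_def add_ac)
  have F1: "(F' has_vector_derivative F'' x) (at x)" for x
    unfolding F'_def[abs_def]
    using has_vector_derivative_add[OF has_vector_derivative_mult[OF S1 p'(2), of x] has_vector_derivative_mult[OF S p''(2), of x]]
    by (simp add: F''_def algebra_simps)
  have cF1: "continuous_on UNIV F'"
    by (rule vector_derivative_imp_continuous_on[OF F1])
  have cF2: "continuous_on UNIV F''"
    unfolding F''_def S''_def S'_def
    by (intro continuous_intros continuous_on_compose2[OF smooth_step''_continuous] continuous_on_compose2[OF smooth_step_continuous(1)]
        continuous_on_compose2[OF smooth_step_continuous(2)] continuous_on_polymonial_function p' p'' assms) auto
  \<comment> \<open>For \<open>0 < x < 1\<close> the product \<open>x * (1 - x)\<close> is at most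
    the distance of \<open>x\<close> to either end. For \<open>n < 1\<close> the interval is empty,
    which the definition of \<open>complex_test\<close> permits.\<close>
  have supp: "?q x \<le> 0" if "x \<notin> {1 / (n + 1)..1 - 1 / (n + 1)}" for x
  proof -
    consider "x \<le> 0" | "0 < x" "x < 1" | "x \<ge> 1" by linarith
    then show ?thesis
    proof cases
      case 1
      then have "x * (1 - x) \<le> 0" by (intro mult_nonpos_nonneg) auto
      then have "n * (x * (1 - x)) \<le> 0" by (rule mult_nonneg_nonpos[OF assms(2)])
      then show ?thesis by simp
    next
      case 2
      have "x < 1 / (n + 1) \<or> 1 - x < 1 / (n + 1)" using that by auto
      moreover have "x * (1 - x) \<le> x" "x * (1 - x) \<le> 1 - x"
        using 2 by (auto simp: mult_left_le mult_right_le_one_le mult_left_le_one_le)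
      ultimately have "x * (1 - x) \<le> 1 / (n + 1)" by linarith
      then have "n * (x * (1 - x)) \<le> n * (1 / (n + 1))" using assms(2) by (intro mult_left_mono) auto
      also have "\<dots> \<le> 1" using assms(2) by (simp add: field_simps)
      finally show ?thesis by simp
    next
      case 3
      then have "x * (1 - x) \<le> 0" by (intro mult_nonneg_nonpos) auto
      then have "n * (x * (1 - x)) \<le> 0" by (rule mult_nonneg_nonpos[OF assms(2)])
      then show ?thesis by simp
    qed
  qed
  have ab: "0 < 1 / (n + 1)" "1 - 1 / (n + 1) < 1" using assms(2) by auto
  show thesis
  proof (rule that)
    show "complex_test (\<lambda>x. of_real (smooth_step (?q x)) * p x) F'"
      unfolding complex_test_def using F cF1 ab supp
      by (intro conjI exI[of _ "1 / (n + 1)"] exI[of _ "1 - 1 / (n + 1)"]) (auto simp: smooth_step_nonpos)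
    show "complex_test F' F''"
      unfolding complex_test_def using F1 cF2 ab supp
      by (intro conjI exI[of _ "1 / (n + 1)"] exI[of _ "1 - 1 / (n + 1)"])
        (auto simp: F'_def S'_def smooth_step_nonpos smooth_step'_nonpos)
  qed
qed

text \<open>Measurability provides continuous functions converging almost everywhere. They are made
  uniformly bounded, replaced by polynomials and cut off near the ends; the common bound then turns
  pointwise convergence into L^2 convergence.\<close>

lemma complex_test_dense_bounded:
  assumes f: "f \<in> borel_measurable unit_interval" and B: "0 \<le> B" "\<And>x. x \<in> {0..1} \<Longrightarrow> cmod (f x) \<le> B" and "\<epsilon> > 0"
  obtains F F' F'' where "complex_test F F'" "complex_test F' F''"
    "nrm2 unit_interval (\<lambda>x. f x - F x) < \<epsilon>"
proof -
  have "f measurable_on {0..1}"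
    using f by (subst measurable_on_iff_borel_measurable) auto
  then obtain N g where N: "negligible N" and g: "\<And>n. continuous_on UNIV (g n)"
    and lim: "\<And>x. x \<notin> N \<Longrightarrow> (\<lambda>n. g n x) \<longlonglongrightarrow> (if x \<in> {0..1} then f x else 0)"
    unfolding measurable_on_def by blast
  \<comment> \<open>Projecting onto the closed ball bounds the approximants by \<open>B\<close>
    without spoiling the limit, since the projection is continuous and fixes the values of
    \<open>f\<close>.\<close>
  let ?C = "cball (0::complex) B"
  have C: "convex ?C" "closed ?C" "?C \<noteq> {}" using B by auto
  define k where "k n x = closest_point ?C (g n x)" for n x
  have kc: "continuous_on S (k n)" for n S
    unfolding k_def
    by (rule continuous_on_compose2[OF continuous_on_closest_point[OF C, of UNIV]])
      (auto intro: continuous_on_subset[OF g])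
  have kB: "cmod (k n x) \<le> B" for n x
    using closest_point_in_set[OF C(2,3), of "g n x"] by (simp add: k_def)
  have "\<exists>p. polynomial_function p \<and> (\<forall>x\<in>{0..1}. cmod (k n x - p x) < 1 / (1 + real n))" for n
    by (rule Stone_Weierstrass_polynomial_function[OF compact_Icc kc]) auto
  then obtain p where p: "\<And>n. polynomial_function (p n)"
    and pk: "\<And>n x. x \<in> {0..1} \<Longrightarrow> cmod (k n x - p n x) < 1 / (1 + real n)" by metis
  define F where "F n x = of_real (smooth_step (real n * (x * (1 - x)) - 1)) * p n x" for n x
  have "\<exists>F' F''. complex_test (F n) F' \<and> complex_test F' F''" for n
    unfolding F_def using complex_test_cutoff_polynomial[OF p, of "real n" n] by (metis of_nat_0_le_iff)
  then obtain F' F'' where F: "\<And>n. complex_test (F n) (F' n)" "\<And>n. complex_test (F' n) (F'' n)" by metis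
  have FB: "cmod (F n x) \<le> B + 1" if "x \<in> {0..1}" for n x
  proof -
    have "cmod (p n x) \<le> cmod (k n x) + cmod (k n x - p n x)"
      by (metis norm_minus_commute norm_triangle_sub)
    also have "\<dots> \<le> B + 1"
    proof -
      have "1 / (1 + real n) \<le> 1" by simp
      then show ?thesis using kB[of n x] pk[OF that, of n] by linarith
    qed
    finally have "cmod (p n x) \<le> B + 1" .
    moreover have "cmod (F n x) \<le> 1 * cmod (p n x)"
      unfolding F_def norm_mult using smooth_step_bounds by (intro mult_right_mono) auto
    ultimately show ?thesis by simp
  qed
  have "(\<lambda>n. nrm2 unit_interval (\<lambda>x. f x - F n x)) \<longlonglongrightarrow> 0"
  \<comment> \<open>The dominating constant is \<open>B\<close> for \<open>f\<close> plus
    \<open>B + 1\<close> for \<open>F n\<close>, whose polynomial stays within \<open>1\<close> of a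
    function bounded by \<open>B\<close>.\<close>
  proof (rule nrm2_dominated_convergence[where w="\<lambda>_. of_real (2 * B + 1)"])
    show "F n \<in> borel_measurable unit_interval" for n
      using complex_test_sqint(1)[OF F(1)] by (rule sqint_measurable)
    show "(\<lambda>_. of_real (2 * B + 1)) \<in> sqint unit_interval"
      by (intro continuous_on_sqint continuous_intros)
    show "AE x in unit_interval. cmod (f x - F n x) \<le> cmod (of_real (2 * B + 1))" for n
    proof (rule AE_I2)
      fix x assume "x \<in> space unit_interval"
      then have x: "x \<in> {0..1}" by simp
      have "cmod (f x - F n x) \<le> cmod (f x) + cmod (F n x)" by (rule norm_triangle_ineq4)
      also have "\<dots> \<le> 2 * B + 1" using B(2)[OF x] FB[OF x, of n] by simp
      also have "\<dots> = cmod (of_real (2 * B + 1))" using B(1) by (simp only: norm_of_real)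
      finally show "cmod (f x - F n x) \<le> cmod (of_real (2 * B + 1))" .
    qed
    show "AE x in unit_interval. (\<lambda>n. F n x) \<longlonglongrightarrow> f x"
    proof -
      have "AE x in unit_interval. x \<notin> N \<union> {0, 1}"
        by (rule AE_unit_interval_negligible) (use N in auto)
      then show ?thesis
        using AE_space
      proof eventually_elim
        fix x assume "x \<notin> N \<union> {0, 1}" "x \<in> space unit_interval"
        then have x: "x \<notin> N" "0 < x" "x < 1" "x \<in> {0..1}" by auto
        have "(\<lambda>n. k n x) \<longlonglongrightarrow> closest_point ?C (f x)"
          unfolding k_def
          using continuous_at_closest_point[OF C] lim[OF x(1)] x(4)
          by (intro isCont_tendsto_compose[of _ "closest_point ?C"]) auto
        also have "closest_point ?C (f x) = f x"
          by (rule closest_point_self) (use B(2)[OF x(4)] in auto)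
        finally have k: "(\<lambda>n. k n x) \<longlonglongrightarrow> f x" .
        have "(\<lambda>n. k n x - p n x) \<longlonglongrightarrow> 0"
        proof (rule Lim_null_comparison)
          show "\<forall>\<^sub>F n in sequentially. norm (k n x - p n x) \<le> 1 / (1 + real n)"
            by (intro always_eventually allI less_imp_le pk x)
          show "(\<lambda>n. 1 / (1 + real n)) \<longlonglongrightarrow> 0"
            using LIMSEQ_inverse_real_of_nat by (simp add: inverse_eq_divide)
        qed
        from tendsto_diff[OF k this] have p_lim: "(\<lambda>n. p n x) \<longlonglongrightarrow> f x" by simp
        show "(\<lambda>n. F n x) \<longlonglongrightarrow> f x"
        proof (rule Lim_transform_eventually[OF p_lim])
          obtain m where m: "2 / (x * (1 - x)) \<le> real m" using real_arch_simple by blast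
          show "\<forall>\<^sub>F n in sequentially. p n x = F n x"
            using eventually_ge_at_top[of m]
          proof eventually_elim
            fix n assume "m \<le> n"
            have pos: "0 < x * (1 - x)" using x by simp
            have "2 / (x * (1 - x)) \<le> real n" using m \<open>m \<le> n\<close> by linarith
            then have "2 \<le> real n * (x * (1 - x))" using pos by (simp only: pos_divide_le_eq)
            then show "p n x = F n x" by (simp add: F_def smooth_step_ge1)
          qed
        qed
      qed
    qed
  qed (rule f)
  from order_tendstoD(2)[OF this \<open>\<epsilon> > 0\<close>] obtain n where "nrm2 unit_interval (\<lambda>x. f x - F n x) < \<epsilon>"
    using eventually_happens' sequentially_bot by blast
  with F show thesis by (intro that)
qed

text \<open>Discarding the values of \<open>f\<close> above the height \<open>n\<close> leaves
  bounded functions; their distance to \<open>f\<close> is dominated by \<open>f\<close>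
  itself.\<close>

lemma complex_test_dense:
  assumes f: "f \<in> sqint unit_interval" and "\<epsilon> > 0"
  obtains F F' F'' where "complex_test F F'" "complex_test F' F''"
    "nrm2 unit_interval (\<lambda>x. f x - F x) < \<epsilon>"
proof -
  note [measurable] = sqint_measurable[OF f]
  define h where "h n x = (if cmod (f x) \<le> real n then f x else 0)" for n x
  have [measurable]: "h n \<in> borel_measurable unit_interval" for n unfolding h_def by measurable
  have "(\<lambda>n. nrm2 unit_interval (\<lambda>x. f x - h n x)) \<longlonglongrightarrow> 0"
  proof (rule nrm2_dominated_convergence[OF _ _ f])
    have "(\<lambda>n. h n x) \<longlonglongrightarrow> f x" for x
    proof (rule Lim_transform_eventually[OF tendsto_const])
      obtain m where m: "cmod (f x) \<le> real m" using real_arch_simple by blast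
      show "\<forall>\<^sub>F n in sequentially. f x = h n x"
        using eventually_ge_at_top[of m] by eventually_elim (use m in \<open>auto simp: h_def\<close>)
    qed
    then show "AE x in unit_interval. (\<lambda>n. h n x) \<longlonglongrightarrow> f x" by simp
  qed (auto simp: h_def)
  moreover have "\<epsilon> / 2 > 0" using \<open>\<epsilon> > 0\<close> by simp
  ultimately obtain n where n: "nrm2 unit_interval (\<lambda>x. f x - h n x) < \<epsilon> / 2"
    using eventually_happens' sequentially_bot order_tendstoD(2) by blast
  obtain F F' F'' where F: "complex_test F F'" "complex_test F' F''"
    "nrm2 unit_interval (\<lambda>x. h n x - F x) < \<epsilon> / 2"
    by (rule complex_test_dense_bounded[of "h n" "real n" "\<epsilon> / 2"]) (use \<open>\<epsilon> > 0\<close> in \<open>auto simp: h_def\<close>)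
  have hs: "h n \<in> sqint unit_interval"
    by (rule sqint_bound[OF _ sqint_integrable[OF f]]) (auto simp: h_def)
  have "nrm2 unit_interval (\<lambda>x. f x - F x) = nrm2 unit_interval (\<lambda>x. (f x - h n x) + (h n x - F x))"
    by simp
  also have "\<dots> \<le> nrm2 unit_interval (\<lambda>x. f x - h n x) + nrm2 unit_interval (\<lambda>x. h n x - F x)"
    by (intro nrm2_triangle sqint_diff f hs complex_test_sqint(1)[OF F(1)])
  also have "\<dots> < \<epsilon>" using n F(3) by simp
  finally show thesis using that F(1,2) by blast
qed

text \<open>The squared norm is the integral of \<open>w * cnj w\<close>. Approximating
  \<open>cnj w\<close> by a test function, against which \<open>w\<close> integrates to zero, bounds
  it by \<open>\<epsilon>\<close> times the norm.\<close>

lemma fundamental_lemma_unit_interval: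
  assumes w: "w \<in> sqint unit_interval"
    and orth: "\<And>\<phi> \<phi>'. complex_test \<phi> \<phi>' \<Longrightarrow> (LINT x|unit_interval. w x * \<phi> x) = 0"
  shows "AE x in unit_interval. w x = 0"
proof -
  have le: "(nrm2 unit_interval w)\<^sup>2 \<le> nrm2 unit_interval w * \<epsilon>" if "\<epsilon> > 0" for \<epsilon> :: real
  proof -
    obtain F F' F'' where F: "complex_test F F'" and lt: "nrm2 unit_interval (\<lambda>x. cnj (w x) - F x) < \<epsilon>"
      using complex_test_dense[OF cnj_sqint[OF w] \<open>\<epsilon> > 0\<close>] by metis
    note Fs = complex_test_sqint(1)[OF F]
    have "complex_of_real ((nrm2 unit_interval w)\<^sup>2) = (LINT x|unit_interval. w x * cnj (w x))"
      unfolding nrm2_power2 by (simp add: complex_norm_square[symmetric] flip: integral_complex_of_real)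
    also have "\<dots> = (LINT x|unit_interval. w x * (cnj (w x) - F x)) + (LINT x|unit_interval. w x * F x)"
      by (subst Bochner_Integration.integral_add[symmetric])
        (auto intro!: integrable_mult_sqint w sqint_diff cnj_sqint Fs simp: algebra_simps)
    also have "\<dots> = (LINT x|unit_interval. w x * (cnj (w x) - F x))" using orth[OF F] by simp
    finally have "(nrm2 unit_interval w)\<^sup>2 = cmod (LINT x|unit_interval. w x * (cnj (w x) - F x))"
      by (metis abs_power2 norm_of_real)
    also have "\<dots> \<le> nrm2 unit_interval w * nrm2 unit_interval (\<lambda>x. cnj (w x) - F x)"
      by (intro Cauchy_Schwarz_nrm2 sqint_diff cnj_sqint w Fs)
    also have "\<dots> \<le> nrm2 unit_interval w * \<epsilon>"
      using lt by (intro mult_left_mono) (auto simp: nrm2_nonneg)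
    finally show ?thesis .
  qed
  have "nrm2 unit_interval w = 0"
  proof (rule ccontr)
    assume "nrm2 unit_interval w \<noteq> 0"
    then have pos: "nrm2 unit_interval w > 0" using nrm2_nonneg[of unit_interval w] by linarith
    from le[of "nrm2 unit_interval w / 2"] pos show False by (simp add: power2_eq_square)
  qed
  then show ?thesis using nrm2_zero_iff[OF w] by simp
qed

lemma has_weak_deriv_unique:
  assumes "has_weak_deriv f g" "has_weak_deriv f h"
  shows "AE x in unit_interval. g x = h x"
proof -
  have g: "g \<in> sqint unit_interval" and h: "h \<in> sqint unit_interval"
    using assms by (auto simp: has_weak_deriv_def L2_interval_eq_sqint)
  have "AE x in unit_interval. g x - h x = 0"
  proof (rule fundamental_lemma_unit_interval[OF sqint_diff[OF g h]])
    fix \<phi> \<phi>' assume \<phi>: "complex_test \<phi> \<phi>'"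
    have "(LINT x|unit_interval. (g x - h x) * \<phi> x) =
        (LINT x|unit_interval. g x * \<phi> x) - (LINT x|unit_interval. h x * \<phi> x)"
      unfolding left_diff_distrib
      by (intro Bochner_Integration.integral_diff integrable_mult_sqint g h complex_test_sqint[OF \<phi>])
    then show "(LINT x|unit_interval. (g x - h x) * \<phi> x) = 0"
      using has_weak_deriv_complex_test[OF assms(1) \<phi>] has_weak_deriv_complex_test[OF assms(2) \<phi>] by simp
  qed
  then show ?thesis by eventually_elim simp
qed

section \<open>The Sobolev space of the unit interval\<close>

lemma has_weak_deriv_sqint:
  assumes "has_weak_deriv f g"
  shows "f \<in> sqint unit_interval" "g \<in> sqint unit_interval"
  using assms by (auto simp: has_weak_deriv_def L2_interval_eq_sqint)

text \<open>The vanishing mean makes the primitive from \<open>0\<close> vanish again to the right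
  of the support.\<close>

lemma complex_test_antiderivative:
  fixes \<Psi> :: "real \<Rightarrow> complex"
  assumes c: "continuous_on UNIV \<Psi>" and ab: "0 < a" "a \<le> b" "b < 1" "\<And>x. x \<notin> {a..b} \<Longrightarrow> \<Psi> x = 0"
    and zero: "(LINT x|unit_interval. \<Psi> x) = 0"
  obtains \<Phi> where "complex_test \<Phi> \<Psi>"
proof -
  define \<Phi> where "\<Phi> x = integral {0..x} \<Psi>" for x
  have cS: "continuous_on S \<Psi>" for S using c continuous_on_subset by blast
  have int: "\<Psi> integrable_on {x..y}" for x y by (rule integrable_continuous_real[OF cS])
  have left: "\<Phi> x = 0" if "x < a" for x
  proof -
    have "integral {0..x} \<Psi> = integral {0..x} (\<lambda>_. 0)"
      by (rule Henstock_Kurzweil_Integration.integral_cong) (use that ab in auto)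
    then show ?thesis by (simp add: \<Phi>_def)
  qed
  have "integral {0..1} \<Psi> = 0"
    using zero lebesgue_integral_eq_integral[OF continuous_imp_integrable_real[OF cS, of 0 1]] by simp
  \<comment> \<open>The hypothesis on the support leaves the value at \<open>b\<close> open, so this
    point is discarded as a null set.\<close>
  moreover have right': "integral {b..y} \<Psi> = 0" for y
  proof -
    have "integral {b..y} \<Psi> = integral {b..y} (\<lambda>_. 0)"
    proof (rule integral_spike[of "{b}"])
      show "0 = \<Psi> x" if "x \<in> {b..y} - {b}" for x using ab(4)[of x] that by auto
    qed auto
    then show ?thesis by simp
  qed
  ultimately have "integral {0..b} \<Psi> = 0"
    using Henstock_Kurzweil_Integration.integral_combine[OF _ _ int, of 0 b 1] ab by simp
  then have right: "\<Phi> x = 0" if "x > b" for x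
    unfolding \<Phi>_def using right'[of x] that ab
      Henstock_Kurzweil_Integration.integral_combine[OF _ _ int, of 0 b x] by simp
  have "(\<Phi> has_vector_derivative \<Psi> x) (at x)" for x
  proof (cases "x < a")
    case True
    have "((\<lambda>_. 0) has_vector_derivative \<Psi> x) (at x)" using True ab(4)[of x] by auto
    then show ?thesis
      by (rule has_vector_derivative_transform_within_open[of _ _ _ "{..<a}"]) (use True left in auto)
  next
    case False
    then have "0 < x" using ab by auto
    have "(\<Phi> has_vector_derivative \<Psi> x) (at x within {0..x + 1})"
      unfolding \<Phi>_def by (rule integral_has_vector_derivative[OF cS]) (use \<open>0 < x\<close> in auto)
    then show ?thesis
      using at_within_interior[of x "{0..x + 1}"] \<open>0 < x\<close> by simp
  qed
  then have "complex_test \<Phi> \<Psi>"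
    unfolding complex_test_def using c ab left right
    by (intro conjI allI exI[of _ a] exI[of _ b]) (auto simp: not_le)
  then show thesis by (rule that)
qed

text \<open>The lemma of du Bois-Reymond. Only test functions of mean zero are derivatives of test
  functions, so the mean of \<open>\<psi>\<close> times a fixed \<open>\<eta>\<close> of mean one is
  subtracted from \<open>\<psi>\<close>. The remainder integrates to zero against \<open>w\<close>,
  which says that \<open>w\<close> acts on \<open>\<psi>\<close> like the constant \<open>c\<close>,
  the integral of \<open>w * \<eta>\<close>.\<close>

lemma weak_deriv_zero_constant:
  assumes w: "w \<in> sqint unit_interval"
    and orth: "\<And>\<phi> \<phi>'. complex_test \<phi> \<phi>' \<Longrightarrow> (LINT x|unit_interval. w x * \<phi>' x) = 0"
  obtains c where "AE x in unit_interval. w x = c"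
proof -
  let ?I = "\<lambda>f. LINT x|unit_interval. f x :: complex"
  have one: "(\<lambda>x. 1) \<in> sqint unit_interval" by (intro continuous_on_sqint continuous_intros)
  obtain \<eta>0 \<eta>0' where \<eta>0: "complex_test \<eta>0 \<eta>0'" and lt: "nrm2 unit_interval (\<lambda>x. 1 - \<eta>0 x) < 1"
    using complex_test_dense[OF one, of 1] by (metis zero_less_one)
  have i1: "?I (\<lambda>x. 1) = 1" by (simp add: measure_unit_interval)
  have nrm1: "nrm2 unit_interval (\<lambda>x. 1) = 1" by (simp add: nrm2_def measure_unit_interval)
  note \<eta>0s = complex_test_sqint(1)[OF \<eta>0]
  \<comment> \<open>The L^2 distance of \<open>\<eta>0\<close> to \<open>1\<close> is below
    \<open>1\<close> on an interval of length one, so by Cauchy-Schwarz its mean differs from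
    \<open>1\<close> by less than \<open>1\<close>.\<close>
  have "?I \<eta>0 \<noteq> 0"
  proof
    assume "?I \<eta>0 = 0"
    then have "?I (\<lambda>x. 1 - \<eta>0 x) = 1"
      using i1 sqint_integrable_unit_interval[OF \<eta>0s] sqint_integrable_unit_interval[OF one]
      by (subst Bochner_Integration.integral_diff) auto
    then show False
      using Cauchy_Schwarz_nrm2[OF sqint_diff[OF one \<eta>0s] one] lt nrm1 by simp
  qed
  define \<eta> where "\<eta> x = \<eta>0 x / ?I \<eta>0" for x
  have i\<eta>: "?I \<eta> = 1" using \<open>?I \<eta>0 \<noteq> 0\<close> by (simp add: \<eta>_def)
  have \<eta>s: "\<eta> \<in> sqint unit_interval"
    unfolding \<eta>_def using sqint_cmult[OF \<eta>0s, of "inverse (?I \<eta>0)"] by (simp add: field_simps)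
  have \<eta>c: "continuous_on UNIV \<eta>"
    unfolding \<eta>_def divide_inverse by (intro continuous_intros complex_test_continuous[OF \<eta>0])
  obtain a1 b1 where ab1: "0 < a1" "b1 < 1" "\<And>x. x \<notin> {a1..b1} \<Longrightarrow> \<eta> x = 0"
    using \<eta>0 unfolding complex_test_def \<eta>_def by auto
  define c where "c = ?I (\<lambda>x. w x * \<eta> x)"
  have cs: "(\<lambda>x. c) \<in> sqint unit_interval" by (intro continuous_on_sqint continuous_intros)
  have "AE x in unit_interval. w x - c = 0"
  proof (rule fundamental_lemma_unit_interval[OF sqint_diff[OF w cs]])
    fix \<psi> \<psi>' assume \<psi>: "complex_test \<psi> \<psi>'"
    note \<psi>s = complex_test_sqint(1)[OF \<psi>]
    obtain a2 b2 where ab2: "0 < a2" "b2 < 1" "\<And>x. x \<notin> {a2..b2} \<Longrightarrow> \<psi> x = 0"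
      using \<psi> unfolding complex_test_def by auto
    define \<Psi> where "\<Psi> x = \<psi> x - ?I \<psi> * \<eta> x" for x
    obtain \<Phi> where "complex_test \<Phi> \<Psi>"
    proof (rule complex_test_antiderivative)
      \<comment> \<open>The point \<open>1/2\<close> is included because the support intervals found
        for \<open>\<eta>\<close> and \<open>\<psi>\<close> may be empty, while the antiderivative
        lemma asks for \<open>a \<le> b\<close>.\<close>
      let ?a = "min (1/2) (min a1 a2)" and ?b = "max (1/2) (max b1 b2)"
      show "continuous_on UNIV \<Psi>"
        unfolding \<Psi>_def by (intro continuous_intros \<eta>c complex_test_continuous[OF \<psi>])
      show "0 < ?a" "?a \<le> ?b" "?b < 1" using ab1 ab2 by auto
      show "\<Psi> x = 0" if "x \<notin> {?a..?b}" for x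
      proof -
        have "x \<notin> {a1..b1}" "x \<notin> {a2..b2}" using that by auto
        from ab1(3)[OF this(1)] ab2(3)[OF this(2)] show ?thesis by (simp add: \<Psi>_def)
      qed
      show "?I \<Psi> = 0"
        unfolding \<Psi>_def using sqint_integrable_unit_interval[OF \<psi>s] sqint_integrable_unit_interval[OF \<eta>s] i\<eta>
        by (subst Bochner_Integration.integral_diff) auto
    qed
    from orth[OF this] have 0: "?I (\<lambda>x. w x * \<Psi> x) = 0" .
    have "?I (\<lambda>x. w x * \<Psi> x) = ?I (\<lambda>x. w x * \<psi> x - ?I \<psi> * (w x * \<eta> x))"
      by (simp add: \<Psi>_def algebra_simps)
    also have "\<dots> = ?I (\<lambda>x. w x * \<psi> x) - ?I \<psi> * c"
      unfolding c_def using integrable_mult_sqint[OF w \<psi>s] integrable_mult_sqint[OF w \<eta>s]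
      by (subst Bochner_Integration.integral_diff) auto
    finally have 1: "?I (\<lambda>x. w x * \<psi> x) = ?I \<psi> * c" using 0 by simp
    have "?I (\<lambda>x. (w x - c) * \<psi> x) = ?I (\<lambda>x. w x * \<psi> x) - c * ?I \<psi>"
      unfolding left_diff_distrib
      using integrable_mult_sqint[OF w \<psi>s] sqint_integrable_unit_interval[OF \<psi>s]
      by (subst Bochner_Integration.integral_diff) auto
    then show "?I (\<lambda>x. (w x - c) * \<psi> x) = 0" using 1 by (simp add: mult.commute)
  qed
  then have "AE x in unit_interval. w x = c" by eventually_elim simp
  then show thesis by (rule that)
qed

text \<open>Fubini on the triangle \<open>y \<le> x\<close>: integrating \<open>\<phi>'\<close> over
  \<open>x\<close> first gives \<open>\<phi> 1 - \<phi> y = - \<phi> y\<close>.\<close>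

lemma indefinite_integral_weak_deriv:
  assumes g: "g \<in> sqint unit_interval" and \<phi>: "complex_test \<phi> \<phi>'"
  shows "(LINT x|unit_interval. integral {0..x} g * \<phi>' x) = - (LINT x|unit_interval. g x * \<phi> x)"
proof -
  interpret U: finite_measure unit_interval by (rule unit_interval_finite)
  interpret UU: pair_sigma_finite unit_interval unit_interval ..
  note [measurable] = sqint_measurable[OF g] sqint_measurable[OF complex_test_sqint(2)[OF \<phi>]]
  have [measurable]: "(\<lambda>x. x) \<in> borel_measurable unit_interval"
    by (intro continuous_on_measurable_unit_interval continuous_intros)
  note gi = sqint_integrable_unit_interval[OF g]
  note \<phi>i = sqint_integrable_unit_interval[OF complex_test_sqint(2)[OF \<phi>]]
  define F where "F x y = (if y \<le> x then g y * \<phi>' x else 0)" for x y :: real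
  have [measurable]: "(\<lambda>(x, y). F x y) \<in> borel_measurable (unit_interval \<Otimes>\<^sub>M unit_interval)"
    unfolding F_def by measurable
  have Fbound: "norm (F x y) \<le> norm (g y * \<phi>' x)" for x y by (simp add: F_def)
  have Fi: "integrable unit_interval (F x)" if "x \<in> space unit_interval" for x
  proof (rule Bochner_Integration.integrable_bound)
    show "integrable unit_interval (\<lambda>y. g y * \<phi>' x)" using gi by simp
    show "F x \<in> borel_measurable unit_interval" unfolding F_def by measurable
  qed (use Fbound in auto)
  have "integrable (unit_interval \<Otimes>\<^sub>M unit_interval) (\<lambda>(x, y). F x y)"
  proof (rule UU.Fubini_integrable)
    show "integrable unit_interval (\<lambda>x. LINT y|unit_interval. norm (case (x, y) of (x, y) \<Rightarrow> F x y))"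
    proof (rule Bochner_Integration.integrable_bound)
      show "integrable unit_interval (\<lambda>x. (LINT y|unit_interval. norm (g y)) * norm (\<phi>' x))"
        using \<phi>i by auto
      show "AE x in unit_interval. norm (LINT y|unit_interval. norm (case (x, y) of (x, y) \<Rightarrow> F x y))
          \<le> norm ((LINT y|unit_interval. norm (g y)) * norm (\<phi>' x))"
      proof (rule AE_I2)
        fix x assume x: "x \<in> space unit_interval"
        have "(LINT y|unit_interval. norm (F x y)) \<le> (LINT y|unit_interval. norm (g y) * norm (\<phi>' x))"
          using Fi[OF x] gi Fbound by (intro integral_mono) (auto simp: norm_mult)
        also have "\<dots> = (LINT y|unit_interval. norm (g y)) * norm (\<phi>' x)" by simp
        finally show "norm (LINT y|unit_interval. norm (case (x, y) of (x, y) \<Rightarrow> F x y))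
          \<le> norm ((LINT y|unit_interval. norm (g y)) * norm (\<phi>' x))"
          by (simp add: abs_mult)
      qed
    qed measurable
    show "AE x in unit_interval. integrable unit_interval (\<lambda>y. case (x, y) of (x, y) \<Rightarrow> F x y)"
      using Fi by auto
  qed measurable
  from UU.Fubini_integral[OF this]
  have swap: "(LINT x|unit_interval. LINT y|unit_interval. F x y) = (LINT y|unit_interval. LINT x|unit_interval. F x y)" ..
  have inner1: "(LINT y|unit_interval. F x y) = integral {0..x} g * \<phi>' x" if x: "x \<in> space unit_interval" for x
  proof -
    have "(LINT y|unit_interval. F x y) = (LINT y|unit_interval. (if y \<in> {0..x} then g y else 0) * \<phi>' x)"
      by (rule Bochner_Integration.integral_cong) (auto simp: F_def)
    also have "\<dots> = (LINT y|unit_interval. (if y \<in> {0..x} then g y else 0)) * \<phi>' x"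
      by simp
    also have "(LINT y|unit_interval. (if y \<in> {0..x} then g y else 0)) =
        integral {0..1} (\<lambda>y. if y \<in> {0..x} then g y else 0)"
    proof (rule lebesgue_integral_eq_integral)
      show "integrable unit_interval (\<lambda>y. if y \<in> {0..x} then g y else 0)"
        by (rule Bochner_Integration.integrable_bound[OF gi]) auto
    qed auto
    also have "\<dots> = integral ({0..x} \<inter> {0..1}) g"
      by (rule Henstock_Kurzweil_Integration.integral_restrict_Int)
    also have "{0..x} \<inter> {0..1} = {0..x}" using x by auto
    finally show ?thesis .
  qed
  have inner2: "(LINT x|unit_interval. F x y) = g y * (- \<phi> y)" if y: "y \<in> space unit_interval" for y
  proof -
    have "(LINT x|unit_interval. F x y) = (LINT x|unit_interval. g y * (if x \<in> {y..1} then \<phi>' x else 0))"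
      by (rule Bochner_Integration.integral_cong) (auto simp: F_def)
    also have "\<dots> = g y * (LINT x|unit_interval. (if x \<in> {y..1} then \<phi>' x else 0))"
      by simp
    also have "(LINT x|unit_interval. (if x \<in> {y..1} then \<phi>' x else 0)) =
        integral {0..1} (\<lambda>x. if x \<in> {y..1} then \<phi>' x else 0)"
    proof (rule lebesgue_integral_eq_integral)
      show "integrable unit_interval (\<lambda>x. if x \<in> {y..1} then \<phi>' x else 0)"
        by (rule Bochner_Integration.integrable_bound[OF \<phi>i]) auto
    qed auto
    also have "\<dots> = integral ({y..1} \<inter> {0..1}) \<phi>'"
      by (rule Henstock_Kurzweil_Integration.integral_restrict_Int)
    also have "{y..1} \<inter> {0..1} = {y..1}" using y by auto
    also have "integral {y..1} \<phi>' = \<phi> 1 - \<phi> y"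
      by (rule integral_unique, rule fundamental_theorem_of_calculus)
        (use y in \<open>auto intro!: has_vector_derivative_at_within complex_test_deriv[OF \<phi>]\<close>)
    also have "\<phi> 1 = 0" using \<phi> unfolding complex_test_def by auto
    finally show ?thesis by simp
  qed
  have "(LINT x|unit_interval. integral {0..x} g * \<phi>' x) = (LINT x|unit_interval. LINT y|unit_interval. F x y)"
    by (rule Bochner_Integration.integral_cong) (simp_all add: inner1)
  also have "\<dots> = (LINT y|unit_interval. g y * (- \<phi> y))"
    unfolding swap by (rule Bochner_Integration.integral_cong[OF refl]) (rule inner2)
  finally show ?thesis by simp
qed

text \<open>The primitive of \<open>g\<close> has the weak derivative \<open>g\<close> too, so
  \<open>f\<close> minus this primitive has weak derivative zero and is constant almost
  everywhere.\<close>

lemma weak_deriv_continuous_primitive: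
  assumes "has_weak_deriv f g"
  obtains u where "continuous_on {0..1} u" "AE x in unit_interval. f x = u x"
    "\<And>x. x \<in> {0..1} \<Longrightarrow> u x = u 0 + integral {0..x} g"
proof -
  note f = has_weak_deriv_sqint(1)[OF assms] and g = has_weak_deriv_sqint(2)[OF assms]
  have gint: "g integrable_on {0..1}"
    using integrable_on_lebesgue_on[OF sqint_integrable_unit_interval[OF g]] by simp
  define v where "v x = integral {0..x} g" for x
  have vc: "continuous_on {0..1} v"
    unfolding v_def by (rule indefinite_integral_continuous_1[OF gint])
  note vs = continuous_on_sqint[OF vc]
  obtain c where c: "AE x in unit_interval. f x - v x = c"
  proof (rule weak_deriv_zero_constant[OF sqint_diff[OF f vs]])
    fix \<phi> \<phi>' assume \<phi>: "complex_test \<phi> \<phi>'"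
    have "(LINT x|unit_interval. (f x - v x) * \<phi>' x) =
        (LINT x|unit_interval. f x * \<phi>' x) - (LINT x|unit_interval. v x * \<phi>' x)"
      unfolding left_diff_distrib
      by (intro Bochner_Integration.integral_diff integrable_mult_sqint f vs complex_test_sqint[OF \<phi>])
    then show "(LINT x|unit_interval. (f x - v x) * \<phi>' x) = 0"
      using has_weak_deriv_complex_test[OF assms \<phi>] indefinite_integral_weak_deriv[OF g \<phi>]
      by (simp add: v_def)
  qed
  show thesis
  proof (rule that)
    show "continuous_on {0..1} (\<lambda>x. c + v x)" by (intro continuous_intros vc)
    show "AE x in unit_interval. f x = c + v x" using c by eventually_elim (simp add: algebra_simps)
    show "c + v x = c + v 0 + integral {0..x} g" for x by (simp add: v_def)
  qed
qed

text \<open>The points of the open interval where \<open>u\<close> and \<open>v\<close> differ form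
  an open set, and a negligible open set is empty. The endpoints follow by continuity.\<close>

lemma continuous_AE_unit_interval_eq:
  fixes u v :: "real \<Rightarrow> complex"
  assumes u: "continuous_on {0..1} u" and v: "continuous_on {0..1} v"
    and ae: "AE x in unit_interval. u x = v x" and x: "x \<in> {0..1}"
  shows "u x = v x"
proof -
  let ?S = "{x \<in> {0<..<1}. u x - v x \<in> - {0}}"
  have "open ?S"
  proof -
    have "continuous_on {0<..<1} (\<lambda>x. u x - v x)"
      by (intro continuous_intros continuous_on_subset[OF u] continuous_on_subset[OF v]) auto
    from continuous_open_preimage[OF this, of "- {0}"] show ?thesis
      by (simp add: vimage_def Int_def open_Compl)
  qed
  moreover have "negligible ?S"
    by (rule negligible_subset[OF negligible_AE_unit_interval[OF ae]]) auto
  ultimately have "?S = {}" using open_not_negligible by blast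
  then have 0: "u y - v y = 0" if "y \<in> {0<..<1}" for y using that by blast
  have cl: "closure {0<..<1::real} = {0..1}" by simp
  have "u x - v x = 0"
    by (rule continuous_constant_on_closure[of "{0<..<1}" "\<lambda>x. u x - v x"])
      (use 0 x u v cl in \<open>auto intro!: continuous_intros\<close>)
  then show ?thesis by simp
qed

lemma continuous_rep_eq:
  assumes u: "continuous_on {0..1} u" and ae: "AE x in unit_interval. f x = u x" and x: "x \<in> {0..1}"
  shows "continuous_rep f x = u x"
proof -
  let ?P = "\<lambda>u. continuous_on {0..1} u \<and> (AE x in unit_interval. f x = u x)"
  have P: "?P (continuous_rep f)"
    unfolding continuous_rep_def by (rule someI[of ?P u]) (use u ae in blast)
  then have "AE x in unit_interval. continuous_rep f x = u x"
    using ae by (auto elim!: eventually_elim2)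
  then show ?thesis
    using continuous_AE_unit_interval_eq[OF _ u _ x, of "continuous_rep f"] P by blast
qed

section \<open>Continuous representatives and traces\<close>

lemma weak_deriv_works: "f \<in> H1_interval \<Longrightarrow> has_weak_deriv f (weak_deriv f)"
  unfolding H1_interval_def weak_deriv_def by (auto intro: someI[of "has_weak_deriv f"])

lemma continuous_rep_works:
  assumes "f \<in> H1_interval"
  shows "continuous_on {0..1} (continuous_rep f)" "AE x in unit_interval. f x = continuous_rep f x"
proof -
  obtain u where u: "continuous_on {0..1} u" "AE x in unit_interval. f x = u x"
    using weak_deriv_continuous_primitive[OF weak_deriv_works[OF assms]] by metis
  let ?P = "\<lambda>u. continuous_on {0..1} u \<and> (AE x in unit_interval. f x = u x)"
  have "?P (continuous_rep f)"
    unfolding continuous_rep_def by (rule someI[of ?P u]) (use u in blast)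
  then show "continuous_on {0..1} (continuous_rep f)" "AE x in unit_interval. f x = continuous_rep f x" by auto
qed

text \<open>Two values of the continuous representative differ by at most the L^1 norm of the
  derivative, hence by at most its L^2 norm, as the interval has length one. Splitting
  \<open>u p\<close> into \<open>u x\<close> and the difference, squaring and averaging over
  \<open>x\<close> gives the estimate.\<close>

lemma trace_inequality:
  assumes f: "f \<in> H1_interval" and p: "p \<in> {0..1}"
  shows "(cmod (continuous_rep f p))\<^sup>2 \<le> 2 * sqnorm_interval f + 2 * sqnorm_interval (weak_deriv f)"
proof -
  define g where "g = weak_deriv f"
  note wd = weak_deriv_works[OF f, folded g_def]
  note fs = has_weak_deriv_sqint(1)[OF wd] and gs = has_weak_deriv_sqint(2)[OF wd]
  obtain u where u: "continuous_on {0..1} u" "AE x in unit_interval. f x = u x"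
    "\<And>x. x \<in> {0..1} \<Longrightarrow> u x = u 0 + integral {0..x} g"
    using weak_deriv_continuous_primitive[OF wd] by metis
  note gi = sqint_integrable_unit_interval[OF gs]
  have gint: "g integrable_on {0..1}" using integrable_on_lebesgue_on[OF gi] by simp
  have one: "(\<lambda>x. 1) \<in> sqint unit_interval" by (intro continuous_on_sqint continuous_intros)
  have gabs: "(\<lambda>x. of_real (cmod (g x))) \<in> sqint unit_interval"
    using sqint_measurable[OF gs] by (intro sqint_bound[OF _ sqint_integrable[OF gs]]) auto
  have absint: "(\<lambda>x. cmod (g x)) integrable_on {0..1}"
    using integrable_on_lebesgue_on[OF integrable_norm[OF gi]] by simp
  have "integral {0..1} (\<lambda>x. cmod (g x)) = (LINT x|unit_interval. cmod (g x))"
    by (rule lebesgue_integral_eq_integral[symmetric]) (use gi in auto)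
  also have "\<dots> = cmod (LINT x|unit_interval. of_real (cmod (g x)) * 1)"
    by (simp add: integral_nonneg_AE)
  also have "\<dots> \<le> nrm2 unit_interval (\<lambda>x. of_real (cmod (g x))) * nrm2 unit_interval (\<lambda>x. 1)"
    by (rule Cauchy_Schwarz_nrm2[OF gabs one])
  also have "\<dots> = nrm2 unit_interval g" by (simp add: nrm2_def measure_unit_interval)
  finally have L1: "integral {0..1} (\<lambda>x. cmod (g x)) \<le> nrm2 unit_interval g" .
  have diff: "cmod (u y - u x) \<le> nrm2 unit_interval g" if "0 \<le> x" "x \<le> y" "y \<le> 1" for x y
  proof -
    have "integral {0..x} g + integral {x..y} g = integral {0..y} g"
      using that by (intro Henstock_Kurzweil_Integration.integral_combine) (auto intro: integrable_on_subinterval[OF gint])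
    then have "u y - u x = integral {x..y} g"
      using u(3)[of x] u(3)[of y] that by (simp add: algebra_simps)
    also have "cmod \<dots> \<le> integral {x..y} (\<lambda>x. cmod (g x))"
      using that by (intro integral_norm_bound_integral integrable_on_subinterval[OF gint] integrable_on_subinterval[OF absint]) auto
    also have "\<dots> \<le> integral {0..1} (\<lambda>x. cmod (g x))"
      using that by (intro integral_subset_le integrable_on_subinterval[OF absint] absint) auto
    finally show ?thesis using L1 by simp
  qed
  have "(cmod (u p))\<^sup>2 \<le> 2 * (cmod (u x))\<^sup>2 + 2 * sqnorm_interval g" if x: "x \<in> {0..1}" for x
  proof -
    have "cmod (u p - u x) \<le> nrm2 unit_interval g"
      using diff[of p x] diff[of x p] p x by (cases "x \<le> p") (auto simp: norm_minus_commute)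
    then have "(cmod (u p - u x))\<^sup>2 \<le> sqnorm_interval g"
      unfolding sqnorm_interval_eq_nrm2 by (intro power_mono) auto
    then show ?thesis using cmod_add_power2_le[of "u x" "u p - u x"] by simp
  qed
  then have "(LINT x|unit_interval. (cmod (u p))\<^sup>2) \<le> (LINT x|unit_interval. 2 * (cmod (u x))\<^sup>2 + 2 * sqnorm_interval g)"
    using sqint_integrable[OF continuous_on_sqint[OF u(1)]]
    by (intro integral_mono) auto
  also have "\<dots> = 2 * (LINT x|unit_interval. (cmod (u x))\<^sup>2) + 2 * sqnorm_interval g"
    using sqint_integrable[OF continuous_on_sqint[OF u(1)]] by (simp add: measure_unit_interval)
  also have "(LINT x|unit_interval. (cmod (u x))\<^sup>2) = sqnorm_interval f"
    unfolding sqnorm_interval_def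
    by (rule integral_cong_AE) (use u(2) sqint_measurable[OF fs] sqint_measurable[OF continuous_on_sqint[OF u(1)]] in auto)
  finally have "(cmod (u p))\<^sup>2 \<le> 2 * sqnorm_interval f + 2 * sqnorm_interval g"
    by (simp add: measure_unit_interval)
  then show ?thesis using continuous_rep_eq[OF u(1,2) p] by (simp add: g_def)
qed

text \<open>Integration of the product rule; the boundary terms vanish with the test function at
  \<open>0\<close> and \<open>1\<close>.\<close>

lemma has_weak_deriv_classical:
  assumes F: "\<And>x. (F has_vector_derivative \<phi> x) (at x)" and \<phi>: "continuous_on UNIV \<phi>"
  shows "has_weak_deriv F \<phi>"
  unfolding has_weak_deriv_def L2_interval_eq_sqint
proof (intro conjI allI impI)
  have Fc: "continuous_on S F" for S by (rule vector_derivative_imp_continuous_on[OF F])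
  have \<phi>c: "continuous_on S \<phi>" for S using \<phi> continuous_on_subset by blast
  show "F \<in> sqint unit_interval" "\<phi> \<in> sqint unit_interval"
    by (intro continuous_on_sqint Fc \<phi>c)+
  fix \<tau> \<tau>' assume "test_function \<tau> \<tau>'"
  from complex_test_of_real[OF this]
  have \<tau>: "complex_test (\<lambda>x. of_real (\<tau> x)) (\<lambda>x. of_real (\<tau>' x))" .
  have "((\<lambda>x. F x * of_real (\<tau>' x) + \<phi> x * of_real (\<tau> x)) has_integral
      F 1 * of_real (\<tau> 1) - F 0 * of_real (\<tau> 0)) {0..1}"
    by (rule fundamental_theorem_of_calculus)
      (auto intro!: has_vector_derivative_mult has_vector_derivative_at_within[OF F]
        has_vector_derivative_at_within[OF complex_test_deriv[OF \<tau>]])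
  moreover have "\<tau> 0 = 0" "\<tau> 1 = 0"
    using \<open>test_function \<tau> \<tau>'\<close> by (auto simp: test_function_def)
  moreover have i: "integrable unit_interval (\<lambda>x. F x * of_real (\<tau>' x))"
    "integrable unit_interval (\<lambda>x. \<phi> x * of_real (\<tau> x))"
    by (intro continuous_imp_integrable_real continuous_on_mult Fc \<phi>c complex_test_continuous[OF \<tau>])+
  ultimately have "(LINT x|unit_interval. F x * of_real (\<tau>' x) + \<phi> x * of_real (\<tau> x)) = 0"
    by (subst lebesgue_integral_eq_integral) (auto dest: integral_unique)
  then show "(LINT x|unit_interval. F x * of_real (\<tau>' x)) = - (LINT x|unit_interval. \<phi> x * of_real (\<tau> x))"
    using i by (simp add: eq_neg_iff_add_eq_0)
qed

section \<open>The Hilbert space of the graph\<close>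

lemma integrable_count_space_iff:
  fixes h :: "'a \<Rightarrow> 'b::{banach,second_countable_topology}"
  shows "integrable (count_space A) h \<longleftrightarrow> (\<lambda>x. norm (h x)) summable_on A"
  using abs_summable_equivalent[of h A] by (simp add: abs_summable_on_def)

lemma integral_count_space_eq_infsum:
  fixes h :: "'a \<Rightarrow> 'b::{banach,second_countable_topology}"
  assumes "integrable (count_space A) h"
  shows "integral\<^sup>L (count_space A) h = infsum h A"
  using infsetsum_infsum[of h A] assms by (simp add: abs_summable_on_def infsetsum_def)

definition cut :: "('e \<times> real) set \<Rightarrow> ('e \<Rightarrow> real \<Rightarrow> complex) \<Rightarrow> 'e \<Rightarrow> real \<Rightarrow> complex" where
  "cut \<omega> f = (\<lambda>e x. if (e, x) \<in> \<omega> then f e x else 0)"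

lemma sqnorm_interval_nonneg: "0 \<le> sqnorm_interval f"
  by (simp add: sqnorm_interval_def)

text \<open>Cutting by \<open>A \<times> UNIV\<close> rather than \<open>A \<times> {0..1}\<close>
  returns the very function \<open>f e\<close>, also outside \<open>[0,1]\<close>. Hence
  \<open>weak_deriv\<close> and \<open>continuous_rep\<close>, which are chosen for each function,
  agree without any comparison of representatives.\<close>

lemma cut_edges: "cut (A \<times> UNIV) f e = (if e \<in> A then f e else (\<lambda>x. 0))"
  by (auto simp: cut_def)

section \<open>L^2 of the graph as L^2 of a product measure\<close>

context countable_digraph
begin

lemma edge_space: "space (edge_measure G) = arcs G \<times> {0..1}"
  by (simp add: edge_measure_def space_pair_measure)

lemma pair_sigma_finite_edges: "pair_sigma_finite (count_space (arcs G)) unit_interval"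
  by (intro pair_sigma_finite.intro sigma_finite_measure_count_space_countable countable_arcs
      finite_measure.axioms unit_interval_finite)

lemma borel_measurable_edges_iff:
  "case_prod f \<in> borel_measurable (edge_measure G) \<longleftrightarrow> (\<forall>e\<in>arcs G. f e \<in> borel_measurable unit_interval)"
proof
  assume f: "case_prod f \<in> borel_measurable (edge_measure G)"
  show "\<forall>e\<in>arcs G. f e \<in> borel_measurable unit_interval"
  proof
    fix e assume "e \<in> arcs G"
    then have "Pair e \<in> measurable unit_interval (edge_measure G)"
      unfolding edge_measure_def by (intro measurable_Pair1') simp
    from measurable_compose[OF this f] show "f e \<in> borel_measurable unit_interval" by simp
  qed
next
  assume "\<forall>e\<in>arcs G. f e \<in> borel_measurable unit_interval"
  then show "case_prod f \<in> borel_measurable (edge_measure G)"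
    unfolding edge_measure_def by (intro measurable_pair_measure_countable1 countable_arcs) auto
qed

text \<open>Countability of the edges lets the exceptional null sets of the single edges unite to a
  measurable null set of the product.\<close>

lemma AE_edges_iff:
  "(AE p in edge_measure G. case p of (e, x) \<Rightarrow> P e x) \<longleftrightarrow> (\<forall>e\<in>arcs G. AE x in unit_interval. P e x)"
proof
  interpret pair_sigma_finite "count_space (arcs G)" unit_interval by (rule pair_sigma_finite_edges)
  {
    assume "AE p in edge_measure G. case p of (e, x) \<Rightarrow> P e x"
    from AE_pair[OF this[unfolded edge_measure_def]]
    show "\<forall>e\<in>arcs G. AE x in unit_interval. P e x" by (simp add: AE_count_space)
  next
    assume "\<forall>e\<in>arcs G. AE x in unit_interval. P e x"
    then have "\<forall>e\<in>arcs G. \<exists>N\<in>null_sets unit_interval. {x \<in> space unit_interval. \<not> P e x} \<subseteq> N"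
      by (simp add: eventually_ae_filter)
    then obtain N where N: "\<And>e. e \<in> arcs G \<Longrightarrow> N e \<in> null_sets unit_interval"
      "\<And>e. e \<in> arcs G \<Longrightarrow> {x \<in> space unit_interval. \<not> P e x} \<subseteq> N e" by metis
    have "AE p in edge_measure G. snd p \<notin> N (fst p)"
      unfolding edge_measure_def
    proof (rule AE_pair_measure)
      let ?M = "count_space (arcs G) \<Otimes>\<^sub>M unit_interval"
      have compl: "{0..1} - N e \<in> sets unit_interval" if "e \<in> arcs G" for e
        using sets.compl_sets[OF null_setsD2[OF N(1)[OF that]]] by simp
      have "{x \<in> space ?M. snd x \<notin> N (fst x)} = (\<Union>e\<in>arcs G. {e} \<times> ({0..1} - N e))"
        by (auto simp: space_pair_measure)
      also have "\<dots> \<in> sets ?M"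
        by (intro sets.countable_UN'' countable_arcs pair_measureI compl) auto
      finally show "{x \<in> space ?M. snd x \<notin> N (fst x)} \<in> sets ?M" .
      show "AE e in count_space (arcs G). AE x in unit_interval. snd (e, x) \<notin> N (fst (e, x))"
        using N(1) by (auto simp: AE_count_space intro: AE_not_in)
    qed
    then show "AE p in edge_measure G. case p of (e, x) \<Rightarrow> P e x"
      using AE_space
    proof eventually_elim
      fix p assume "snd p \<notin> N (fst p)" "p \<in> space (edge_measure G)"
      then show "case p of (e, x) \<Rightarrow> P e x"
        using N(2)[of "fst p"] by (auto simp: edge_space)
    qed
  }
qed

lemma L2_eq_iff: "L2_eq G f g \<longleftrightarrow> (\<forall>e\<in>arcs G. AE x in unit_interval. f e x = g e x)"
  unfolding L2_eq_def by (rule AE_edges_iff)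

text \<open>Tonelli's theorem with the counting measure on the edges. It identifies the Hilbert sum
  with L^2 of the disjoint union, so that what is proved for \<open>sqint\<close> transfers.\<close>

lemma L2_graph_iff: "f \<in> L2_graph G \<longleftrightarrow> case_prod f \<in> sqint (edge_measure G)"
proof
  interpret pair_sigma_finite "count_space (arcs G)" unit_interval by (rule pair_sigma_finite_edges)
  {
    assume f: "f \<in> L2_graph G"
    then have fe: "f e \<in> sqint unit_interval" if "e \<in> arcs G" for e
      using that by (simp add: L2_graph_def L2_interval_eq_sqint)
    then have meas: "case_prod f \<in> borel_measurable (edge_measure G)"
      unfolding borel_measurable_edges_iff by (auto dest: sqint_measurable)
    have "integrable (edge_measure G) (\<lambda>p. (cmod (case_prod f p))\<^sup>2)"
      unfolding edge_measure_def
    proof (rule Fubini_integrable)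
      show "(\<lambda>p. (cmod (case_prod f p))\<^sup>2) \<in> borel_measurable (count_space (arcs G) \<Otimes>\<^sub>M unit_interval)"
        using meas unfolding edge_measure_def by measurable
      show "integrable (count_space (arcs G)) (\<lambda>e. LINT x|unit_interval. norm ((cmod (case (e, x) of (e, x) \<Rightarrow> f e x))\<^sup>2))"
        using f by (simp add: integrable_count_space_iff L2_graph_def sqnorm_interval_nonneg flip: sqnorm_interval_def)
      show "AE e in count_space (arcs G). integrable unit_interval (\<lambda>x. (cmod (case (e, x) of (e, x) \<Rightarrow> f e x))\<^sup>2)"
        using sqint_integrable[OF fe] by (simp add: AE_count_space)
    qed
    with meas show "case_prod f \<in> sqint (edge_measure G)" by (simp add: sqint_def)
  next
    assume f: "case_prod f \<in> sqint (edge_measure G)"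
    have i: "integrable (count_space (arcs G) \<Otimes>\<^sub>M unit_interval) (\<lambda>p. (cmod (case_prod f p))\<^sup>2)"
      using sqint_integrable[OF f] by (simp add: edge_measure_def)
    have "f e \<in> sqint unit_interval" if "e \<in> arcs G" for e
      using AE_integrable_fst'[OF i] sqint_measurable[OF f] that
      by (auto simp: AE_count_space sqint_def borel_measurable_edges_iff)
    moreover have "(\<lambda>e. sqnorm_interval (f e)) summable_on arcs G"
      using integrable_fst'[OF i] by (simp add: integrable_count_space_iff sqnorm_interval_nonneg flip: sqnorm_interval_def)
    ultimately show "f \<in> L2_graph G" by (simp add: L2_graph_def L2_interval_eq_sqint)
  }
qed

lemma L2_norm_eq_nrm2:
  assumes "f \<in> L2_graph G"
  shows "L2_norm G f = nrm2 (edge_measure G) (case_prod f)"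
proof -
  interpret pair_sigma_finite "count_space (arcs G)" unit_interval by (rule pair_sigma_finite_edges)
  have i: "integrable (count_space (arcs G) \<Otimes>\<^sub>M unit_interval) (\<lambda>p. (cmod (case_prod f p))\<^sup>2)"
    using sqint_integrable assms by (simp add: edge_measure_def L2_graph_iff)
  show ?thesis
    using integral_fst'[OF i] integral_count_space_eq_infsum[OF integrable_fst'[OF i]]
    by (simp add: L2_norm_def nrm2_def edge_measure_def sqnorm_interval_def)
qed

lemma L2_inner_eq_integral:
  assumes "f \<in> L2_graph G" "g \<in> L2_graph G"
  shows "L2_inner G f g = (LINT p|edge_measure G. case_prod f p * cnj (case_prod g p))"
proof -
  interpret pair_sigma_finite "count_space (arcs G)" unit_interval by (rule pair_sigma_finite_edges)
  have i: "integrable (count_space (arcs G) \<Otimes>\<^sub>M unit_interval) (\<lambda>p. case_prod f p * cnj (case_prod g p))"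
    using integrable_inner_sqint assms by (simp add: edge_measure_def L2_graph_iff)
  show ?thesis
    using integral_fst'[OF i] integral_count_space_eq_infsum[OF integrable_fst'[OF i]]
    by (simp add: L2_inner_def edge_measure_def)
qed

lemma L2_edge: "f \<in> L2_graph G \<Longrightarrow> e \<in> arcs G \<Longrightarrow> f e \<in> sqint unit_interval"
  by (simp add: L2_graph_def L2_interval_eq_sqint)

lemma L2_add: "f \<in> L2_graph G \<Longrightarrow> g \<in> L2_graph G \<Longrightarrow> (\<lambda>e x. f e x + g e x) \<in> L2_graph G"
  using sqint_add[of "case_prod f" "edge_measure G" "case_prod g"]
  by (simp add: L2_graph_iff case_prod_unfold)

lemma L2_cmult: "f \<in> L2_graph G \<Longrightarrow> (\<lambda>e x. c * f e x) \<in> L2_graph G"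
  using sqint_cmult[of "case_prod f" "edge_measure G" c]
  by (simp add: L2_graph_iff case_prod_unfold)

lemma L2_diff: "f \<in> L2_graph G \<Longrightarrow> g \<in> L2_graph G \<Longrightarrow> (\<lambda>e x. f e x - g e x) \<in> L2_graph G"
  using sqint_diff[of "case_prod f" "edge_measure G" "case_prod g"]
  by (simp add: L2_graph_iff case_prod_unfold)

lemma L2_zero: "(\<lambda>e x. 0) \<in> L2_graph G"
  using sqint_zero[of "edge_measure G"] by (simp add: L2_graph_iff case_prod_unfold)

lemma L2_cut:
  assumes "f \<in> L2_graph G" "\<omega> \<inter> space (edge_measure G) \<in> sets (edge_measure G)"
  shows "cut \<omega> f \<in> L2_graph G"
proof -
  have "{p \<in> space (edge_measure G). p \<in> \<omega>} = \<omega> \<inter> space (edge_measure G)" by auto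
  then show ?thesis
    using sqint_restrict[of "case_prod f" "edge_measure G" "\<lambda>p. p \<in> \<omega>"] assms
    unfolding L2_graph_iff cut_def case_prod_unfold by simp
qed

lemma edges_sets:
  assumes "A \<subseteq> arcs G"
  shows "A \<times> {0..1} \<in> sets (edge_measure G)"
  using assms unfolding edge_measure_def by (intro pair_measureI) (auto simp: sets_restrict_space)

lemma edges_sets_UNIV: "(A \<times> UNIV) \<inter> space (edge_measure G) \<in> sets (edge_measure G)"
  using edges_sets[of "A \<inter> arcs G"] by (simp add: edge_space Times_Int_Times)

lemma L2_norm_nonneg: "0 \<le> L2_norm G f"
  by (simp add: L2_norm_def infsum_nonneg sqnorm_interval_nonneg)

lemma L2_norm_triangle:
  assumes "f \<in> L2_graph G" "g \<in> L2_graph G"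
  shows "L2_norm G (\<lambda>e x. f e x + g e x) \<le> L2_norm G f + L2_norm G g"
  using nrm2_triangle[of "case_prod f" "edge_measure G" "case_prod g"] L2_add[OF assms] assms
  by (simp add: L2_norm_eq_nrm2 L2_graph_iff case_prod_unfold)

lemma L2_norm_cmult:
  assumes "f \<in> L2_graph G"
  shows "L2_norm G (\<lambda>e x. c * f e x) = cmod c * L2_norm G f"
  using nrm2_cmult[of "edge_measure G" c "case_prod f"] L2_cmult[OF assms, of c] assms
  by (simp add: L2_norm_eq_nrm2 L2_graph_iff case_prod_unfold)

lemma L2_norm_minus_commute:
  assumes "f \<in> L2_graph G" "g \<in> L2_graph G"
  shows "L2_norm G (\<lambda>e x. f e x - g e x) = L2_norm G (\<lambda>e x. g e x - f e x)"
  using L2_norm_cmult[OF L2_diff[OF assms], of "-1"] by simp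

lemma L2_norm_triangle_diff:
  assumes "f \<in> L2_graph G" "g \<in> L2_graph G"
  shows "L2_norm G (\<lambda>e x. f e x - g e x) \<le> L2_norm G f + L2_norm G g"
  using L2_norm_triangle[OF assms(1) L2_cmult[OF assms(2), of "-1"]] L2_norm_cmult[OF assms(2), of "-1"] by simp

lemma L2_norm_triangle_through:
  assumes "f \<in> L2_graph G" "g \<in> L2_graph G" "h \<in> L2_graph G"
  shows "L2_norm G (\<lambda>e x. f e x - h e x) \<le> L2_norm G (\<lambda>e x. f e x - g e x) + L2_norm G (\<lambda>e x. g e x - h e x)"
  using L2_norm_triangle[OF L2_diff[OF assms(1,2)] L2_diff[OF assms(2,3)]] by simp

lemma L2_norm_eq_0_iff:
  assumes "f \<in> L2_graph G"
  shows "L2_norm G f = 0 \<longleftrightarrow> L2_eq G f (\<lambda>e x. 0)"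
  using nrm2_zero_iff[of "case_prod f" "edge_measure G"] assms
  by (simp add: L2_norm_eq_nrm2 L2_graph_iff L2_eq_def case_prod_unfold)

lemma L2_norm_mono:
  assumes "f \<in> L2_graph G" "g \<in> L2_graph G" "AE (e, x) in edge_measure G. cmod (f e x) \<le> cmod (g e x)"
  shows "L2_norm G f \<le> L2_norm G g"
  using nrm2_mono_AE[of "case_prod g" "edge_measure G" "case_prod f"] assms
    sqint_measurable[of "case_prod f" "edge_measure G"]
  by (simp add: L2_norm_eq_nrm2 L2_graph_iff case_prod_unfold)

lemma L2_norm_cut_le:
  assumes "f \<in> L2_graph G" "\<omega> \<inter> space (edge_measure G) \<in> sets (edge_measure G)"
  shows "L2_norm G (cut \<omega> f) \<le> L2_norm G f"
  by (rule L2_norm_mono[OF L2_cut[OF assms] assms(1)]) (auto simp: cut_def)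

lemma L2_eq_refl: "L2_eq G f f"
  by (simp add: L2_eq_iff)

lemma L2_eq_sym: "L2_eq G f g \<Longrightarrow> L2_eq G g f"
  by (simp add: L2_eq_iff eq_commute)

lemma L2_eq_trans: "L2_eq G f g \<Longrightarrow> L2_eq G g h \<Longrightarrow> L2_eq G f h"
  unfolding L2_eq_def by (erule (1) eventually_elim2) auto

lemma L2_eq_diff: "L2_eq G f f' \<Longrightarrow> L2_eq G g g' \<Longrightarrow> L2_eq G (\<lambda>e x. f e x - g e x) (\<lambda>e x. f' e x - g' e x)"
  unfolding L2_eq_def by (erule (1) eventually_elim2) auto

lemma L2_eq_add: "L2_eq G f f' \<Longrightarrow> L2_eq G g g' \<Longrightarrow> L2_eq G (\<lambda>e x. f e x + g e x) (\<lambda>e x. f' e x + g' e x)"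
  unfolding L2_eq_def by (erule (1) eventually_elim2) auto

lemma L2_eq_cmult: "L2_eq G f f' \<Longrightarrow> L2_eq G (\<lambda>e x. c * f e x) (\<lambda>e x. c * f' e x)"
  unfolding L2_eq_iff by (auto elim!: eventually_mono)

lemma L2_eq_cut: "L2_eq G f g \<Longrightarrow> L2_eq G (cut \<omega> f) (cut \<omega> g)"
  unfolding L2_eq_iff cut_def by (auto elim!: eventually_mono)

lemma L2_norm_cong:
  assumes "f \<in> L2_graph G" "g \<in> L2_graph G" "L2_eq G f g"
  shows "L2_norm G f = L2_norm G g"
  by (rule antisym; rule L2_norm_mono) (use assms in \<open>auto simp: L2_eq_def elim!: eventually_mono\<close>)

lemma L2_eq_iff_norm_diff:
  assumes "f \<in> L2_graph G" "g \<in> L2_graph G"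
  shows "L2_eq G f g \<longleftrightarrow> L2_norm G (\<lambda>e x. f e x - g e x) = 0"
  by (simp add: L2_norm_eq_0_iff[OF L2_diff[OF assms]] L2_eq_iff)

lemma L2_Cauchy_Schwarz:
  assumes "f \<in> L2_graph G" "g \<in> L2_graph G"
  shows "cmod (L2_inner G f g) \<le> L2_norm G f * L2_norm G g"
  using Cauchy_Schwarz_inner_nrm2[of "case_prod f" "edge_measure G" "case_prod g"] assms
  by (simp add: L2_norm_eq_nrm2 L2_inner_eq_integral L2_graph_iff)

lemma L2_inner_diff_left:
  assumes "f \<in> L2_graph G" "g \<in> L2_graph G" "h \<in> L2_graph G"
  shows "L2_inner G (\<lambda>e x. f e x - g e x) h = L2_inner G f h - L2_inner G g h"
  using integrable_inner_sqint[of "case_prod f" "edge_measure G" "case_prod h"]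
    integrable_inner_sqint[of "case_prod g" "edge_measure G" "case_prod h"] L2_diff[OF assms(1,2)] assms
  by (simp add: L2_inner_eq_integral L2_graph_iff case_prod_unfold left_diff_distrib)

lemma L2_inner_cmult_left:
  assumes "f \<in> L2_graph G" "h \<in> L2_graph G"
  shows "L2_inner G (\<lambda>e x. c * f e x) h = c * L2_inner G f h"
  using L2_cmult[OF assms(1), of c] assms
  by (simp add: L2_inner_eq_integral case_prod_unfold mult.assoc)

lemma L2_inner_commute: "L2_inner G f g = cnj (L2_inner G g f)"
  unfolding L2_inner_def infsum_cnj[symmetric] Bochner_Integration.integral_cnj[symmetric]
  by (simp only: complex_cnj_mult complex_cnj_cnj mult.commute)

lemma L2_inner_diff_right:
  assumes "f \<in> L2_graph G" "g \<in> L2_graph G" "h \<in> L2_graph G"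
  shows "L2_inner G h (\<lambda>e x. f e x - g e x) = L2_inner G h f - L2_inner G h g"
  using L2_inner_diff_left[OF assms] L2_inner_commute by (metis complex_cnj_diff)

lemma L2_inner_cmult_right:
  assumes "f \<in> L2_graph G" "h \<in> L2_graph G"
  shows "L2_inner G h (\<lambda>e x. c * f e x) = cnj c * L2_inner G h f"
  using L2_inner_cmult_left[OF assms, of c] L2_inner_commute by (metis complex_cnj_mult)

lemma L2_inner_cong:
  assumes "f \<in> L2_graph G" "f' \<in> L2_graph G" "g \<in> L2_graph G" "g' \<in> L2_graph G"
    and "L2_eq G f f'" "L2_eq G g g'"
  shows "L2_inner G f g = L2_inner G f' g'"
proof -
  have "L2_inner G f g - L2_inner G f' g = 0"
    using L2_Cauchy_Schwarz[OF L2_diff[OF assms(1,2)] assms(3)] assms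
    by (simp add: L2_inner_diff_left L2_eq_iff_norm_diff)
  moreover have "L2_inner G f' g - L2_inner G f' g' = 0"
    using L2_Cauchy_Schwarz[OF assms(2) L2_diff[OF assms(3,4)]] assms
    by (simp add: L2_inner_diff_right L2_eq_iff_norm_diff)
  ultimately show ?thesis by simp
qed

lemma L2_inner_self:
  assumes "f \<in> L2_graph G"
  shows "L2_inner G f f = of_real ((L2_norm G f)\<^sup>2)"
  using assms unfolding L2_inner_eq_integral[OF assms assms] L2_norm_eq_nrm2[OF assms] nrm2_power2
  by (simp add: complex_norm_square[symmetric] flip: integral_complex_of_real)

lemma L2_inner_cut:
  "L2_inner G (cut \<omega> f) g = L2_inner G f (cut \<omega> g)"
  unfolding L2_inner_def cut_def
  by (intro infsum_cong Bochner_Integration.integral_cong) auto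

text \<open>Completeness of L^2 of the graph, for steps as small as those of the gliding hump
  below.\<close>

lemma L2_series_converges:
  fixes g :: "nat \<Rightarrow> 'e \<Rightarrow> real \<Rightarrow> complex"
  assumes g: "\<And>k. g k \<in> L2_graph G" and le: "\<And>k. L2_norm G (g k) \<le> (1/4)^k"
  obtains s where "s \<in> L2_graph G" "(\<lambda>n. L2_norm G (\<lambda>e x. s e x - (\<Sum>k<n. g k e x))) \<longlonglongrightarrow> 0"
proof -
  obtain s where s: "s \<in> sqint (edge_measure G)"
    and lim: "(\<lambda>n. nrm2 (edge_measure G) (\<lambda>p. s p - (\<Sum>k<n. case_prod (g k) p))) \<longlonglongrightarrow> 0"
  proof (rule sqint_series_converges)
    show "case_prod (g k) \<in> sqint (edge_measure G)" for k using g L2_graph_iff by blast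
    show "nrm2 (edge_measure G) (case_prod (g k)) \<le> (1/4)^k" for k
      using le[of k] L2_norm_eq_nrm2[OF g] by simp
  qed
  have cs: "curry s \<in> L2_graph G" using s by (simp add: L2_graph_iff)
  have sums: "(\<lambda>e x. \<Sum>k<n. g k e x) \<in> L2_graph G" for n
    by (induction n) (auto simp: L2_zero intro: L2_add g)
  have "L2_norm G (\<lambda>e x. curry s e x - (\<Sum>k<n. g k e x)) =
      nrm2 (edge_measure G) (\<lambda>p. s p - (\<Sum>k<n. case_prod (g k) p))" for n
    unfolding L2_norm_eq_nrm2[OF L2_diff[OF cs sums]] by (simp add: case_prod_unfold)
  with lim have "(\<lambda>n. L2_norm G (\<lambda>e x. curry s e x - (\<Sum>k<n. g k e x))) \<longlonglongrightarrow> 0" by simp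
  with cs show thesis by (rule that)
qed

text \<open>Since \<open>\<phi>\<close> is compactly supported in the open edges, \<open>F\<close> is constant near the nodes.\<close>

definition smooth_field ::
  "('e \<Rightarrow> real \<Rightarrow> complex) \<Rightarrow> ('e \<Rightarrow> real \<Rightarrow> complex) \<Rightarrow> ('e \<Rightarrow> real \<Rightarrow> complex) \<Rightarrow> bool" where
  "smooth_field F \<phi> \<phi>' \<longleftrightarrow>
     (\<forall>e\<in>arcs G. \<forall>x. (F e has_vector_derivative \<phi> e x) (at x)) \<and>
     (\<forall>e\<in>arcs G. complex_test (\<phi> e) (\<phi>' e)) \<and>
     (\<exists>E. finite E \<and> E \<subseteq> arcs G \<and> (\<forall>e\<in>arcs G - E. \<forall>x. F e x = 0 \<and> \<phi> e x = 0 \<and> \<phi>' e x = 0))"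

lemma complex_test_zero: "complex_test (\<lambda>x. 0) (\<lambda>x. 0)"
  unfolding complex_test_def by (auto intro!: exI[of _ "1/2"])

lemma summable_on_finite_support:
  fixes h :: "'c \<Rightarrow> real"
  assumes "finite E" "E \<subseteq> A" "\<And>x. x \<in> A - E \<Longrightarrow> h x = 0"
  shows "h summable_on A" "infsum h A = sum h E"
  using assms summable_on_cong_neutral[of E A h h] infsum_cong_neutral[of E A h h] by auto

lemma finite_support_L2:
  assumes "finite E" "E \<subseteq> arcs G" "\<And>e x. e \<in> arcs G - E \<Longrightarrow> F e x = 0"
    and "\<And>e. e \<in> E \<Longrightarrow> F e \<in> sqint unit_interval"
  shows "F \<in> L2_graph G"
proof -
  have z: "F e = (\<lambda>x. 0)" if "e \<in> arcs G - E" for e using assms(3)[OF that] by auto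
  have "F e \<in> sqint unit_interval" if "e \<in> arcs G" for e
    using that assms(4)[of e] z[of e] sqint_zero[of unit_interval] by (cases "e \<in> E") auto
  moreover have "(\<lambda>e. sqnorm_interval (F e)) summable_on arcs G"
    by (rule summable_on_finite_support(1)[OF assms(1,2)]) (simp add: z sqnorm_interval_def)
  ultimately show ?thesis by (simp add: L2_graph_def L2_interval_eq_sqint)
qed

lemma smooth_field_L2:
  assumes "smooth_field F \<phi> \<phi>'"
  shows "F \<in> L2_graph G" "\<phi> \<in> L2_graph G" "\<phi>' \<in> L2_graph G"
proof -
  obtain E where E: "finite E" "E \<subseteq> arcs G" "\<And>e x. e \<in> arcs G - E \<Longrightarrow> F e x = 0"
    "\<And>e x. e \<in> arcs G - E \<Longrightarrow> \<phi> e x = 0" "\<And>e x. e \<in> arcs G - E \<Longrightarrow> \<phi>' e x = 0"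
    using assms unfolding smooth_field_def by auto
  have *: "F e \<in> sqint unit_interval" "\<phi> e \<in> sqint unit_interval" "\<phi>' e \<in> sqint unit_interval"
    if "e \<in> arcs G" for e
    using assms that unfolding smooth_field_def
    by (auto intro: continuous_on_sqint vector_derivative_imp_continuous_on complex_test_sqint)
  show "F \<in> L2_graph G" "\<phi> \<in> L2_graph G" "\<phi>' \<in> L2_graph G"
    by (rule finite_support_L2[OF E(1,2)]; use E * in auto)+
qed

text \<open>The function is restricted to the first \<open>n\<close> edges of an enumeration and
  then replaced by a test function on each of them. That \<open>F e\<close> itself is a test
  function makes \<open>F\<close> vanish at the nodes, which later puts it into the form
  domain.\<close>

lemma smooth_fields_dense:
  assumes f: "f \<in> L2_graph G" and "\<epsilon> > 0"
  obtains F \<phi> \<phi>' where "smooth_field F \<phi> \<phi>'" "\<And>e. e \<in> arcs G \<Longrightarrow> complex_test (F e) (\<phi> e)"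
    "L2_norm G (\<lambda>e x. f e x - F e x) < \<epsilon>"
proof -
  define A where "A n = {e \<in> arcs G. to_nat_on (arcs G) e < n}" for n
  have A: "finite (A n)" "A n \<subseteq> arcs G" for n
  proof -
    have "inj_on (to_nat_on (arcs G)) (A n)"
      using inj_on_to_nat_on[OF countable_arcs] by (rule inj_on_subset) (auto simp: A_def)
    moreover have "to_nat_on (arcs G) ` A n \<subseteq> {..<n}" by (auto simp: A_def)
    ultimately show "finite (A n)" using inj_on_finite by blast
  qed (auto simp: A_def)
  let ?c = "\<lambda>n. cut (A n \<times> UNIV) f"
  have cL: "?c n \<in> L2_graph G" for n by (rule L2_cut[OF f edges_sets_UNIV])
  have "(\<lambda>n. nrm2 (edge_measure G) (\<lambda>p. case_prod f p - case_prod (?c n) p)) \<longlonglongrightarrow> 0"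
  proof (rule nrm2_dominated_convergence[where w="case_prod f"])
    show "AE p in edge_measure G. (\<lambda>n. case_prod (?c n) p) \<longlonglongrightarrow> case_prod f p"
    proof (rule AE_I2)
      fix p assume "p \<in> space (edge_measure G)"
      then obtain e x where p: "p = (e, x)" "e \<in> arcs G" by (auto simp: edge_space)
      show "(\<lambda>n. case_prod (?c n) p) \<longlonglongrightarrow> case_prod f p"
      proof (rule Lim_transform_eventually[OF tendsto_const])
        show "\<forall>\<^sub>F n in sequentially. case_prod f p = case_prod (?c n) p"
          using eventually_gt_at_top[of "to_nat_on (arcs G) e"]
          by eventually_elim (simp add: p A_def cut_def)
      qed
    qed
  qed (use f cL in \<open>auto simp: L2_graph_iff cut_def dest: sqint_measurable\<close>)
  moreover have "nrm2 (edge_measure G) (\<lambda>p. case_prod f p - case_prod (?c n) p) =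
      L2_norm G (\<lambda>e x. f e x - ?c n e x)" for n
    unfolding L2_norm_eq_nrm2[OF L2_diff[OF f cL]] by (simp add: case_prod_unfold)
  ultimately have "(\<lambda>n. L2_norm G (\<lambda>e x. f e x - ?c n e x)) \<longlonglongrightarrow> 0" by simp
  moreover have "\<epsilon> / 2 > 0" using \<open>\<epsilon> > 0\<close> by simp
  ultimately obtain n where n: "L2_norm G (\<lambda>e x. f e x - ?c n e x) < \<epsilon> / 2"
    using order_tendstoD(2) eventually_happens' sequentially_bot by blast
  define E where "E = A n"
  have E: "finite E" "E \<subseteq> arcs G" using A by (auto simp: E_def)
  \<comment> \<open>\<open>card E\<close> squared errors of size \<open>\<delta>^2\<close> add up to
    at most \<open>((card E + 1) * \<delta>)^2 = (\<epsilon> / 2)^2\<close>; the summand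
    \<open>1\<close> keeps the denominator positive for empty \<open>E\<close>.\<close>
  define \<delta> where "\<delta> = \<epsilon> / 2 / (real (card E) + 1)"
  have "\<delta> > 0" using \<open>\<epsilon> > 0\<close> by (simp add: \<delta>_def add_nonneg_pos)
  have "\<exists>F F' F''. complex_test F F' \<and> complex_test F' F'' \<and> nrm2 unit_interval (\<lambda>x. f e x - F x) < \<delta>"
    if "e \<in> arcs G" for e
    using complex_test_dense[OF L2_edge[OF f that] \<open>\<delta> > 0\<close>] by metis
  then obtain F0 \<phi>0 \<phi>0' where F0: "\<And>e. e \<in> arcs G \<Longrightarrow> complex_test (F0 e) (\<phi>0 e)"
    "\<And>e. e \<in> arcs G \<Longrightarrow> complex_test (\<phi>0 e) (\<phi>0' e)"
    "\<And>e. e \<in> arcs G \<Longrightarrow> nrm2 unit_interval (\<lambda>x. f e x - F0 e x) < \<delta>" by metis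
  define F where "F e = (if e \<in> E then F0 e else (\<lambda>x. 0))" for e
  define \<phi> where "\<phi> e = (if e \<in> E then \<phi>0 e else (\<lambda>x. 0))" for e
  define \<phi>' where "\<phi>' e = (if e \<in> E then \<phi>0' e else (\<lambda>x. 0))" for e
  have F: "complex_test (F e) (\<phi> e)" "complex_test (\<phi> e) (\<phi>' e)" if "e \<in> arcs G" for e
    using F0 complex_test_zero that by (auto simp: F_def \<phi>_def \<phi>'_def)
  have sf: "smooth_field F \<phi> \<phi>'"
    unfolding smooth_field_def
  proof (intro conjI ballI allI exI[of _ E] E)
    show "(F e has_vector_derivative \<phi> e x) (at x)" if "e \<in> arcs G" for e x
      using complex_test_deriv[OF F(1)[OF that]] .
    show "complex_test (\<phi> e) (\<phi>' e)" if "e \<in> arcs G" for e using F(2)[OF that] .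
  qed (auto simp: F_def \<phi>_def \<phi>'_def)
  note FL = smooth_field_L2(1)[OF sf]
  have "(\<Sum>\<^sub>\<infinity>e\<in>arcs G. sqnorm_interval (\<lambda>x. ?c n e x - F e x)) = (\<Sum>e\<in>E. sqnorm_interval (\<lambda>x. ?c n e x - F e x))"
    by (rule summable_on_finite_support(2)[OF E]) (auto simp: F_def cut_def E_def sqnorm_interval_def)
  also have "\<dots> \<le> (\<Sum>e\<in>E. \<delta>\<^sup>2)"
  proof (rule sum_mono)
    fix e assume e: "e \<in> E"
    have "sqnorm_interval (\<lambda>x. ?c n e x - F e x) = (nrm2 unit_interval (\<lambda>x. f e x - F0 e x))\<^sup>2"
      using e by (simp add: sqnorm_interval_eq_nrm2 cut_edges F_def E_def)
    also have "\<dots> \<le> \<delta>\<^sup>2"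
      using F0(3)[of e] e E nrm2_nonneg by (intro power_mono) (auto simp: less_imp_le)
    finally show "sqnorm_interval (\<lambda>x. ?c n e x - F e x) \<le> \<delta>\<^sup>2" .
  qed
  also have "\<dots> \<le> ((real (card E) + 1) * \<delta>)\<^sup>2"
  proof -
    have "real (card E) \<le> (real (card E) + 1)\<^sup>2" by (simp add: power2_sum)
    then show ?thesis by (simp add: power_mult_distrib mult_right_mono)
  qed
  also have "(real (card E) + 1) * \<delta> = \<epsilon> / 2"
  proof -
    have *: "m * (\<epsilon> / 2 / m) = \<epsilon> / 2" if "m \<noteq> 0" for m using that by simp
    show ?thesis unfolding \<delta>_def by (rule *) linarith
  qed
  finally have "L2_norm G (\<lambda>e x. ?c n e x - F e x) \<le> \<epsilon> / 2"
    unfolding L2_norm_def using \<open>\<epsilon> > 0\<close> by (intro real_le_lsqrt) (auto intro!: infsum_nonneg sqnorm_interval_nonneg)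
  with n L2_norm_triangle_through[OF f cL FL, of n]
  have "L2_norm G (\<lambda>e x. f e x - F e x) < \<epsilon>" by linarith
  with sf F(1) show thesis by (rule that)
qed

end

section \<open>Semigroups on the graph\<close>

locale graph_semigroup = countable_digraph G for G :: "('v, 'e) pre_digraph" (structure) +
  fixes T :: "real \<Rightarrow> ('e \<Rightarrow> real \<Rightarrow> complex) \<Rightarrow> 'e \<Rightarrow> real \<Rightarrow> complex"
  assumes C0: "C0_semigroup G T"
begin

section \<open>Operator norms and local boundedness of the semigroup\<close>

lemma bounded_T: "0 \<le> t \<Longrightarrow> bounded_operator G (T t)"
  using C0 by (simp add: C0_semigroup_def)

lemma T_L2: "0 \<le> t \<Longrightarrow> f \<in> L2_graph G \<Longrightarrow> T t f \<in> L2_graph G"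
  using bounded_T[of t] by (simp add: bounded_operator_def)

lemma T_add:
  "0 \<le> t \<Longrightarrow> f \<in> L2_graph G \<Longrightarrow> g \<in> L2_graph G \<Longrightarrow>
     L2_eq G (T t (\<lambda>e x. f e x + g e x)) (\<lambda>e x. T t f e x + T t g e x)"
  using bounded_T[of t] by (simp add: bounded_operator_def)

lemma T_cmult: "0 \<le> t \<Longrightarrow> f \<in> L2_graph G \<Longrightarrow> L2_eq G (T t (\<lambda>e x. c * f e x)) (\<lambda>e x. c * T t f e x)"
  using bounded_T[of t] by (simp add: bounded_operator_def)

lemma T_diff:
  assumes "0 \<le> t" "f \<in> L2_graph G" "g \<in> L2_graph G"
  shows "L2_eq G (T t (\<lambda>e x. f e x - g e x)) (\<lambda>e x. T t f e x - T t g e x)"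
  using L2_eq_trans[OF T_add[OF assms(1,2) L2_cmult[OF assms(3), of "-1"]]
      L2_eq_add[OF L2_eq_refl T_cmult[OF assms(1,3), of "-1"]]] by simp

lemma T_zero: "f \<in> L2_graph G \<Longrightarrow> L2_eq G (T 0 f) f"
  using C0 by (simp add: C0_semigroup_def)

lemma T_compose: "0 \<le> s \<Longrightarrow> 0 \<le> t \<Longrightarrow> f \<in> L2_graph G \<Longrightarrow> L2_eq G (T (s + t) f) (T s (T t f))"
  using C0 by (simp add: C0_semigroup_def)

lemma T_bounded:
  assumes "0 \<le> t"
  obtains C where "0 \<le> C" "\<And>f. f \<in> L2_graph G \<Longrightarrow> L2_norm G (T t f) \<le> C * L2_norm G f"
proof -
  obtain C where C: "\<And>f. f \<in> L2_graph G \<Longrightarrow> L2_norm G (T t f) \<le> C * L2_norm G f"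
    using bounded_T[OF assms] unfolding bounded_operator_def by metis
  have "L2_norm G (T t f) \<le> max 0 C * L2_norm G f" if "f \<in> L2_graph G" for f
  proof -
    have "C * L2_norm G f \<le> max 0 C * L2_norm G f"
      by (rule mult_right_mono) (auto simp: L2_norm_nonneg)
    then show ?thesis using C[OF that] by linarith
  qed
  then show thesis by (intro that[of "max 0 C"]) auto
qed

lemma T_norm_diff:
  assumes "0 \<le> t" "f \<in> L2_graph G" "g \<in> L2_graph G"
  shows "L2_norm G (\<lambda>e x. T t f e x - T t g e x) = L2_norm G (T t (\<lambda>e x. f e x - g e x))"
  using assms by (intro L2_norm_cong L2_eq_sym[OF T_diff] L2_diff T_L2)

text \<open>The operator norm as a supremum over the unit ball. Besides the bound, the gliding hump
  uses vectors that almost attain the same \<open>N\<close>.\<close>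

lemma T_operator_norm:
  assumes "0 \<le> t"
  obtains N where "0 \<le> N" "\<And>f. f \<in> L2_graph G \<Longrightarrow> L2_norm G (T t f) \<le> N * L2_norm G f"
    "\<And>a. a < N \<Longrightarrow> \<exists>f\<in>L2_graph G. L2_norm G f \<le> 1 \<and> a < L2_norm G (T t f)"
proof -
  obtain C where C: "0 \<le> C" "\<And>f. f \<in> L2_graph G \<Longrightarrow> L2_norm G (T t f) \<le> C * L2_norm G f"
    using T_bounded[OF assms] by metis
  define S where "S = {L2_norm G (T t f) |f. f \<in> L2_graph G \<and> L2_norm G f \<le> 1}"
  have z: "L2_norm G (\<lambda>e x. 0) = 0" using L2_norm_eq_0_iff[OF L2_zero] L2_eq_refl by blast
  have S0: "L2_norm G (T t (\<lambda>e x. 0)) \<in> S" unfolding S_def using L2_zero z by force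
  have bdd: "bdd_above S"
  proof (rule bdd_aboveI)
    fix y assume "y \<in> S"
    then obtain f where f: "y = L2_norm G (T t f)" "f \<in> L2_graph G" "L2_norm G f \<le> 1" by (auto simp: S_def)
    have "C * L2_norm G f \<le> C * 1" using C(1) f(3) by (rule mult_left_mono[rotated])
    then show "y \<le> C" using C(2)[OF f(2)] f(1) by simp
  qed
  show thesis
  proof (rule that)
    show "0 \<le> Sup S" using cSup_upper[OF S0 bdd] L2_norm_nonneg order_trans by blast
    show "L2_norm G (T t f) \<le> Sup S * L2_norm G f" if f: "f \<in> L2_graph G" for f
    proof (cases "L2_norm G f = 0")
      case True
      then show ?thesis using C(2)[OF f] by simp
    next
      case False
      then have pos: "L2_norm G f > 0" using L2_norm_nonneg[of f] by simp
      let ?c = "complex_of_real (1 / L2_norm G f)"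
      have c: "cmod ?c = 1 / L2_norm G f" using pos by (simp add: norm_divide)
      have "L2_norm G (\<lambda>e x. ?c * f e x) = 1"
        using pos unfolding L2_norm_cmult[OF f] c by simp
      then have "L2_norm G (T t (\<lambda>e x. ?c * f e x)) \<in> S"
        unfolding S_def using L2_cmult[OF f, of ?c] by force
      from cSup_upper[OF this bdd] have "L2_norm G (T t (\<lambda>e x. ?c * f e x)) \<le> Sup S" .
      moreover have "L2_norm G (T t (\<lambda>e x. ?c * f e x)) = L2_norm G (\<lambda>e x. ?c * T t f e x)"
        using assms f by (intro L2_norm_cong T_L2 L2_cmult T_cmult)
      moreover have "\<dots> = 1 / L2_norm G f * L2_norm G (T t f)"
        unfolding L2_norm_cmult[OF T_L2[OF assms f]] c ..
      ultimately have "1 / L2_norm G f * L2_norm G (T t f) \<le> Sup S" by (simp only:)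
      then show ?thesis using pos by (simp add: field_simps)
    qed
    show "\<exists>f\<in>L2_graph G. L2_norm G f \<le> 1 \<and> a < L2_norm G (T t f)" if "a < Sup S" for a
      using less_cSupD[OF _ that] S0 unfolding S_def by blast
  qed
qed

text \<open>The gliding hump of Sokal's proof of the uniform boundedness principle.\<close>

lemma T_locally_bounded:
  obtains \<delta> K where "0 < \<delta>"
    "\<And>t f. 0 \<le> t \<Longrightarrow> t \<le> \<delta> \<Longrightarrow> f \<in> L2_graph G \<Longrightarrow> L2_norm G (T t f) \<le> K * L2_norm G f"
proof (rule ccontr)
  assume contra: "\<not> thesis"
  \<comment> \<open>If no bound holds near \<open>0\<close>, the bound \<open>16 ^ n\<close> fails
    at some time up to \<open>1 / (n + 1)\<close>, and these times tend to \<open>0\<close>.\<close>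
  have "\<exists>t f. 0 \<le> t \<and> t \<le> 1 / real (Suc n) \<and> f \<in> L2_graph G \<and> 16 ^ n * L2_norm G f < L2_norm G (T t f)" for n
    using contra that[of "1 / real (Suc n)" "16 ^ n"] by (force simp: not_le)
  then obtain t f where t: "\<And>n. 0 \<le> t n" "\<And>n. t n \<le> 1 / real (Suc n)"
    and f: "\<And>n. f n \<in> L2_graph G" "\<And>n. 16 ^ n * L2_norm G (f n) < L2_norm G (T (t n) (f n))"
    by metis
  have "\<exists>N h. 16 ^ n < N \<and> (\<forall>f\<in>L2_graph G. L2_norm G (T (t n) f) \<le> N * L2_norm G f) \<and>
      h \<in> L2_graph G \<and> L2_norm G h \<le> 1 \<and> 2 / 3 * N < L2_norm G (T (t n) h)" for n
  proof -
    obtain N where N: "0 \<le> N" "\<And>f. f \<in> L2_graph G \<Longrightarrow> L2_norm G (T (t n) f) \<le> N * L2_norm G f"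
      "\<And>a. a < N \<Longrightarrow> \<exists>f\<in>L2_graph G. L2_norm G f \<le> 1 \<and> a < L2_norm G (T (t n) f)"
      using T_operator_norm[OF t(1)[of n]] by metis
    have "16 ^ n * L2_norm G (f n) < N * L2_norm G (f n)" using N(2)[OF f(1)] f(2)[of n] by (rule less_le_trans[rotated])
    then have less: "16 ^ n < N" using L2_norm_nonneg[of "f n"] by (simp add: mult_less_cancel_right)
    moreover have "0 < (16::real) ^ n" by simp
    ultimately have "2 / 3 * N < N" by linarith
    from N(3)[OF this] N(2) less show ?thesis by blast
  qed
  then obtain N h where N: "\<And>n. 16 ^ n < N n" "\<And>n f. f \<in> L2_graph G \<Longrightarrow> L2_norm G (T (t n) f) \<le> N n * L2_norm G f"
    and h: "\<And>n. h n \<in> L2_graph G" "\<And>n. L2_norm G (h n) \<le> 1" "\<And>n. 2 / 3 * N n < L2_norm G (T (t n) (h n))"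
    by metis
  have Npos: "0 < N n" for n using N(1)[of n] by (rule less_trans[rotated]) simp
  \<comment> \<open>The step lengths \<open>4^-n\<close> balance two needs: all steps after the
    \<open>n\<close>-th together move the vector by at most \<open>q n / 3\<close>, while
    \<open>q n * N n\<close> still exceeds \<open>4 ^ n\<close>.\<close>
  define q where "q n = (1 / 4 :: real) ^ n" for n
  have qpos: "0 < q n" for n by (simp add: q_def)
  define y where "y n = (\<lambda>e x. complex_of_real (q n) * h n e x)" for n
  have yL: "y n \<in> L2_graph G" for n unfolding y_def by (rule L2_cmult[OF h(1)])
  have ynorm: "L2_norm G (y n) \<le> q n" for n
    unfolding y_def L2_norm_cmult[OF h(1)] using h(2)[of n] qpos[of n] by (simp add: mult_left_le)
  have Ty: "2 / 3 * q n * N n < L2_norm G (T (t n) (y n))" for n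
  proof -
    have "L2_norm G (T (t n) (y n)) = L2_norm G (\<lambda>e x. complex_of_real (q n) * T (t n) (h n) e x)"
      unfolding y_def by (intro L2_norm_cong T_L2 L2_cmult T_cmult h t)
    also have "\<dots> = q n * L2_norm G (T (t n) (h n))"
      using qpos[of n] by (simp add: L2_norm_cmult T_L2 h t)
    finally show ?thesis using h(3)[of n] qpos[of n] by (simp add: mult.assoc[symmetric] mult.commute[of _ "q n"])
  qed
  \<comment> \<open>This decides the sign of the \<open>n\<close>-th step. Since
    \<open>2 * y n\<close> is the difference of \<open>X n + y n\<close> and
    \<open>X n - y n\<close>, the image of at least one of the two is no shorter than that of
    \<open>y n\<close>.\<close>
  define good where "good n u \<longleftrightarrow> 2 / 3 * q n * N n \<le> L2_norm G (T (t n) (\<lambda>e x. u e x + y n e x))" for n u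
  define X where "X = rec_nat (\<lambda>e x. 0 :: complex) (\<lambda>n u. \<lambda>e x. if good n u then u e x + y n e x else u e x - y n e x)"
  have X0: "X 0 = (\<lambda>e x. 0)" by (simp add: X_def)
  have XSuc: "X (Suc n) = (\<lambda>e x. if good n (X n) then X n e x + y n e x else X n e x - y n e x)" for n
    unfolding X_def nat.rec(2) ..
  have XL: "X n \<in> L2_graph G" for n
  proof (induction n)
    case (Suc n)
    then show ?case unfolding XSuc by (cases "good n (X n)") (simp_all add: L2_add L2_diff yL)
  qed (simp add: X0 L2_zero)
  define g where "g n = (\<lambda>e x. X (Suc n) e x - X n e x)" for n
  have gL: "g n \<in> L2_graph G" for n unfolding g_def by (intro L2_diff XL)
  have gnorm: "L2_norm G (g n) \<le> q n" for n
  proof (cases "good n (X n)")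
    case True
    then have "g n = y n" by (simp add: g_def XSuc)
    then show ?thesis using ynorm by simp
  next
    case False
    then have "g n = (\<lambda>e x. (-1) * y n e x)" by (simp add: g_def XSuc)
    then show ?thesis using ynorm L2_norm_cmult[OF yL, of "-1" n] by simp
  qed
  have TX: "2 / 3 * q n * N n \<le> L2_norm G (T (t n) (X (Suc n)))" for n
  proof (cases "good n (X n)")
    case True
    then show ?thesis using True[unfolded good_def] by (simp add: XSuc)
  next
    case False
    let ?u = "\<lambda>e x. X n e x + y n e x" and ?v = "\<lambda>e x. X n e x - y n e x"
    have uv: "?u \<in> L2_graph G" "?v \<in> L2_graph G" by (intro L2_add L2_diff XL yL)+
    have "2 * L2_norm G (T (t n) (y n)) = L2_norm G (\<lambda>e x. 2 * T (t n) (y n) e x)"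
      by (simp add: L2_norm_cmult T_L2 t yL)
    also have "\<dots> = L2_norm G (T (t n) (\<lambda>e x. 2 * y n e x))"
      by (intro L2_norm_cong L2_eq_sym[OF T_cmult] T_L2 L2_cmult t yL)
    also have "(\<lambda>e x. 2 * y n e x) = (\<lambda>e x. ?u e x - ?v e x)" by (simp add: fun_eq_iff)
    also have "L2_norm G (T (t n) \<dots>) = L2_norm G (\<lambda>e x. T (t n) ?u e x - T (t n) ?v e x)"
      by (rule T_norm_diff[OF t(1) uv, symmetric])
    also have "\<dots> \<le> L2_norm G (T (t n) ?u) + L2_norm G (T (t n) ?v)"
      by (intro L2_norm_triangle_diff T_L2 t uv)
    finally show ?thesis using Ty[of n] False by (simp add: XSuc good_def)
  qed
  obtain s where s: "s \<in> L2_graph G" "(\<lambda>n. L2_norm G (\<lambda>e x. s e x - (\<Sum>k<n. g k e x))) \<longlonglongrightarrow> 0"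
  proof (rule L2_series_converges)
    show "g k \<in> L2_graph G" for k by (rule gL)
    show "L2_norm G (g k) \<le> (1/4) ^ k" for k using gnorm[of k] by (simp only: q_def)
  qed
  have "(\<Sum>k<n. g k e x) = X n e x" for n e x
    unfolding g_def by (subst sum_lessThan_telescope) (simp add: X0)
  with s(2) have lim: "(\<lambda>n. L2_norm G (\<lambda>e x. s e x - X n e x)) \<longlonglongrightarrow> 0" by simp
  \<comment> \<open>The factor \<open>1 - q j\<close> keeps the exact partial sum of the geometric
    series; with the plain bound \<open>q n / 3\<close> the induction would not close.\<close>
  have tail: "L2_norm G (\<lambda>e x. X (Suc n + j) e x - X (Suc n) e x) \<le> q n * (1 - q j) / 3" for n j
  proof (induction j)
    case 0
    have "L2_norm G (\<lambda>e x. 0) = 0" using L2_norm_eq_0_iff[OF L2_zero] L2_eq_refl by blast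
    then show ?case by (simp add: q_def)
  next
    case (Suc j)
    have "L2_norm G (\<lambda>e x. X (Suc n + Suc j) e x - X (Suc n) e x)
        \<le> L2_norm G (g (Suc n + j)) + L2_norm G (\<lambda>e x. X (Suc n + j) e x - X (Suc n) e x)"
      using L2_norm_triangle_through[OF XL[of "Suc n + Suc j"] XL[of "Suc n + j"] XL[of "Suc n"]] by (simp add: g_def)
    also have "\<dots> \<le> q (Suc n + j) + q n * (1 - q j) / 3" using gnorm Suc by (intro add_mono)
    also have "\<dots> = q n * (1 - q (Suc j)) / 3" by (simp add: q_def power_add field_simps)
    finally show ?case .
  qed
  have close: "L2_norm G (\<lambda>e x. s e x - X (Suc n) e x) \<le> q n / 3" for n
  proof (rule tendsto_lowerbound)
    show "(\<lambda>j. L2_norm G (\<lambda>e x. s e x - X (j + Suc n) e x) + q n / 3) \<longlonglongrightarrow> q n / 3"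
      using tendsto_add[OF LIMSEQ_ignore_initial_segment[OF lim, of "Suc n"] tendsto_const[of "q n / 3"]] by simp
    show "\<forall>\<^sub>F j in sequentially. L2_norm G (\<lambda>e x. s e x - X (Suc n) e x)
        \<le> L2_norm G (\<lambda>e x. s e x - X (j + Suc n) e x) + q n / 3"
    proof (intro always_eventually allI)
      fix j
      have "q n * (1 - q j) \<le> q n" using qpos[of n] qpos[of j] by (simp add: mult_left_le)
      then show "L2_norm G (\<lambda>e x. s e x - X (Suc n) e x)
        \<le> L2_norm G (\<lambda>e x. s e x - X (j + Suc n) e x) + q n / 3"
        using L2_norm_triangle_through[OF s(1) XL[of "j + Suc n"] XL[of "Suc n"]] tail[of n j]
        by (simp add: add.commute)
    qed
  qed simp
  \<comment> \<open>Of the length \<open>2/3 * q n * N n\<close> of the image of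
    \<open>X (Suc n)\<close>, passing to the limit \<open>s\<close> costs at most
    \<open>1/3 * q n * N n\<close>.\<close>
  have big: "4 ^ n / 3 \<le> L2_norm G (T (t n) s)" for n
  proof -
    have "L2_norm G (T (t n) (X (Suc n))) \<le> L2_norm G (T (t n) s) + L2_norm G (\<lambda>e x. T (t n) (X (Suc n)) e x - T (t n) s e x)"
      using L2_norm_triangle[OF T_L2[OF t(1) s(1)] L2_diff[OF T_L2[OF t(1) XL] T_L2[OF t(1) s(1)]], of n n "Suc n" n] by simp
    also have "L2_norm G (\<lambda>e x. T (t n) (X (Suc n)) e x - T (t n) s e x) \<le> N n * L2_norm G (\<lambda>e x. X (Suc n) e x - s e x)"
      unfolding T_norm_diff[OF t(1) XL s(1)] by (intro N L2_diff XL s)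
    also have "\<dots> \<le> N n * (q n / 3)"
      using close[of n] Npos[of n] unfolding L2_norm_minus_commute[OF XL s(1)] by (intro mult_left_mono) auto
    finally have "1 / 3 * (q n * N n) \<le> L2_norm G (T (t n) s)" using TX[of n] by (simp add: algebra_simps)
    moreover have "4 ^ n = q n * 16 ^ n" by (simp add: q_def flip: power_mult_distrib)
    moreover have "q n * 16 ^ n \<le> q n * N n" using N(1)[of n] qpos[of n] by simp
    ultimately show ?thesis by linarith
  qed
  have "((\<lambda>t. L2_norm G (\<lambda>e x. T t s e x - s e x)) \<longlongrightarrow> 0) (at_right 0)"
    using C0 s(1) by (simp add: C0_semigroup_def)
  from order_tendstoD(2)[OF this, of 1] obtain d where d: "0 < d"
    "\<And>t. 0 < t \<Longrightarrow> t < d \<Longrightarrow> L2_norm G (\<lambda>e x. T t s e x - s e x) < 1"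
    unfolding eventually_at_right_field by auto
  obtain m where m: "1 / d < real m" using reals_Archimedean2 by blast
  obtain k where k: "3 * (L2_norm G s + 1) < 4 ^ k" using real_arch_pow[of 4] by auto
  define n where "n = max m k"
  have "t n < d"
  proof -
    have "1 / d < real (Suc n)" using m by (simp add: n_def)
    then have "1 / real (Suc n) < d" using d(1) by (simp add: field_simps)
    then show ?thesis using t(2)[of n] by linarith
  qed
  \<comment> \<open>The limit from the right says nothing at time \<open>0\<close>, which
    \<open>t n\<close> may equal.\<close>
  have "L2_norm G (T (t n) s) \<le> L2_norm G s + 1"
  proof (cases "t n = 0")
    case True
    then show ?thesis using L2_norm_cong[OF T_L2[OF order_refl s(1)] s(1) T_zero[OF s(1)]] by simp
  next
    case False
    then have "L2_norm G (\<lambda>e x. T (t n) s e x - s e x) < 1" using d(2) t(1)[of n] \<open>t n < d\<close> by simp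
    then show ?thesis using L2_norm_triangle[OF L2_diff[OF T_L2[OF t(1) s(1)] s(1)] s(1), of n] by simp
  qed
  moreover have "(4::real) ^ k \<le> 4 ^ n" by (simp add: n_def power_increasing)
  ultimately have "L2_norm G (T (t n) s) < 4 ^ n / 3"
    using less_le_trans[OF k, of "4 ^ n"] by simp
  with big[of n] show False by simp
qed

text \<open>By the semigroup law, splitting off a time \<open>\<delta>\<close> costs one factor
  \<open>K\<close>. Taking \<open>K \<ge> 1\<close> lets a single power of \<open>K\<close> serve
  all shorter times.\<close>

lemma T_bounded_upto:
  obtains K where "0 \<le> K"
    "\<And>s f. 0 \<le> s \<Longrightarrow> s \<le> t \<Longrightarrow> f \<in> L2_graph G \<Longrightarrow> L2_norm G (T s f) \<le> K * L2_norm G f"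
proof -
  obtain \<delta> K0 where \<delta>: "0 < \<delta>" and K0:
    "\<And>t f. 0 \<le> t \<Longrightarrow> t \<le> \<delta> \<Longrightarrow> f \<in> L2_graph G \<Longrightarrow> L2_norm G (T t f) \<le> K0 * L2_norm G f"
    using T_locally_bounded by metis
  define K where "K = max 1 K0"
  have K: "L2_norm G (T t f) \<le> K * L2_norm G f" if "0 \<le> t" "t \<le> \<delta>" "f \<in> L2_graph G" for t f
  proof -
    have "K0 * L2_norm G f \<le> K * L2_norm G f" unfolding K_def by (rule mult_right_mono) (auto simp: L2_norm_nonneg)
    then show ?thesis using K0[OF that] by linarith
  qed
  have K1: "1 \<le> K" by (simp add: K_def)
  have *: "L2_norm G (T s f) \<le> K ^ Suc n * L2_norm G f"
    if "0 \<le> s" "s \<le> real (Suc n) * \<delta>" "f \<in> L2_graph G" for n s f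
    using that
  proof (induction n arbitrary: s f)
    case 0
    then show ?case using K by simp
  next
    case (Suc n)
    show ?case
    proof (cases "s \<le> \<delta>")
      case True
      have "L2_norm G (T s f) \<le> K * L2_norm G f" using K Suc.prems True by simp
      also have "\<dots> \<le> K ^ Suc (Suc n) * L2_norm G f"
        using power_increasing[of 1 "Suc (Suc n)" K] K1 by (intro mult_right_mono) (auto simp: L2_norm_nonneg)
      finally show ?thesis .
    next
      case False
      have b: "0 \<le> s - \<delta>" "s - \<delta> \<le> real (Suc n) * \<delta>" using False Suc.prems by (auto simp: algebra_simps)
      have "L2_norm G (T s f) = L2_norm G (T \<delta> (T (s - \<delta>) f))"
        using T_compose[of \<delta> "s - \<delta>" f] b \<delta> Suc.prems by (intro L2_norm_cong T_L2) auto
      also have "\<dots> \<le> K * L2_norm G (T (s - \<delta>) f)" using K \<delta> b Suc.prems by (intro K T_L2) auto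
      also have "\<dots> \<le> K * (K ^ Suc n * L2_norm G f)" using K1 by (intro mult_left_mono Suc.IH b Suc.prems) auto
      finally show ?thesis by (simp add: mult.assoc)
    qed
  qed
  obtain n where "t / \<delta> \<le> real n" using real_arch_simple by blast
  then have "t \<le> real (Suc n) * \<delta>" using \<delta> by (simp add: field_simps)
  with * K1 show thesis by (intro that[of "K ^ Suc n"]) (auto intro: order_trans)
qed

section \<open>Difference quotients and the generator\<close>

definition diff_quotient :: "('e \<Rightarrow> real \<Rightarrow> complex) \<Rightarrow> real \<Rightarrow> 'e \<Rightarrow> real \<Rightarrow> complex" where
  "diff_quotient f k = (\<lambda>e x. (T k f e x - f e x) / of_real k)"

lemma diff_quotient_L2:
  assumes "0 \<le> k" "f \<in> L2_graph G"
  shows "diff_quotient f k \<in> L2_graph G"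
  using L2_cmult[OF L2_diff[OF T_L2[OF assms] assms(2)], of "inverse (of_real k)"]
  by (simp add: diff_quotient_def divide_inverse mult.commute)

lemma generatorD:
  assumes "generator G T f f'"
  shows "f \<in> L2_graph G" "f' \<in> L2_graph G"
    "((\<lambda>k. L2_norm G (\<lambda>e x. diff_quotient f k e x - f' e x)) \<longlongrightarrow> 0) (at_right 0)"
  using assms by (auto simp: generator_def diff_quotient_def)

lemma T_diff_quotient:
  assumes "0 \<le> s" "0 \<le> k" "f \<in> L2_graph G"
  shows "L2_eq G (T s (diff_quotient f k)) (diff_quotient (T s f) k)"
proof -
  have "L2_eq G (T s (diff_quotient f k)) (\<lambda>e x. inverse (of_real k) * T s (\<lambda>e x. T k f e x - f e x) e x)"
    using T_cmult[OF assms(1) L2_diff[OF T_L2[OF assms(2,3)] assms(3)], of "inverse (of_real k)"]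
    by (simp add: diff_quotient_def divide_inverse mult.commute)
  moreover have "L2_eq G (T s (\<lambda>e x. T k f e x - f e x)) (\<lambda>e x. T s (T k f) e x - T s f e x)"
    using assms by (intro T_diff T_L2)
  moreover have "L2_eq G (T s (T k f)) (T k (T s f))"
    using L2_eq_trans[OF L2_eq_sym[OF T_compose[OF assms]] T_compose[OF assms(2,1,3), unfolded add.commute[of k s]]] .
  ultimately have "L2_eq G (T s (diff_quotient f k))
      (\<lambda>e x. inverse (of_real k) * (T k (T s f) e x - T s f e x))"
    by (blast intro: L2_eq_trans[OF _ L2_eq_cmult[OF L2_eq_trans[OF _ L2_eq_diff[OF _ L2_eq_refl]]]])
  then show ?thesis by (simp add: diff_quotient_def divide_inverse mult.commute)
qed

text \<open>\<open>T s\<close> commutes with the difference quotients and is bounded, so it carries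
  their convergence over.\<close>

lemma generator_T:
  assumes "generator G T f f'" "0 \<le> s"
  shows "generator G T (T s f) (T s f')"
proof -
  note f = generatorD[OF assms(1)]
  obtain C where C: "0 \<le> C" "\<And>f. f \<in> L2_graph G \<Longrightarrow> L2_norm G (T s f) \<le> C * L2_norm G f"
    using T_bounded[OF assms(2)] by metis
  have le: "L2_norm G (\<lambda>e x. diff_quotient (T s f) k e x - T s f' e x) \<le>
      C * L2_norm G (\<lambda>e x. diff_quotient f k e x - f' e x)" if "0 < k" for k
  proof -
    have k: "0 \<le> k" using that by simp
    note d = diff_quotient_L2[OF k f(1)]
    have "L2_norm G (\<lambda>e x. diff_quotient (T s f) k e x - T s f' e x) =
        L2_norm G (\<lambda>e x. T s (diff_quotient f k) e x - T s f' e x)"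
      using assms(2) k f by (intro L2_norm_cong L2_diff diff_quotient_L2 T_L2
          L2_eq_diff[OF L2_eq_sym[OF T_diff_quotient] L2_eq_refl])
    also have "\<dots> = L2_norm G (T s (\<lambda>e x. diff_quotient f k e x - f' e x))"
      by (rule T_norm_diff[OF assms(2) d f(2)])
    also have "\<dots> \<le> C * L2_norm G (\<lambda>e x. diff_quotient f k e x - f' e x)"
      by (intro C L2_diff d f)
    finally show ?thesis .
  qed
  have "((\<lambda>k. L2_norm G (\<lambda>e x. diff_quotient (T s f) k e x - T s f' e x)) \<longlongrightarrow> 0) (at_right 0)"
  proof (rule Lim_null_comparison)
    show "\<forall>\<^sub>F k in at_right 0. norm (L2_norm G (\<lambda>e x. diff_quotient (T s f) k e x - T s f' e x)) \<le>
        C * L2_norm G (\<lambda>e x. diff_quotient f k e x - f' e x)"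
      using eventually_at_right_less[of 0] by eventually_elim (simp add: L2_norm_nonneg le)
    show "((\<lambda>k. C * L2_norm G (\<lambda>e x. diff_quotient f k e x - f' e x)) \<longlongrightarrow> 0) (at_right 0)"
      using tendsto_mult_right_zero[OF f(3)] .
  qed
  then show ?thesis
    using T_L2[OF assms(2)] f by (simp add: generator_def diff_quotient_def)
qed

section \<open>Moving time across a cut inner product\<close>

definition cut_form ::
  "('e \<times> real) set \<Rightarrow> real \<Rightarrow> real \<Rightarrow> ('e \<Rightarrow> real \<Rightarrow> complex) \<Rightarrow> ('e \<Rightarrow> real \<Rightarrow> complex) \<Rightarrow> complex" where
  "cut_form W s r f h = L2_inner G (cut W (T s f)) (T r h)"

context
  fixes W assumes W: "W \<inter> space (edge_measure G) \<in> sets (edge_measure G)"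
begin

lemma cut_L2: "f \<in> L2_graph G \<Longrightarrow> cut W f \<in> L2_graph G"
  by (rule L2_cut[OF _ W])

lemma cut_form_diff_left:
  assumes "0 \<le> s" "0 \<le> r" "f \<in> L2_graph G" "g \<in> L2_graph G" "h \<in> L2_graph G"
  shows "cut_form W s r (\<lambda>e x. f e x - g e x) h = cut_form W s r f h - cut_form W s r g h"
proof -
  have "cut_form W s r (\<lambda>e x. f e x - g e x) h = L2_inner G (cut W (\<lambda>e x. T s f e x - T s g e x)) (T r h)"
    unfolding cut_form_def using assms by (intro L2_inner_cong cut_L2 T_L2 L2_diff L2_eq_cut T_diff L2_eq_refl)
  also have "cut W (\<lambda>e x. T s f e x - T s g e x) = (\<lambda>e x. cut W (T s f) e x - cut W (T s g) e x)"
    by (simp add: cut_def fun_eq_iff)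
  finally show ?thesis
    unfolding cut_form_def using assms by (simp add: L2_inner_diff_left cut_L2 T_L2)
qed

lemma cut_form_diff_right:
  assumes "0 \<le> s" "0 \<le> r" "f \<in> L2_graph G" "g \<in> L2_graph G" "h \<in> L2_graph G"
  shows "cut_form W s r h (\<lambda>e x. f e x - g e x) = cut_form W s r h f - cut_form W s r h g"
proof -
  have "cut_form W s r h (\<lambda>e x. f e x - g e x) = L2_inner G (cut W (T s h)) (\<lambda>e x. T r f e x - T r g e x)"
    unfolding cut_form_def using assms by (intro L2_inner_cong cut_L2 T_L2 L2_diff T_diff L2_eq_refl)
  then show ?thesis
    unfolding cut_form_def using assms by (simp add: L2_inner_diff_right cut_L2 T_L2)
qed

lemma cut_form_cmult_left:
  assumes "0 \<le> s" "0 \<le> r" "f \<in> L2_graph G" "h \<in> L2_graph G"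
  shows "cut_form W s r (\<lambda>e x. c * f e x) h = c * cut_form W s r f h"
proof -
  have "cut_form W s r (\<lambda>e x. c * f e x) h = L2_inner G (cut W (\<lambda>e x. c * T s f e x)) (T r h)"
    unfolding cut_form_def using assms by (intro L2_inner_cong cut_L2 T_L2 L2_cmult L2_eq_cut T_cmult L2_eq_refl)
  also have "cut W (\<lambda>e x. c * T s f e x) = (\<lambda>e x. c * cut W (T s f) e x)"
    by (simp add: cut_def fun_eq_iff)
  finally show ?thesis
    unfolding cut_form_def using assms by (simp add: L2_inner_cmult_left cut_L2 T_L2)
qed

lemma cut_form_cmult_right:
  assumes "0 \<le> s" "0 \<le> r" "f \<in> L2_graph G" "h \<in> L2_graph G"
  shows "cut_form W s r h (\<lambda>e x. c * f e x) = cnj c * cut_form W s r h f"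
proof -
  have "cut_form W s r h (\<lambda>e x. c * f e x) = L2_inner G (cut W (T s h)) (\<lambda>e x. c * T r f e x)"
    unfolding cut_form_def using assms by (intro L2_inner_cong cut_L2 T_L2 L2_cmult T_cmult L2_eq_refl)
  then show ?thesis
    unfolding cut_form_def using assms by (simp add: L2_inner_cmult_right cut_L2 T_L2)
qed

lemma cut_form_bound:
  assumes sr: "0 \<le> s" "0 \<le> r" and f: "f \<in> L2_graph G" and h: "h \<in> L2_graph G" and "0 \<le> K"
    and K: "L2_norm G (T s f) \<le> K * L2_norm G f" "L2_norm G (T r h) \<le> K * L2_norm G h"
  shows "cmod (cut_form W s r f h) \<le> K\<^sup>2 * L2_norm G f * L2_norm G h"
proof -
  have "cmod (cut_form W s r f h) \<le> L2_norm G (cut W (T s f)) * L2_norm G (T r h)"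
    unfolding cut_form_def by (intro L2_Cauchy_Schwarz cut_L2 T_L2 sr f h)
  also have "\<dots> \<le> (K * L2_norm G f) * (K * L2_norm G h)"
    using L2_norm_cut_le[OF T_L2[OF sr(1) f] W] K \<open>0 \<le> K\<close>
    by (intro mult_mono order_trans[OF _ K(1)]) (auto simp: L2_norm_nonneg)
  finally show ?thesis by (simp add: power2_eq_square mult_ac)
qed

text \<open>Moving a time step \<open>k\<close> from the left to the right factor changes the form by \<open>o(k)\<close>,
  uniformly in \<open>s\<close> and \<open>r\<close>, since the contributions of order \<open>k\<close> cancel exactly by \<open>sym\<close>. Thus no
  derivative of \<open>s \<mapsto> (1\<^sub>W T(s) f | T(t-s) h)\<close> has to be formed.\<close>

lemma cut_commutes_on_generator:
  assumes sym: "\<And>f f' h h'. generator G T f f' \<Longrightarrow> generator G T h h' \<Longrightarrow>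
      L2_inner G (cut W f') h = L2_inner G (cut W f) h'"
    and f: "generator G T f f'" and h: "generator G T h h'" and t: "0 \<le> t"
  shows "L2_inner G (cut W (T t f)) h = L2_inner G (cut W f) (T t h)"
proof -
  note fL = generatorD[OF f] and hL = generatorD[OF h]
  obtain K where K: "0 \<le> K"
    "\<And>s f. 0 \<le> s \<Longrightarrow> s \<le> t \<Longrightarrow> f \<in> L2_graph G \<Longrightarrow> L2_norm G (T s f) \<le> K * L2_norm G f"
    using T_bounded_upto by metis
  \<comment> \<open>The bound for the error of one step divided by its length: the distances of the
    difference quotients to their limits, with a factor \<open>K\<close> for each of the two
    operators.\<close>
  define \<epsilon> where "\<epsilon> k = K\<^sup>2 * (L2_norm G (\<lambda>e x. diff_quotient f k e x - f' e x) * L2_norm G h +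
      L2_norm G f * L2_norm G (\<lambda>e x. diff_quotient h k e x - h' e x))" for k
  have step: "cmod (cut_form W (s + k) r f h - cut_form W s (r + k) f h) \<le> k * \<epsilon> k"
    if "0 \<le> s" "s \<le> t" "0 \<le> r" "r \<le> t" "0 < k" for s r k
  proof -
    have k: "0 \<le> k" using that by simp
    let ?u = "diff_quotient f k" and ?v = "diff_quotient h k"
    note u = diff_quotient_L2[OF k fL(1)] and v = diff_quotient_L2[OF k hL(1)]
    note L = fL(1,2) hL(1,2) u v T_L2[OF k fL(1)] T_L2[OF k hL(1)]
    have 1: "cut_form W (s + k) r f h = cut_form W s r (T k f) h"
      unfolding cut_form_def using that k L by (intro L2_inner_cong cut_L2 T_L2 L2_eq_cut T_compose L2_eq_refl) auto
    have 2: "cut_form W s (r + k) f h = cut_form W s r f (T k h)"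
      unfolding cut_form_def using that k L by (intro L2_inner_cong cut_L2 T_L2 T_compose L2_eq_refl) auto
    have eq: "(\<lambda>e x. T k f e x - f e x) = (\<lambda>e x. of_real k * ?u e x)"
      "(\<lambda>e x. T k h e x - h e x) = (\<lambda>e x. of_real k * ?v e x)"
      using that by (auto simp: diff_quotient_def fun_eq_iff)
    have 3: "cut_form W s r (T k f) h - cut_form W s r f h = of_real k * cut_form W s r ?u h"
      using cut_form_diff_left[OF that(1,3) L(7,1,3)] cut_form_cmult_left[OF that(1,3) u L(3)] by (simp add: eq)
    have 4: "cut_form W s r f (T k h) - cut_form W s r f h = of_real k * cut_form W s r f ?v"
      using cut_form_diff_right[OF that(1,3) L(8,3,1)] cut_form_cmult_right[OF that(1,3) v L(1), of "of_real k"] by (simp add: eq)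
    have 5: "cut_form W s r f' h = cut_form W s r f h'"
      unfolding cut_form_def by (rule sym[OF generator_T[OF f that(1)] generator_T[OF h that(3)]])
    let ?a = "\<lambda>e x. ?u e x - f' e x" and ?b = "\<lambda>e x. ?v e x - h' e x"
    have ab: "?a \<in> L2_graph G" "?b \<in> L2_graph G" by (intro L2_diff L)+
    have D: "cut_form W (s + k) r f h - cut_form W s (r + k) f h =
        of_real k * (cut_form W s r ?a h - cut_form W s r f ?b)"
    proof -
      have "cut_form W s r ?a h - cut_form W s r f ?b = cut_form W s r ?u h - cut_form W s r f ?v"
        using 5 cut_form_diff_left[OF that(1,3) L(5,2,3)] cut_form_diff_right[OF that(1,3) L(6,4,1)] by simp
      moreover have "cut_form W (s + k) r f h - cut_form W s (r + k) f h =
          of_real k * cut_form W s r ?u h - of_real k * cut_form W s r f ?v"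
        unfolding 1 2 3[symmetric] 4[symmetric] by simp
      ultimately show ?thesis by (simp only: right_diff_distrib)
    qed
    have "cmod (cut_form W (s + k) r f h - cut_form W s (r + k) f h) \<le>
        k * (cmod (cut_form W s r ?a h) + cmod (cut_form W s r f ?b))"
      unfolding D using that by (simp add: norm_mult norm_triangle_ineq4 mult_left_mono)
    also have "\<dots> \<le> k * (K\<^sup>2 * L2_norm G ?a * L2_norm G h + K\<^sup>2 * L2_norm G f * L2_norm G ?b)"
      using that by (intro mult_left_mono add_mono cut_form_bound K L ab) auto
    finally show ?thesis by (simp add: \<epsilon>_def algebra_simps)
  qed
  have "(\<epsilon> \<longlongrightarrow> K\<^sup>2 * (0 * L2_norm G h + L2_norm G f * 0)) (at_right 0)"
    unfolding \<epsilon>_def by (intro tendsto_intros fL hL)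
  then have \<epsilon>0: "(\<epsilon> \<longlongrightarrow> 0) (at_right 0)" by simp
  show ?thesis
  proof (cases "t = 0")
    case True
    then show ?thesis
      using fL hL by (intro L2_inner_cong cut_L2 T_L2 L2_eq_cut) (auto intro: T_zero L2_eq_sym)
  next
    case False
    then have t: "0 < t" using t by simp
    have le: "cmod (cut_form W t 0 f h - cut_form W 0 t f h) \<le> t * \<epsilon> (t / real (Suc n))" for n
    proof -
      define k where "k = t / real (Suc n)"
      have k: "0 < k" using t by (simp add: k_def)
      have kn: "real (Suc n) * k = t" by (simp add: k_def)
      \<comment> \<open>Telescoping: after \<open>j\<close> of the \<open>n + 1\<close> steps the
        left factor carries the time \<open>j * k\<close>. All steps together cost
        \<open>t * \<epsilon> k\<close>, which tends to \<open>0\<close> with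
        \<open>k\<close>.\<close>
      have part: "cmod (cut_form W (real j * k) (t - real j * k) f h - cut_form W 0 t f h) \<le> real j * (k * \<epsilon> k)"
        if "j \<le> Suc n" for j
        using that
      proof (induction j)
        case (Suc j)
        have j: "real (Suc j) * k \<le> t" unfolding kn[symmetric] using Suc.prems k by (intro mult_right_mono) auto
        then have j': "real j * k + k \<le> t" by (simp add: algebra_simps)
        have "0 \<le> real j * k" using k by simp
        with j' k have "cmod (cut_form W (real j * k + k) (t - real j * k - k) f h -
            cut_form W (real j * k) ((t - real j * k - k) + k) f h) \<le> k * \<epsilon> k"
          by (intro step) linarith+
        then have "cmod (cut_form W (real (Suc j) * k) (t - real (Suc j) * k) f h -
            cut_form W (real j * k) (t - real j * k) f h) \<le> k * \<epsilon> k"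
          by (simp add: algebra_simps)
        then have "cmod (cut_form W (real (Suc j) * k) (t - real (Suc j) * k) f h - cut_form W 0 t f h)
            \<le> k * \<epsilon> k + real j * (k * \<epsilon> k)"
          using Suc.IH Suc.prems by (intro norm_diff_triangle_le[where y="cut_form W (real j * k) (t - real j * k) f h"]) auto
        then show ?case by (simp add: algebra_simps)
      qed simp
      from part[of "Suc n"] have "cmod (cut_form W t 0 f h - cut_form W 0 t f h) \<le> real (Suc n) * (k * \<epsilon> k)"
        unfolding kn by simp
      then have "cmod (cut_form W t 0 f h - cut_form W 0 t f h) \<le> t * \<epsilon> k"
        unfolding mult.assoc[symmetric] kn .
      then show ?thesis by (simp only: k_def)
    qed
    have "filterlim (\<lambda>n. t / real (Suc n)) (at_right 0) sequentially"
    proof (rule tendsto_imp_filterlim_at_right)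
      show "(\<lambda>n. t / real (Suc n)) \<longlonglongrightarrow> 0"
        using tendsto_mult_right_zero[OF LIMSEQ_inverse_real_of_nat, of t] by (simp add: divide_inverse)
    qed (use t in auto)
    from filterlim_compose[OF \<epsilon>0 this] have "(\<lambda>n. t * \<epsilon> (t / real (Suc n))) \<longlonglongrightarrow> 0"
      by (rule tendsto_mult_right_zero)
    then have "cmod (cut_form W t 0 f h - cut_form W 0 t f h) \<le> 0"
      by (rule tendsto_lowerbound) (intro always_eventually allI le, simp)
    then have "cut_form W t 0 f h = cut_form W 0 t f h" by simp
    moreover have "cut_form W t 0 f h = L2_inner G (cut W (T t f)) h"
      unfolding cut_form_def using t fL hL by (intro L2_inner_cong cut_L2 T_L2 L2_eq_refl T_zero) auto
    moreover have "cut_form W 0 t f h = L2_inner G (cut W f) (T t h)"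
      unfolding cut_form_def using t fL hL by (intro L2_inner_cong cut_L2 T_L2 L2_eq_cut L2_eq_refl T_zero) auto
    ultimately show ?thesis by simp
  qed
qed

text \<open>Both sides are bounded sesquilinear forms in \<open>f\<close> and \<open>h\<close>, so
  their agreement extends from the dense domain of the generator, one argument at a time.\<close>

lemma cut_commutes:
  assumes sym: "\<And>f f' h h'. generator G T f f' \<Longrightarrow> generator G T h h' \<Longrightarrow>
      L2_inner G (cut W f') h = L2_inner G (cut W f) h'"
    and dense: "\<And>f \<epsilon>. f \<in> L2_graph G \<Longrightarrow> 0 < \<epsilon> \<Longrightarrow>
      \<exists>F F'. generator G T F F' \<and> L2_norm G (\<lambda>e x. f e x - F e x) < \<epsilon>"
    and f: "f \<in> L2_graph G" and h: "h \<in> L2_graph G" and t: "0 \<le> t"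
  shows "L2_inner G (cut W (T t f)) h = L2_inner G (cut W f) (T t h)"
proof -
  \<comment> \<open>Both terms are written as \<open>cut_form\<close>, keeping \<open>T 0\<close>,
    so that its linearity and its bound apply to them alike.\<close>
  define B where "B f h = cut_form W t 0 f h - cut_form W 0 t f h" for f h
  have B: "B f h = L2_inner G (cut W (T t f)) h - L2_inner G (cut W f) (T t h)"
    if "f \<in> L2_graph G" "h \<in> L2_graph G" for f h
  proof -
    have "cut_form W t 0 f h = L2_inner G (cut W (T t f)) h"
      unfolding cut_form_def using t that by (intro L2_inner_cong cut_L2 T_L2 L2_eq_refl T_zero) auto
    moreover have "cut_form W 0 t f h = L2_inner G (cut W f) (T t h)"
      unfolding cut_form_def using t that by (intro L2_inner_cong cut_L2 T_L2 L2_eq_cut L2_eq_refl T_zero) auto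
    ultimately show ?thesis by (simp add: B_def)
  qed
  obtain K where K: "0 \<le> K"
    "\<And>s f. 0 \<le> s \<Longrightarrow> s \<le> t \<Longrightarrow> f \<in> L2_graph G \<Longrightarrow> L2_norm G (T s f) \<le> K * L2_norm G f"
    using T_bounded_upto by metis
  have Bbound: "cmod (B f h) \<le> 2 * K\<^sup>2 * L2_norm G f * L2_norm G h"
    if "f \<in> L2_graph G" "h \<in> L2_graph G" for f h
  proof -
    have "cmod (cut_form W t 0 f h) \<le> K\<^sup>2 * L2_norm G f * L2_norm G h"
      "cmod (cut_form W 0 t f h) \<le> K\<^sup>2 * L2_norm G f * L2_norm G h"
      using t that K by (intro cut_form_bound; simp)+
    then show ?thesis using norm_triangle_ineq4[of "cut_form W t 0 f h" "cut_form W 0 t f h"] by (simp add: B_def)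
  qed
  have small: "z = 0" if "\<And>\<epsilon>. 0 < \<epsilon> \<Longrightarrow> cmod z \<le> c * \<epsilon>" for z c
  proof -
    have "(\<lambda>n. c * inverse (real (Suc n))) \<longlonglongrightarrow> 0"
      by (rule tendsto_mult_right_zero[OF LIMSEQ_inverse_real_of_nat])
    then have "cmod z \<le> 0"
      by (rule tendsto_lowerbound) (intro always_eventually allI that, simp_all)
    then show ?thesis by simp
  qed
  have gen: "B F h = 0" if F: "generator G T F F'" and h: "h \<in> L2_graph G" for F F' h
  proof (rule small)
    fix \<epsilon> :: real assume "0 < \<epsilon>"
    then obtain H H' where H: "generator G T H H'" "L2_norm G (\<lambda>e x. h e x - H e x) < \<epsilon>"
      using dense[OF h] by metis
    note L = generatorD(1)[OF F] generatorD(1)[OF H(1)]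
    have "B F h = B F (\<lambda>e x. h e x - H e x) + B F H"
      using t L h by (simp add: B_def cut_form_diff_right)
    also have "B F H = 0"
      using cut_commutes_on_generator[OF sym F H(1) t] L by (simp add: B)
    finally have "cmod (B F h) \<le> 2 * K\<^sup>2 * L2_norm G F * L2_norm G (\<lambda>e x. h e x - H e x)"
      using Bbound[OF L(1) L2_diff[OF h L(2)]] by simp
    also have "\<dots> \<le> 2 * K\<^sup>2 * L2_norm G F * \<epsilon>"
      using H(2) by (intro mult_left_mono) (auto simp: L2_norm_nonneg)
    finally show "cmod (B F h) \<le> 2 * K\<^sup>2 * L2_norm G F * \<epsilon>" .
  qed
  have "B f h = 0"
  proof (rule small)
    fix \<epsilon> :: real assume "0 < \<epsilon>"
    then obtain F F' where F: "generator G T F F'" "L2_norm G (\<lambda>e x. f e x - F e x) < \<epsilon>"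
      using dense[OF f] by metis
    note L = generatorD(1)[OF F(1)]
    have "B f h = B (\<lambda>e x. f e x - F e x) h + B F h"
      using t L f h by (simp add: B_def cut_form_diff_left)
    also have "B F h = 0" by (rule gen[OF F(1) h])
    finally have "cmod (B f h) \<le> 2 * K\<^sup>2 * L2_norm G (\<lambda>e x. f e x - F e x) * L2_norm G h"
      using Bbound[OF L2_diff[OF f L] h] by simp
    also have "\<dots> = (2 * K\<^sup>2 * L2_norm G h) * L2_norm G (\<lambda>e x. f e x - F e x)" by simp
    also have "\<dots> \<le> 2 * K\<^sup>2 * L2_norm G h * \<epsilon>"
      using F(2) by (intro mult_left_mono) (auto simp: L2_norm_nonneg)
    finally show "cmod (B f h) \<le> 2 * K\<^sup>2 * L2_norm G h * \<epsilon>" .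
  qed
  then show ?thesis by (simp add: B f h)
qed

end

end

section \<open>The Laplacian\<close>

lemma complex_test_cnj:
  assumes "complex_test \<phi> \<phi>'"
  shows "complex_test (\<lambda>x. cnj (\<phi> x)) (\<lambda>x. cnj (\<phi>' x))"
  using assms unfolding complex_test_def
  by (auto intro!: continuous_intros bounded_linear.has_vector_derivative[OF bounded_linear_cnj])

lemma weak_deriv_AE_eq:
  assumes "has_weak_deriv f g"
  shows "f \<in> H1_interval" "AE x in unit_interval. weak_deriv f x = g x"
proof -
  show "f \<in> H1_interval" using assms by (auto simp: H1_interval_def)
  then show "AE x in unit_interval. weak_deriv f x = g x"
    using has_weak_deriv_unique[OF weak_deriv_works assms] by blast
qed

lemma sqnorm_weak_deriv:
  assumes "has_weak_deriv f g"
  shows "sqnorm_interval (weak_deriv f) = sqnorm_interval g"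
proof -
  note w = has_weak_deriv_sqint(2)[OF weak_deriv_works[OF weak_deriv_AE_eq(1)[OF assms]]]
  show ?thesis
    unfolding sqnorm_interval_def
    by (rule integral_cong_AE)
      (use weak_deriv_AE_eq(2)[OF assms] sqint_measurable[OF w] sqint_measurable[OF has_weak_deriv_sqint(2)[OF assms]] in auto)
qed

lemma has_weak_deriv_zero: "has_weak_deriv (\<lambda>x. 0) (\<lambda>x. 0)"
  by (rule has_weak_deriv_classical) auto

lemma continuous_rep_zero: "x \<in> {0..1} \<Longrightarrow> continuous_rep (\<lambda>x. 0) x = 0"
  using continuous_rep_eq[of "\<lambda>x. 0" "\<lambda>x. 0"] by simp

lemma integral_weak_deriv_zero:
  assumes g: "g \<in> sqint unit_interval"
  shows "(LINT x|unit_interval. g x * cnj (weak_deriv (\<lambda>x. 0) x)) = 0"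
proof -
  note w = weak_deriv_works[OF weak_deriv_AE_eq(1)[OF has_weak_deriv_zero]]
  have "(LINT x|unit_interval. g x * cnj (weak_deriv (\<lambda>x. 0) x)) = (LINT x|unit_interval. 0)"
    by (rule integral_cong_AE)
      (use weak_deriv_AE_eq(2)[OF has_weak_deriv_zero] sqint_measurable[OF g] sqint_measurable[OF cnj_sqint[OF has_weak_deriv_sqint(2)[OF w]]] in auto)
  then show ?thesis by simp
qed

text \<open>Almost everywhere, and by continuity everywhere, \<open>u * (F - u) = 0\<close>. On
  \<open>{a..b}\<close> the quotient \<open>u / F\<close> is thus continuous with values in
  \<open>{0, 1}\<close>, hence constant, and its value decides the alternative.\<close>

lemma continuous_cut_constant:
  fixes F u :: "real \<Rightarrow> complex"
  assumes u: "continuous_on {0..1} u" and F: "continuous_on {0..1} F"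
    and ae: "AE x in unit_interval. (if x \<in> S then F x else 0) = u x"
    and ab: "0 \<le> a" "b \<le> 1" and nz: "\<And>x. x \<in> {a..b} \<Longrightarrow> F x \<noteq> 0"
  shows "(AE x in unit_interval. x \<in> {a..b} \<longrightarrow> x \<in> S) \<or> (AE x in unit_interval. x \<in> {a..b} \<longrightarrow> x \<notin> S)"
proof -
  have "u x * (F x - u x) = 0" if "x \<in> {0..1}" for x
  proof (rule continuous_AE_unit_interval_eq[where v="\<lambda>x. 0", OF _ _ _ that])
    show "AE x in unit_interval. u x * (F x - u x) = 0"
      using ae by eventually_elim (auto split: if_splits)
  qed (intro continuous_intros u F)+
  then have cases: "u x = 0 \<or> u x = F x" if "x \<in> {a..b}" for x
  proof -
    have "x \<in> {0..1}" using that ab by auto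
    from \<open>\<And>x. x \<in> {0..1} \<Longrightarrow> u x * (F x - u x) = 0\<close>[OF this] show ?thesis by auto
  qed
  have "(\<lambda>x. u x / F x) constant_on {a..b}"
  proof (rule continuous_finite_range_constant)
    show "continuous_on {a..b} (\<lambda>x. u x / F x)"
      using ab nz by (intro continuous_intros continuous_on_subset[OF u] continuous_on_subset[OF F]) auto
    have vals: "u x / F x \<in> {0, 1}" if "x \<in> {a..b}" for x
      using cases[OF that] nz[OF that] by auto
    have "(\<lambda>x. u x / F x) ` {a..b} \<subseteq> {0, 1}" by (rule image_subsetI) (rule vals)
    then show "finite ((\<lambda>x. u x / F x) ` {a..b})" by (rule finite_subset) simp
  qed simp
  then obtain c where c: "\<And>x. x \<in> {a..b} \<Longrightarrow> u x / F x = c" by (auto simp: constant_on_def)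
  show ?thesis
  proof (cases "c = 0")
    case True
    then have u0: "u x = 0" if "x \<in> {a..b}" for x using c[OF that] nz[OF that] by simp
    have "AE x in unit_interval. x \<in> {a..b} \<longrightarrow> x \<notin> S"
      using ae by eventually_elim (use nz u0 in \<open>auto split: if_splits\<close>)
    then show ?thesis ..
  next
    case False
    then have u0: "u x \<noteq> 0" if "x \<in> {a..b}" for x using c[OF that] by auto
    have "AE x in unit_interval. x \<in> {a..b} \<longrightarrow> x \<in> S"
      using ae by eventually_elim (use u0 in \<open>auto split: if_splits\<close>)
    then show ?thesis ..
  qed
qed

text \<open>On each of the intervals \<open>I m\<close>, which exhaust the open interval, some bump
  has no zero, so \<open>S\<close> is null or full there. All of them contain
  \<open>{1/3..2/3}\<close>, so the same alternative holds for every \<open>m\<close>.\<close>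

lemma unit_interval_dichotomy:
  assumes "\<And>n. \<exists>u. continuous_on {0..1} u \<and>
    (AE x in unit_interval. (if x \<in> S then complex_of_real (smooth_step (real n * (x * (1 - x)) - 1)) else 0) = u x)"
  shows "(AE x in unit_interval. x \<in> S) \<or> (AE x in unit_interval. x \<notin> S)"
proof -
  define I where "I m = {1 / real (m + 3) .. 1 - 1 / real (m + 3)}" for m :: nat
  have I: "(AE x in unit_interval. x \<in> I m \<longrightarrow> x \<in> S) \<or> (AE x in unit_interval. x \<in> I m \<longrightarrow> x \<notin> S)" for m
  proof -
    let ?m = "real (m + 3)"
    \<comment> \<open>With \<open>M = m + 3\<close>, the product \<open>x * (1 - x)\<close> is at
      least \<open>1/M * (1 - 1/M)\<close> on \<open>I m\<close>. The factor \<open>M^2\<close>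
      turns this into \<open>M - 1 \<ge> 2\<close>, so the argument of \<open>smooth_step\<close> is
      positive.\<close>
    let ?F = "\<lambda>x. complex_of_real (smooth_step (real ((m + 3)\<^sup>2) * (x * (1 - x)) - 1))"
    obtain u where u: "continuous_on {0..1} u" "AE x in unit_interval. (if x \<in> S then ?F x else 0) = u x"
      using assms by blast
    have "?F x \<noteq> 0" if "x \<in> I m" for x
    proof -
      have x: "1 / ?m \<le> x" "1 / ?m \<le> 1 - x" using that by (auto simp: I_def)
      have m3: "?m \<ge> 3" by simp
      have "1 / ?m * (1 - 1 / ?m) \<le> x * (1 - x)"
      proof -
        have "0 \<le> (x - 1 / ?m) * (1 - x - 1 / ?m)" using x by (intro mult_nonneg_nonneg) auto
        then show ?thesis by (simp add: algebra_simps)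
      qed
      then have "?m\<^sup>2 * (1 / ?m * (1 - 1 / ?m)) \<le> ?m\<^sup>2 * (x * (1 - x))" by (rule mult_left_mono) simp
      moreover have "?m\<^sup>2 * (1 / ?m * (1 - 1 / ?m)) = ?m - 1"
      proof -
        have *: "a\<^sup>2 * (1 / a * (1 - 1 / a)) = a - 1" if "a \<noteq> 0" for a :: real
          using that by (simp add: power2_eq_square field_simps)
        show ?thesis by (rule *) simp
      qed
      ultimately have "0 < ?m\<^sup>2 * (x * (1 - x)) - 1" using m3 by linarith
      from smooth_step_pos[OF this] show ?thesis by simp
    qed
    then show ?thesis
      unfolding I_def
      by (intro continuous_cut_constant[OF u(1) _ u(2)] continuous_intros continuous_on_compose2[OF smooth_step_continuous(1)]) auto
  qed
  have all: "AE x in unit_interval. P x" if "\<And>m. AE x in unit_interval. x \<in> I m \<longrightarrow> P x" for P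
  proof -
    have "AE x in unit_interval. \<forall>m. x \<in> I m \<longrightarrow> P x" unfolding AE_all_countable using that by blast
    moreover have "AE x in unit_interval. x \<notin> {0, 1}" by (rule AE_unit_interval_negligible) simp
    ultimately show ?thesis
      using AE_space
    proof eventually_elim
      fix x assume P: "\<forall>m. x \<in> I m \<longrightarrow> P x" and "x \<notin> {0, 1}" "x \<in> space unit_interval"
      then have x: "0 < x" "x < 1" by auto
      obtain m where m: "max (1 / x) (1 / (1 - x)) < real m" using reals_Archimedean2 by blast
      then have "1 / x < real (m + 3)" "1 / (1 - x) < real (m + 3)" by auto
      then have "1 / real (m + 3) \<le> x" "1 / real (m + 3) \<le> 1 - x" using x by (auto simp: field_simps)
      then have "x \<in> I m" by (auto simp: I_def)
      with P show "P x" by blast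
    qed
  qed
  show ?thesis
  proof (rule ccontr)
    assume "\<not> ?thesis"
    then obtain m1 m2 where m: "\<not> (AE x in unit_interval. x \<in> I m1 \<longrightarrow> x \<in> S)" "\<not> (AE x in unit_interval. x \<in> I m2 \<longrightarrow> x \<notin> S)"
      using all[of "\<lambda>x. x \<in> S"] all[of "\<lambda>x. x \<notin> S"] by blast
    then have 1: "AE x in unit_interval. x \<in> I m1 \<longrightarrow> x \<notin> S" and 2: "AE x in unit_interval. x \<in> I m2 \<longrightarrow> x \<in> S"
      using I by blast+
    have sub: "{1/3..2/3} \<subseteq> I m" for m
    proof -
      have "1 / real (m + 3) \<le> 1 / 3" by (intro divide_left_mono) auto
      then show ?thesis by (auto simp: I_def)
    qed
    have "AE x in unit_interval. x \<notin> {1/3..2/3}"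
      using 1 2 by eventually_elim (use sub in blast)
    from negligible_AE_unit_interval[OF this] have "negligible {1/3<..<2/3::real}"
      by (rule negligible_subset) auto
    moreover have "(1/2::real) \<in> {1/3<..<2/3}" by simp
    ultimately show False using open_not_negligible[OF open_greaterThanLessThan] by blast
  qed
qed

section \<open>Smooth fields, the form domain and the Laplacian\<close>

context countable_digraph
begin

lemma smooth_field_weak_deriv:
  assumes "smooth_field F \<phi> \<phi>'" "e \<in> arcs G"
  shows "has_weak_deriv (F e) (\<phi> e)"
  using assms unfolding smooth_field_def
  by (intro has_weak_deriv_classical) (auto intro: complex_test_continuous)

lemma smooth_field_continuous:
  assumes "smooth_field F \<phi> \<phi>'" "e \<in> arcs G"
  shows "continuous_on S (F e)"
  using assms unfolding smooth_field_def by (intro vector_derivative_imp_continuous_on) auto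

lemma smooth_field_form_domain:
  assumes sf: "smooth_field F \<phi> \<phi>'"
    and d: "\<And>e. e \<in> arcs G \<Longrightarrow> F e 0 = d (tail G e)" "\<And>e. e \<in> arcs G \<Longrightarrow> F e 1 = d (head G e)"
    and V: "finite V" "\<And>v. v \<in> verts G - V \<Longrightarrow> d v = 0"
  shows "F \<in> form_domain G"
proof -
  obtain E where E: "finite E" "E \<subseteq> arcs G" "\<And>e. e \<in> arcs G - E \<Longrightarrow> F e = (\<lambda>x. 0)"
    "\<And>e. e \<in> arcs G - E \<Longrightarrow> \<phi> e = (\<lambda>x. 0)"
    using sf unfolding smooth_field_def by (metis ext)
  have "F \<in> H1_graph G"
    unfolding H1_graph_def
  proof (intro CollectI conjI ballI)
    show "F e \<in> H1_interval" if "e \<in> arcs G" for e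
      by (rule weak_deriv_AE_eq(1)[OF smooth_field_weak_deriv[OF sf that]])
    show "(\<lambda>e. sqnorm_interval (F e) + sqnorm_interval (weak_deriv (F e))) summable_on arcs G"
    proof (rule summable_on_finite_support(1)[OF E(1,2)])
      fix e assume e: "e \<in> arcs G - E"
      then have "sqnorm_interval (weak_deriv (F e)) = sqnorm_interval (\<phi> e)"
        by (intro sqnorm_weak_deriv smooth_field_weak_deriv[OF sf]) auto
      then show "sqnorm_interval (F e) + sqnorm_interval (weak_deriv (F e)) = 0"
        using E(3,4)[OF e] by (simp add: sqnorm_interval_def)
    qed
  qed
  moreover have "(\<lambda>v. (cmod (d v))\<^sup>2) summable_on verts G"
    by (rule summable_on_finite_support(1)[of "V \<inter> verts G"]) (use V in auto)
  moreover have "continuous_rep (F e) x = F e x" if "e \<in> arcs G" "x \<in> {0..1}" for e x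
    using that by (intro continuous_rep_eq smooth_field_continuous[OF sf]) auto
  ultimately show ?thesis using d unfolding form_domain_def by auto
qed

lemma form_domain_H1: "\<psi> \<in> form_domain G \<Longrightarrow> e \<in> arcs G \<Longrightarrow> \<psi> e \<in> H1_interval"
  by (simp add: form_domain_def H1_graph_def)

text \<open>The derivative \<open>\<phi>\<close> has compact support in each open edge, so its
  conjugate may serve as a test function for the weak derivative of \<open>g\<close>. No boundary
  terms arise, whatever the node values of \<open>F\<close> and \<open>g\<close> are.\<close>

lemma smooth_field_laplacian:
  assumes sf: "smooth_field F \<phi> \<phi>'" and F: "F \<in> form_domain G"
  shows "laplacian G F \<phi>'"
  unfolding laplacian_def
proof (intro conjI ballI F smooth_field_L2(3)[OF sf])
  fix g assume g: "g \<in> form_domain G"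
  have "(LINT x|unit_interval. weak_deriv (F e) x * cnj (weak_deriv (g e) x)) =
      - (LINT x|unit_interval. \<phi>' e x * cnj (g e x))" if e: "e \<in> arcs G" for e
  proof -
    have ct: "complex_test (\<phi> e) (\<phi>' e)" using sf e by (simp add: smooth_field_def)
    note wF = smooth_field_weak_deriv[OF sf e] and wg = weak_deriv_works[OF form_domain_H1[OF g e]]
    note sqs = has_weak_deriv_sqint(2)[OF weak_deriv_works[OF weak_deriv_AE_eq(1)[OF wF]]]
      has_weak_deriv_sqint(2)[OF wF] cnj_sqint[OF has_weak_deriv_sqint(2)[OF wg]]
    have "(LINT x|unit_interval. weak_deriv (F e) x * cnj (weak_deriv (g e) x)) =
        (LINT x|unit_interval. \<phi> e x * cnj (weak_deriv (g e) x))"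
      by (rule integral_cong_AE) (use weak_deriv_AE_eq(2)[OF wF] sqs[THEN sqint_measurable] in auto)
    also have "\<dots> = cnj (LINT x|unit_interval. weak_deriv (g e) x * cnj (\<phi> e x))"
      unfolding Bochner_Integration.integral_cnj[symmetric] by (simp add: mult.commute)
    also have "\<dots> = cnj (- (LINT x|unit_interval. g e x * cnj (\<phi>' e x)))"
      using has_weak_deriv_complex_test[OF wg complex_test_cnj[OF ct]] by simp
    also have "\<dots> = - (LINT x|unit_interval. \<phi>' e x * cnj (g e x))"
      unfolding complex_cnj_minus Bochner_Integration.integral_cnj[symmetric] by (simp add: mult.commute)
    finally show ?thesis .
  qed
  then show "dirichlet_form G F g = - L2_inner G \<phi>' g"
    unfolding dirichlet_form_def L2_inner_def infsum_uminus[symmetric] by (intro infsum_cong)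
qed

definition closed_edges :: "'e set \<Rightarrow> bool" where
  "closed_edges A \<longleftrightarrow> A \<subseteq> arcs G \<and>
     (\<forall>e\<in>A. \<forall>e'\<in>arcs G. \<forall>v\<in>verts G.
        edegree G v < \<infinity> \<and> incident G v e \<and> incident G v e' \<longrightarrow> e' \<in> A)"

text \<open>The defining condition is symmetric in the two edges: no node of finite degree joins
  \<open>A\<close> to its complement.\<close>

lemma closed_edges_compl: "closed_edges A \<Longrightarrow> closed_edges (arcs G - A)"
  unfolding closed_edges_def by blast

lemma closed_edges_arcs: "closed_edges (arcs G)"
  unfolding closed_edges_def by blast

text \<open>The trace inequality bounds \<open>\<bar>d\<^sub>v\<bar>\<^sup>2\<close> on every edge at \<open>v\<close> by a summable sequence.\<close>

lemma infinite_degree_trace_zero: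
  assumes \<psi>: "\<psi> \<in> H1_graph G"
    and d: "\<And>e. e \<in> arcs G \<Longrightarrow> continuous_rep (\<psi> e) 0 = d (tail G e)"
      "\<And>e. e \<in> arcs G \<Longrightarrow> continuous_rep (\<psi> e) 1 = d (head G e)"
    and v: "edegree G v = \<infinity>"
  shows "d v = 0"
proof (rule ccontr)
  assume "d v \<noteq> 0"
  let ?S = "in_arcs G v \<union> out_arcs G v"
  let ?s = "\<lambda>e. sqnorm_interval (\<psi> e) + sqnorm_interval (weak_deriv (\<psi> e))"
  have "infinite ?S" using v by (auto simp: edegree_def split: if_splits)
  have S: "?S \<subseteq> arcs G" by auto
  have summ: "?s summable_on arcs G" using \<psi> by (simp add: H1_graph_def)
  have lb: "(cmod (d v))\<^sup>2 / 2 \<le> ?s e" if "e \<in> ?S" for e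
  proof -
    have e: "e \<in> arcs G" using that S by blast
    then have "\<psi> e \<in> H1_interval" using \<psi> by (simp add: H1_graph_def)
    from trace_inequality[OF this, of 0] trace_inequality[OF this, of 1] that d[OF e]
    show ?thesis by (auto simp: in_arcs_def out_arcs_def)
  qed
  \<comment> \<open>Already \<open>n\<close> edges at \<open>v\<close> would contribute more than
    the whole sum.\<close>
  obtain n where n: "infsum ?s (arcs G) < real n * ((cmod (d v))\<^sup>2 / 2)"
    using reals_Archimedean3[of "(cmod (d v))\<^sup>2 / 2"] \<open>d v \<noteq> 0\<close> by auto
  obtain E where E: "E \<subseteq> ?S" "finite E" "card E = n"
    using infinite_arbitrarily_large[OF \<open>infinite ?S\<close>] by metis
  have "real n * ((cmod (d v))\<^sup>2 / 2) = (\<Sum>e\<in>E. (cmod (d v))\<^sup>2 / 2)" using E by simp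
  also have "\<dots> \<le> sum ?s E" using E lb by (intro sum_mono) auto
  also have "\<dots> \<le> infsum ?s (arcs G)"
    using E S by (intro finite_sum_le_infsum summ) (auto simp: sqnorm_interval_nonneg)
  finally show False using n by simp
qed

text \<open>Only nodes that meet edges both inside and outside \<open>A\<close> could spoil the
  matching of the node values. Closedness makes their degree infinite, and there the node values
  vanish already.\<close>

lemma cut_form_domain:
  assumes A: "closed_edges A" and \<psi>: "\<psi> \<in> form_domain G"
  shows "cut (A \<times> UNIV) \<psi> \<in> form_domain G"
proof -
  obtain d where d: "(\<lambda>v. (cmod (d v))\<^sup>2) summable_on verts G"
    "\<And>e. e \<in> arcs G \<Longrightarrow> continuous_rep (\<psi> e) 0 = d (tail G e)"
    "\<And>e. e \<in> arcs G \<Longrightarrow> continuous_rep (\<psi> e) 1 = d (head G e)" and H1: "\<psi> \<in> H1_graph G"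
    using \<psi> unfolding form_domain_def by auto
  note inf0 = infinite_degree_trace_zero[OF H1 d(2,3)]
  \<comment> \<open>Keeping \<open>d\<close> at every node met by \<open>A\<close> suits the edges
    in \<open>A\<close>; on the other edges the value has to be \<open>0\<close>, which
    \<open>fin\<close> checks.\<close>
  define d' where "d' v = (if \<exists>e\<in>A. incident G v e then d v else 0)" for v
  have H1': "cut (A \<times> UNIV) \<psi> \<in> H1_graph G"
    unfolding H1_graph_def
  proof (intro CollectI conjI ballI)
    show "cut (A \<times> UNIV) \<psi> e \<in> H1_interval" if "e \<in> arcs G" for e
      using weak_deriv_AE_eq(1)[OF has_weak_deriv_zero] form_domain_H1[OF \<psi> that] by (simp add: cut_edges)
    have summ: "(\<lambda>e. sqnorm_interval (\<psi> e) + sqnorm_interval (weak_deriv (\<psi> e))) summable_on arcs G"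
      using H1 by (simp add: H1_graph_def)
    have wz: "sqnorm_interval (weak_deriv (\<lambda>x. 0)) = 0"
      unfolding sqnorm_weak_deriv[OF has_weak_deriv_zero] by (simp add: sqnorm_interval_def)
    have z: "sqnorm_interval (\<lambda>x. 0) = 0" by (simp add: sqnorm_interval_def)
    show "(\<lambda>e. sqnorm_interval (cut (A \<times> UNIV) \<psi> e) + sqnorm_interval (weak_deriv (cut (A \<times> UNIV) \<psi> e))) summable_on arcs G"
      by (rule summable_on_comparison_test[OF summ]) (auto simp: cut_edges wz z sqnorm_interval_nonneg)
  qed
  have fin: "d' v = 0" if e: "e \<in> arcs G - A" "incident G v e" "v \<in> verts G" for v e
  proof (cases "\<exists>e\<in>A. incident G v e")
    case True
    then obtain e' where "e' \<in> A" "incident G v e'" by blast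
    then have "\<not> edegree G v < \<infinity>" using A e unfolding closed_edges_def by blast
    then show ?thesis using inf0[of v] by (simp add: d'_def)
  qed (auto simp: d'_def)
  show ?thesis
    unfolding form_domain_def
  proof (intro CollectI conjI H1' exI[of _ d'] ballI)
    show "(\<lambda>v. (cmod (d' v))\<^sup>2) summable_on verts G"
      by (rule summable_on_comparison_test[OF d(1)]) (auto simp: d'_def)
    fix e assume e: "e \<in> arcs G"
    have inc: "incident G (tail G e) e" "incident G (head G e) e" by (auto simp: incident_def)
    show "continuous_rep (cut (A \<times> UNIV) \<psi> e) 0 = d' (tail G e)"
    proof (cases "e \<in> A")
      case True
      then show ?thesis using d(2)[OF e] inc by (auto simp: cut_edges d'_def)
    next
      case False
      then show ?thesis using fin[of e "tail G e"] e inc by (simp add: cut_edges continuous_rep_zero)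
    qed
    show "continuous_rep (cut (A \<times> UNIV) \<psi> e) 1 = d' (head G e)"
    proof (cases "e \<in> A")
      case True
      then show ?thesis using d(3)[OF e] inc by (auto simp: cut_edges d'_def)
    next
      case False
      then show ?thesis using fin[of e "head G e"] e inc by (simp add: cut_edges continuous_rep_zero)
    qed
  qed
qed

text \<open>The cut is moved to \<open>h\<close>, which stays in the form domain and may be inserted
  into the weak equation for \<open>f\<close>. The resulting form has contributions from the edges
  in \<open>A\<close> only, so its conjugate is the form with the roles of \<open>f\<close> and
  \<open>h\<close> exchanged.\<close>

lemma laplacian_cut_symmetric:
  assumes A: "closed_edges A" and f: "laplacian G f f'" and h: "laplacian G h h'"
  shows "L2_inner G (cut (A \<times> UNIV) f') h = L2_inner G (cut (A \<times> UNIV) f) h'"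
proof -
  let ?P = "cut (A \<times> UNIV)"
  have fV: "f \<in> form_domain G" and hV: "h \<in> form_domain G" using f h by (auto simp: laplacian_def)
  have termwise: "(LINT x|unit_interval. weak_deriv (f e) x * cnj (weak_deriv (?P h e) x)) =
      cnj (LINT x|unit_interval. weak_deriv (h e) x * cnj (weak_deriv (?P f e) x))" if e: "e \<in> arcs G" for e
  proof (cases "e \<in> A")
    case True
    then show ?thesis
      unfolding Bochner_Integration.integral_cnj[symmetric] by (simp add: cut_edges mult.commute)
  next
    case False
    note s = has_weak_deriv_sqint(2)[OF weak_deriv_works[OF form_domain_H1[OF _ e]]]
    from False show ?thesis
      by (simp add: cut_edges integral_weak_deriv_zero s fV hV)
  qed
  have "L2_inner G (?P f') h = L2_inner G f' (?P h)" by (rule L2_inner_cut)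
  also have "\<dots> = - dirichlet_form G f (?P h)"
    using f cut_form_domain[OF A hV] by (simp add: laplacian_def)
  also have "dirichlet_form G f (?P h) = cnj (dirichlet_form G h (?P f))"
    unfolding dirichlet_form_def infsum_cnj[symmetric] by (intro infsum_cong termwise)
  also have "dirichlet_form G h (?P f) = - L2_inner G h' (?P f)"
    using h cut_form_domain[OF A fV] by (simp add: laplacian_def)
  finally show ?thesis using L2_inner_commute[of "?P f" h'] by simp
qed

section \<open>Ideals given by sets of edges\<close>

lemma L2_ideal_edges_iff:
  "f \<in> L2_ideal G (A \<times> {0..1}) \<longleftrightarrow>
     f \<in> L2_graph G \<and> (\<forall>e\<in>arcs G - A. AE x in unit_interval. f e x = 0)"
proof -
  have "(AE x in unit_interval. (e, x) \<notin> A \<times> {0..1} \<longrightarrow> f e x = 0) \<longleftrightarrow> e \<in> A \<or> (AE x in unit_interval. f e x = 0)" for e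
  proof (cases "e \<in> A")
    case True
    have "AE x in unit_interval. (e, x) \<notin> A \<times> {0..1} \<longrightarrow> f e x = 0"
      by (rule AE_I2) (use True in auto)
    then show ?thesis using True by simp
  qed simp
  then show ?thesis unfolding L2_ideal_def AE_edges_iff by blast
qed

lemma edge_indicator_L2:
  assumes "e \<in> arcs G"
  shows "(\<lambda>e' x. if e' = e then 1 else 0) \<in> L2_graph G"
proof (rule finite_support_L2[of "{e}"])
  show "(\<lambda>x. if e' = e then 1 else 0) \<in> sqint unit_interval" if "e' \<in> {e}" for e'
    by (intro continuous_on_sqint continuous_intros)
qed (use assms in auto)

lemma not_AE_unit_interval_False: "\<not> (AE x in unit_interval. False)"
proof
  assume "AE x in unit_interval. False"
  then have "negligible {0..1::real}" using negligible_AE_unit_interval[of "\<lambda>x. False"] by (simp add: atLeastAtMost_def atLeast_def atMost_def Int_def)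
  then have "negligible {0<..<1::real}" by (rule negligible_subset) auto
  moreover have "(1/2::real) \<in> {0<..<1}" by simp
  ultimately show False using open_not_negligible[OF open_greaterThanLessThan] by blast
qed

text \<open>The indicator function of a single edge tests whether the edge belongs to the
  set.\<close>

lemma L2_ideal_edges_subset_iff:
  assumes "A \<subseteq> arcs G"
  shows "L2_ideal G (A \<times> {0..1}) \<subseteq> L2_ideal G (B \<times> {0..1}) \<longleftrightarrow> A \<subseteq> B"
proof
  assume sub: "L2_ideal G (A \<times> {0..1}) \<subseteq> L2_ideal G (B \<times> {0..1})"
  show "A \<subseteq> B"
  proof
    fix e assume e: "e \<in> A"
    let ?f = "\<lambda>e' x::real. if e' = e then 1 else 0 :: complex"
    have "?f \<in> L2_ideal G (A \<times> {0..1})"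
      unfolding L2_ideal_edges_iff using edge_indicator_L2 e assms by auto
    with sub have "?f \<in> L2_ideal G (B \<times> {0..1})" by blast
    then show "e \<in> B"
      unfolding L2_ideal_edges_iff using e assms not_AE_unit_interval_False by (auto dest!: bspec[of _ _ e])
  qed
next
  assume "A \<subseteq> B"
  then show "L2_ideal G (A \<times> {0..1}) \<subseteq> L2_ideal G (B \<times> {0..1})"
    unfolding subset_iff L2_ideal_edges_iff by blast
qed

lemma L2_ideal_edges_eq_iff:
  assumes "A \<subseteq> arcs G" "B \<subseteq> arcs G"
  shows "L2_ideal G (A \<times> {0..1}) = L2_ideal G (B \<times> {0..1}) \<longleftrightarrow> A = B"
  using L2_ideal_edges_subset_iff[OF assms(1), of B] L2_ideal_edges_subset_iff[OF assms(2), of A] by blast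

lemma nontrivial_ideal_edges:
  assumes "A \<subseteq> arcs G" "A \<noteq> {}"
  shows "nontrivial_ideal G (L2_ideal G (A \<times> {0..1}))"
proof -
  interpret pair_sigma_finite "count_space (arcs G)" unit_interval by (rule pair_sigma_finite_edges)
  obtain e where e: "e \<in> A" using assms by blast
  have "emeasure unit_interval {0..1::real} = 1"
    by (simp add: emeasure_restrict_space)
  then have "emeasure (edge_measure G) ({e} \<times> {0..1}) = 1"
    unfolding edge_measure_def using e assms
    by (subst M2.emeasure_pair_measure_Times) (auto simp: sets_restrict_space)
  moreover have "emeasure (edge_measure G) ({e} \<times> {0..1}) \<le> emeasure (edge_measure G) (A \<times> {0..1})"
    using e by (intro emeasure_mono edges_sets assms) auto
  ultimately have "0 < emeasure (edge_measure G) (A \<times> {0..1})" by (metis less_le_trans zero_less_one)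
  then show ?thesis unfolding nontrivial_ideal_def using edges_sets[OF assms(1)] by blast
qed

text \<open>\<open>nontrivial_ideal\<close> asks for some \<open>\<omega>\<close> of positive
  measure, so it has to be excluded that such an \<open>\<omega>\<close> represents the ideal of the
  empty set. Edge indicators cut by \<open>\<omega>\<close> lie in that ideal, which makes
  \<open>\<omega>\<close> null.\<close>

lemma trivial_ideal_edges:
  assumes "A \<subseteq> arcs G" "nontrivial_ideal G (L2_ideal G (A \<times> {0..1}))"
  shows "A \<noteq> {}"
proof
  assume "A = {}"
  obtain \<omega> where \<omega>: "\<omega> \<in> sets (edge_measure G)" "0 < emeasure (edge_measure G) \<omega>"
    "L2_ideal G (A \<times> {0..1}) = L2_ideal G \<omega>"
    using assms(2) by (auto simp: nontrivial_ideal_def)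
  have "AE p in edge_measure G. p \<notin> \<omega>"
  proof -
    have "\<forall>e\<in>arcs G. AE x in unit_interval. (e, x) \<notin> \<omega>"
    proof
      fix e assume e: "e \<in> arcs G"
      let ?f = "cut \<omega> (\<lambda>e' x. if e' = e then 1 else 0)"
      have "\<omega> \<inter> space (edge_measure G) \<in> sets (edge_measure G)" using \<omega>(1) by auto
      from L2_cut[OF edge_indicator_L2[OF e] this] have "?f \<in> L2_ideal G \<omega>"
        unfolding L2_ideal_def AE_edges_iff by (auto simp: cut_def)
      then have "?f \<in> L2_ideal G (A \<times> {0..1})" using \<omega>(3) by simp
      then have "AE x in unit_interval. ?f e x = 0"
        using e \<open>A = {}\<close> unfolding L2_ideal_edges_iff by blast
      then show "AE x in unit_interval. (e, x) \<notin> \<omega>"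
        by eventually_elim (auto simp: cut_def split: if_splits)
    qed
    then have "AE p in edge_measure G. case p of (e, x) \<Rightarrow> (e, x) \<notin> \<omega>" unfolding AE_edges_iff .
    then show ?thesis by (simp add: case_prod_unfold)
  qed
  then have "emeasure (edge_measure G) \<omega> = 0"
    using AE_iff_measurable[OF \<omega>(1), of "\<lambda>p. p \<notin> \<omega>"] sets.sets_into_space[OF \<omega>(1)] by auto
  with \<omega>(2) show False by simp
qed

end

section \<open>Invariant ideals\<close>

locale graph_heat_semigroup = graph_semigroup G T
  for G :: "('v, 'e) pre_digraph" (structure)
    and T :: "real \<Rightarrow> ('e \<Rightarrow> real \<Rightarrow> complex) \<Rightarrow> 'e \<Rightarrow> real \<Rightarrow> complex" +
  assumes generator_eq: "generator G T = laplacian G"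
begin

text \<open>Fields supported in the open edges vanish at all nodes, so the zero family of node
  values puts them into the form domain.\<close>

lemma generator_dense:
  assumes "f \<in> L2_graph G" "0 < \<epsilon>"
  shows "\<exists>F F'. generator G T F F' \<and> L2_norm G (\<lambda>e x. f e x - F e x) < \<epsilon>"
proof -
  obtain F \<phi> \<phi>' where F: "smooth_field F \<phi> \<phi>'" "\<And>e. e \<in> arcs G \<Longrightarrow> complex_test (F e) (\<phi> e)"
    "L2_norm G (\<lambda>e x. f e x - F e x) < \<epsilon>"
    using smooth_fields_dense[OF assms] by metis
  have ends: "F e 0 = 0" "F e 1 = 0" if "e \<in> arcs G" for e
    using F(2)[OF that] by (auto simp: complex_test_def)
  have "F \<in> form_domain G"
    by (rule smooth_field_form_domain[OF F(1), of "\<lambda>v. 0" "{}"]) (auto simp: ends)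
  from smooth_field_laplacian[OF F(1) this] F(3) show ?thesis unfolding generator_eq by blast
qed

lemma cut_closed_edges_commutes:
  assumes "closed_edges A" "f \<in> L2_graph G" "h \<in> L2_graph G" "0 \<le> t"
  shows "L2_inner G (cut (A \<times> UNIV) (T t f)) h = L2_inner G (cut (A \<times> UNIV) f) (T t h)"
  by (rule cut_commutes[OF edges_sets_UNIV _ generator_dense assms(2-4)])
    (simp_all add: generator_eq laplacian_cut_symmetric[OF assms(1)])

lemma cut_arcs_eq: "L2_eq G (cut (arcs G \<times> UNIV) f) f"
  by (simp add: L2_eq_iff cut_edges)

lemma T_symmetric:
  assumes f: "f \<in> L2_graph G" and h: "h \<in> L2_graph G" and t: "0 \<le> t"
  shows "L2_inner G (T t f) h = L2_inner G f (T t h)"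
proof -
  have "L2_inner G (T t f) h = L2_inner G (cut (arcs G \<times> UNIV) (T t f)) h"
    using assms by (intro L2_inner_cong L2_cut edges_sets_UNIV T_L2 L2_eq_refl L2_eq_sym[OF cut_arcs_eq])
  also have "\<dots> = L2_inner G (cut (arcs G \<times> UNIV) f) (T t h)"
    by (rule cut_closed_edges_commutes[OF closed_edges_arcs f h t])
  also have "\<dots> = L2_inner G f (T t h)"
    using assms by (intro L2_inner_cong L2_cut edges_sets_UNIV T_L2 L2_eq_refl cut_arcs_eq)
  finally show ?thesis .
qed

text \<open>Let \<open>Q\<close> be the cut by the complementary edges, again a closed set, and
  \<open>u = Q (T t f)\<close>. Then \<open>(u | u) = (Q f | T t u) = 0\<close>, because
  \<open>Q f\<close> vanishes almost everywhere.\<close>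

lemma closed_edges_invariant:
  assumes A: "closed_edges A"
  shows "invariant T (L2_ideal G (A \<times> {0..1}))"
  unfolding invariant_def
proof (intro allI impI image_subsetI)
  fix t :: real and f assume t: "0 \<le> t" and "f \<in> L2_ideal G (A \<times> {0..1})"
  then have f: "f \<in> L2_graph G" and fz: "\<And>e. e \<in> arcs G - A \<Longrightarrow> AE x in unit_interval. f e x = 0"
    by (auto simp: L2_ideal_edges_iff)
  let ?Q = "cut ((arcs G - A) \<times> UNIV)"
  let ?u = "?Q (T t f)"
  have uL: "?u \<in> L2_graph G" by (intro L2_cut edges_sets_UNIV T_L2 t f)
  have "L2_eq G (?Q f) (\<lambda>e x. 0)"
    using fz by (auto simp: L2_eq_iff cut_edges)
  then have "L2_inner G (?Q f) (T t ?u) = L2_inner G (\<lambda>e x. 0) (T t ?u)"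
    by (intro L2_inner_cong L2_cut edges_sets_UNIV T_L2 t f uL L2_zero L2_eq_refl)
  then have "L2_inner G ?u ?u = 0"
    using cut_closed_edges_commutes[OF closed_edges_compl[OF A] f uL t] by (simp add: L2_inner_def)
  then have "L2_eq G ?u (\<lambda>e x. 0)" using L2_inner_self[OF uL] L2_norm_eq_0_iff[OF uL] by simp
  then show "T t f \<in> L2_ideal G (A \<times> {0..1})"
    unfolding L2_ideal_edges_iff L2_eq_iff using T_L2[OF t f] by (auto simp: cut_edges)
qed

text \<open>Since \<open>T\<close> is symmetric, the orthogonal complement of an invariant ideal is invariant as well,
  so that the projection onto the ideal commutes with \<open>T\<close> and leaves the form domain invariant.\<close>

lemma invariant_ideal_cut_generator:
  assumes \<omega>: "\<omega> \<in> sets (edge_measure G)" and inv: "invariant T (L2_ideal G \<omega>)"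
    and gen: "generator G T f f'"
  shows "generator G T (cut \<omega> f) (cut \<omega> f')"
proof -
  let ?P = "cut \<omega>" and ?Q = "cut (- \<omega>)"
  have \<omega>': "\<omega> \<inter> space (edge_measure G) \<in> sets (edge_measure G)" using \<omega> by auto
  have "- \<omega> \<inter> space (edge_measure G) = space (edge_measure G) - \<omega>" by auto
  then have \<omega>c: "- \<omega> \<inter> space (edge_measure G) \<in> sets (edge_measure G)" using \<omega> by auto
  have PL: "?P u \<in> L2_graph G" and QL: "?Q u \<in> L2_graph G" if "u \<in> L2_graph G" for u
    using L2_cut[OF that \<omega>'] L2_cut[OF that \<omega>c] .
  have ideal_iff: "u \<in> L2_ideal G \<omega> \<longleftrightarrow> u \<in> L2_graph G \<and> L2_eq G (?Q u) (\<lambda>e x. 0)" for u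
  proof -
    have "(AE p in edge_measure G. case p of (e, x) \<Rightarrow> (e, x) \<notin> \<omega> \<longrightarrow> u e x = 0) \<longleftrightarrow> L2_eq G (?Q u) (\<lambda>e x. 0)"
      unfolding L2_eq_def by (rule AE_cong) (auto simp: cut_def)
    then show ?thesis by (simp add: L2_ideal_def)
  qed
  have QP: "?Q (?P u) = (\<lambda>e x. 0)" for u by (auto simp: cut_def fun_eq_iff)
  have P_ideal: "?P u \<in> L2_ideal G \<omega>" if "u \<in> L2_graph G" for u
    unfolding ideal_iff QP using PL[OF that] L2_eq_refl by blast
  have Q_T_P: "L2_eq G (?Q (T t (?P u))) (\<lambda>e x. 0)" if "0 \<le> t" "u \<in> L2_graph G" for t u
  proof -
    have "T t (?P u) \<in> L2_ideal G \<omega>"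
      using inv that(1) P_ideal[OF that(2)] unfolding invariant_def image_subset_iff by blast
    then show ?thesis unfolding ideal_iff by (rule conjunct2)
  qed
  have P_T_Q: "L2_eq G (?P (T t (?Q u))) (\<lambda>e x. 0)" if t: "0 \<le> t" and u: "u \<in> L2_graph G" for t u
  proof -
    let ?k = "?P (T t (?Q u))"
    have k: "?k \<in> L2_graph G" by (intro PL T_L2 QL t u)
    have "L2_inner G ?k ?k = L2_inner G (T t (?Q u)) (?P ?k)" by (rule L2_inner_cut)
    also have "\<dots> = L2_inner G (?Q u) (T t (?P ?k))"
      by (intro T_symmetric QL PL t u k)
    also have "\<dots> = L2_inner G u (?Q (T t (?P ?k)))" by (rule L2_inner_cut)
    also have "\<dots> = L2_inner G u (\<lambda>e x. 0)"
      by (intro L2_inner_cong u QL PL T_L2 t k L2_zero L2_eq_refl Q_T_P)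
    also have "\<dots> = 0" by (simp add: L2_inner_def)
    finally show ?thesis using L2_inner_self[OF k] L2_norm_eq_0_iff[OF k] by simp
  qed
  have commute: "L2_eq G (T t (?P u)) (?P (T t u))" if t: "0 \<le> t" and u: "u \<in> L2_graph G" for t u
  proof -
    have sum: "u = (\<lambda>e x. ?P u e x + ?Q u e x)" by (auto simp: cut_def fun_eq_iff)
    have "L2_eq G (T t u) (\<lambda>e x. T t (?P u) e x + T t (?Q u) e x)"
      using T_add[OF t PL[OF u] QL[OF u]] unfolding sum[symmetric] .
    then show ?thesis
      using Q_T_P[OF t u] P_T_Q[OF t u] unfolding L2_eq_def
    proof eventually_elim
      fix p
      assume "case p of (e, x) \<Rightarrow> T t u e x = T t (?P u) e x + T t (?Q u) e x"
        "case p of (e, x) \<Rightarrow> ?Q (T t (?P u)) e x = 0" "case p of (e, x) \<Rightarrow> ?P (T t (?Q u)) e x = 0"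
      then show "case p of (e, x) \<Rightarrow> T t (?P u) e x = ?P (T t u) e x"
        by (auto simp: cut_def split: if_splits)
    qed
  qed
  note f = generatorD[OF gen]
  \<comment> \<open>By \<open>commute\<close> this error is almost everywhere the cut of the error
    for \<open>f\<close>, and cutting does not increase the norm.\<close>
  have "((\<lambda>k. L2_norm G (\<lambda>e x. diff_quotient (?P f) k e x - ?P f' e x)) \<longlongrightarrow> 0) (at_right 0)"
  proof (rule Lim_null_comparison[OF _ f(3)])
    show "\<forall>\<^sub>F k in at_right 0. norm (L2_norm G (\<lambda>e x. diff_quotient (?P f) k e x - ?P f' e x))
        \<le> L2_norm G (\<lambda>e x. diff_quotient f k e x - f' e x)"
      using eventually_at_right_less[of 0]
    proof eventually_elim
      fix k :: real assume "0 < k"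
      then have k: "0 \<le> k" by simp
      note dL = L2_diff[OF diff_quotient_L2[OF k f(1)] f(2)]
      have "L2_norm G (\<lambda>e x. diff_quotient (?P f) k e x - ?P f' e x) =
          L2_norm G (?P (\<lambda>e x. diff_quotient f k e x - f' e x))"
      proof (rule L2_norm_cong)
        show "(\<lambda>e x. diff_quotient (?P f) k e x - ?P f' e x) \<in> L2_graph G"
          by (intro L2_diff diff_quotient_L2 PL f k)
        show "?P (\<lambda>e x. diff_quotient f k e x - f' e x) \<in> L2_graph G" by (rule PL[OF dL])
        show "L2_eq G (\<lambda>e x. diff_quotient (?P f) k e x - ?P f' e x) (?P (\<lambda>e x. diff_quotient f k e x - f' e x))"
          using commute[OF k f(1)] unfolding L2_eq_def
          by eventually_elim (auto simp: cut_def diff_quotient_def split: if_splits)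
      qed
      also have "\<dots> \<le> L2_norm G (\<lambda>e x. diff_quotient f k e x - f' e x)"
        by (rule L2_norm_cut_le[OF dL \<omega>'])
      finally show "norm (L2_norm G (\<lambda>e x. diff_quotient (?P f) k e x - ?P f' e x))
        \<le> L2_norm G (\<lambda>e x. diff_quotient f k e x - f' e x)" by (simp add: L2_norm_nonneg)
    qed
  qed
  then show ?thesis using PL f by (simp add: generator_def diff_quotient_def)
qed

text \<open>All that the classification of invariant ideals uses of invariance:
  \<open>cut \<omega> F\<close> has continuous representatives on the edges and common values at the
  nodes.\<close>

lemma invariant_ideal_cut_form_domain:
  assumes "\<omega> \<in> sets (edge_measure G)" "invariant T (L2_ideal G \<omega>)"
    and "smooth_field F \<phi> \<phi>'" "F \<in> form_domain G"
  shows "cut \<omega> F \<in> form_domain G"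
  using invariant_ideal_cut_generator[OF assms(1,2)] smooth_field_laplacian[OF assms(3,4)]
  unfolding generator_eq by (auto simp: laplacian_def)

text \<open>A bump inside the edge keeps a continuous representative after cutting, which rules out
  a jump of the indicator of \<open>\<omega>\<close> wherever the bump does not vanish.\<close>

lemma invariant_ideal_edge_dichotomy:
  assumes \<omega>: "\<omega> \<in> sets (edge_measure G)" and inv: "invariant T (L2_ideal G \<omega>)" and e: "e \<in> arcs G"
  shows "(AE x in unit_interval. (e, x) \<in> \<omega>) \<or> (AE x in unit_interval. (e, x) \<notin> \<omega>)"
proof -
  have "\<exists>u. continuous_on {0..1} u \<and> (AE x in unit_interval.
      (if x \<in> {x. (e, x) \<in> \<omega>} then complex_of_real (smooth_step (real n * (x * (1 - x)) - 1)) else 0) = u x)" for n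
  proof -
    let ?b = "\<lambda>x. complex_of_real (smooth_step (real n * (x * (1 - x)) - 1))"
    \<comment> \<open>The constant polynomial \<open>1\<close> specialises the density construction
      to a pure bump.\<close>
    have "polynomial_function (\<lambda>x::real. 1 :: complex)" by simp
    from complex_test_cutoff_polynomial[OF this, of "real n"]
    obtain b' b'' where b: "complex_test (\<lambda>x. ?b x * 1) b'" "complex_test b' b''" by auto
    then have b: "complex_test ?b b'" "complex_test b' b''" by (simp_all only: mult_1_right)
    define F where "F e' = (if e' = e then ?b else (\<lambda>x. 0))" for e'
    define \<phi> where "\<phi> e' = (if e' = e then b' else (\<lambda>x. 0))" for e'
    define \<phi>' where "\<phi>' e' = (if e' = e then b'' else (\<lambda>x. 0))" for e'
    have ct: "complex_test (F e') (\<phi> e')" "complex_test (\<phi> e') (\<phi>' e')" for e'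
      using b complex_test_zero by (auto simp: F_def \<phi>_def \<phi>'_def)
    have sf: "smooth_field F \<phi> \<phi>'"
      unfolding smooth_field_def
      using ct complex_test_deriv[OF ct(1)] e by (auto intro!: exI[of _ "{e}"] simp: F_def \<phi>_def \<phi>'_def)
    have ends: "F e' 0 = 0" "F e' 1 = 0" for e'
      using ct(1)[of e'] by (auto simp: complex_test_def)
    have "F \<in> form_domain G"
      by (rule smooth_field_form_domain[OF sf, of "\<lambda>v. 0" "{}"]) (auto simp: ends)
    from invariant_ideal_cut_form_domain[OF \<omega> inv sf this]
    have "cut \<omega> F e \<in> H1_interval" by (rule form_domain_H1[OF _ e])
    then have H1: "cut \<omega> F e \<in> H1_interval" .
    have eq: "cut \<omega> F e = (\<lambda>x. if x \<in> {x. (e, x) \<in> \<omega>} then ?b x else 0)"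
      by (simp add: cut_def F_def fun_eq_iff)
    show ?thesis
      using continuous_rep_works[OF H1] unfolding eq by (intro exI conjI)
  qed
  from unit_interval_dichotomy[OF this] show ?thesis by simp
qed

text \<open>The transition at the tail falls from \<open>1\<close> at \<open>1/6\<close> to
  \<open>0\<close> at \<open>1/3\<close>, the one at the head rises from \<open>0\<close> at
  \<open>2/3\<close> to \<open>1\<close> at \<open>5/6\<close>. On a loop at \<open>v\<close> both
  summands are present and do not overlap.\<close>

definition node_field :: "'v \<Rightarrow> 'e \<Rightarrow> real \<Rightarrow> complex" where
  "node_field v e x = of_real ((if tail G e = v then smooth_step (2 - 6 * x) else 0) +
     (if head G e = v then smooth_step (6 * x - 4) else 0))"

definition node_field' :: "'v \<Rightarrow> 'e \<Rightarrow> real \<Rightarrow> complex" where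
  "node_field' v e x = of_real ((if tail G e = v then - 6 * smooth_step' (2 - 6 * x) else 0) +
     (if head G e = v then 6 * smooth_step' (6 * x - 4) else 0))"

definition node_field'' :: "'v \<Rightarrow> 'e \<Rightarrow> real \<Rightarrow> complex" where
  "node_field'' v e x = of_real ((if tail G e = v then 36 * smooth_step'' (2 - 6 * x) else 0) +
     (if head G e = v then 36 * smooth_step'' (6 * x - 4) else 0))"

text \<open>Finite degree makes the set of edges carrying the field finite. On every edge the
  derivative lives in \<open>[1/6,5/6]\<close>, away from the nodes.\<close>

lemma node_field_smooth:
  assumes "edegree G v < \<infinity>"
  shows "smooth_field (node_field v) (node_field' v) (node_field'' v)"
  unfolding smooth_field_def
proof (intro conjI ballI allI)
  have lin: "((\<lambda>x. 2 - 6 * x) has_real_derivative - 6) (at x)" "((\<lambda>x. 6 * x - 4) has_real_derivative 6) (at x)" for x :: real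
    by (auto intro!: derivative_eq_intros)
  have s1: "((\<lambda>x. smooth_step (2 - 6 * x)) has_real_derivative - 6 * smooth_step' (2 - 6 * x)) (at x)"
    "((\<lambda>x. smooth_step (6 * x - 4)) has_real_derivative 6 * smooth_step' (6 * x - 4)) (at x)" for x
    using DERIV_chain2[OF smooth_step_deriv lin(1)] DERIV_chain2[OF smooth_step_deriv lin(2)] by (simp_all add: mult.commute)
  have s2: "((\<lambda>x. - 6 * smooth_step' (2 - 6 * x)) has_real_derivative 36 * smooth_step'' (2 - 6 * x)) (at x)"
    "((\<lambda>x. 6 * smooth_step' (6 * x - 4)) has_real_derivative 36 * smooth_step'' (6 * x - 4)) (at x)" for x
    using DERIV_cmult[OF DERIV_chain2[OF smooth_step'_deriv lin(1)], of "-6"]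
      DERIV_cmult[OF DERIV_chain2[OF smooth_step'_deriv lin(2)], of 6] by (simp_all add: mult.commute)
  fix e assume e: "e \<in> arcs G"
  show "(node_field v e has_vector_derivative node_field' v e x) (at x)" for x
    unfolding node_field_def[abs_def] node_field'_def
    by (intro has_vector_derivative_of_realI DERIV_add)
      (use s1 in auto)
  have d': "(node_field' v e has_vector_derivative node_field'' v e x) (at x)" for x
    unfolding node_field'_def[abs_def] node_field''_def
    by (intro has_vector_derivative_of_realI DERIV_add)
      (use s2 in auto)
  have "continuous_on UNIV (node_field'' v e)"
  proof -
    have "continuous_on UNIV (\<lambda>x. smooth_step'' (2 - 6 * x))" "continuous_on UNIV (\<lambda>x. smooth_step'' (6 * x - 4))"
      by (intro continuous_on_compose2[OF smooth_step''_continuous] continuous_intros; simp)+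
    then show ?thesis
      unfolding node_field''_def[abs_def]
      by (cases "tail G e = v"; cases "head G e = v") (auto intro!: continuous_intros)
  qed
  moreover have "node_field' v e x = 0" if "x \<notin> {1/6..5/6}" for x
  proof -
    have "smooth_step' (2 - 6 * x) = 0"
      using that by (cases "x < 1/6") (auto intro: smooth_step'_ge1 smooth_step'_nonpos)
    moreover have "smooth_step' (6 * x - 4) = 0"
      using that by (cases "x < 1/6") (auto intro: smooth_step'_ge1 smooth_step'_nonpos)
    ultimately show ?thesis by (simp add: node_field'_def)
  qed
  ultimately show "complex_test (node_field' v e) (node_field'' v e)"
    unfolding complex_test_def using d' by (intro conjI exI[of _ "1/6"] exI[of _ "5/6"]) auto
next
  show "\<exists>E. finite E \<and> E \<subseteq> arcs G \<and> (\<forall>e\<in>arcs G - E. \<forall>x.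
      node_field v e x = 0 \<and> node_field' v e x = 0 \<and> node_field'' v e x = 0)"
    using assms
    by (intro exI[of _ "in_arcs G v \<union> out_arcs G v"])
      (auto simp: edegree_def node_field_def node_field'_def node_field''_def split: if_splits)
qed

lemma node_field_ends:
  "node_field v e 0 = (if tail G e = v then 1 else 0)" "node_field v e 1 = (if head G e = v then 1 else 0)"
  by (simp_all add: node_field_def smooth_step_nonpos smooth_step_ge1)

text \<open>The field around \<open>v\<close> has the value \<open>1\<close> there. After cutting,
  an edge in the set still shows \<open>1\<close> at \<open>v\<close> and an edge outside shows
  \<open>0\<close>, but both must show the same node value \<open>d v\<close>.\<close>

lemma invariant_ideal_closed_edges:
  assumes \<omega>: "\<omega> \<in> sets (edge_measure G)" and inv: "invariant T (L2_ideal G \<omega>)"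
  shows "closed_edges {e \<in> arcs G. AE x in unit_interval. (e, x) \<in> \<omega>}" (is "closed_edges ?A")
  unfolding closed_edges_def
proof (intro conjI ballI impI)
  fix e e' v
  assume e: "e \<in> ?A" and e': "e' \<in> arcs G" and "v \<in> verts G"
    and v: "edegree G v < \<infinity> \<and> incident G v e \<and> incident G v e'"
  note sf = node_field_smooth[of v]
  let ?F = "node_field v"
  have "?F \<in> form_domain G"
    by (rule smooth_field_form_domain[OF sf, of "\<lambda>w. if w = v then 1 else 0" "{v}"])
      (use v in \<open>auto simp: node_field_ends\<close>)
  from invariant_ideal_cut_form_domain[OF \<omega> inv sf this] v
  obtain d where d: "\<And>e. e \<in> arcs G \<Longrightarrow> continuous_rep (cut \<omega> ?F e) 0 = d (tail G e)"
      "\<And>e. e \<in> arcs G \<Longrightarrow> continuous_rep (cut \<omega> ?F e) 1 = d (head G e)"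
    unfolding form_domain_def by auto
  have inside: "continuous_rep (cut \<omega> ?F e) x = ?F e x" if "e \<in> ?A" "x \<in> {0..1}" for e x
  proof (rule continuous_rep_eq[OF _ _ that(2)])
    show "continuous_on {0..1} (?F e)" using smooth_field_continuous[OF sf] v that(1) by blast
    have "AE x in unit_interval. (e, x) \<in> \<omega>" using that(1) by blast
    then show "AE x in unit_interval. cut \<omega> ?F e x = ?F e x" by eventually_elim (simp add: cut_def)
  qed
  have outside: "continuous_rep (cut \<omega> ?F e) x = 0" if "e \<in> arcs G - ?A" "x \<in> {0..1}" for e x
  proof (rule continuous_rep_eq[where u="\<lambda>x. 0", OF _ _ that(2)])
    have "AE x in unit_interval. (e, x) \<notin> \<omega>"
      using invariant_ideal_edge_dichotomy[OF \<omega> inv, of e] that(1) by blast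
    then show "AE x in unit_interval. cut \<omega> ?F e x = 0" by eventually_elim (simp add: cut_def)
  qed simp
  have "d v = 1"
    using v e d[of e] inside[OF e, of 0] inside[OF e, of 1]
    by (auto simp: incident_def node_field_ends)
  show "e' \<in> ?A"
  proof (rule ccontr)
    assume "e' \<notin> ?A"
    then have "d v = 0"
      using v e' d[of e'] outside[of e' 0] outside[of e' 1] by (auto simp: incident_def)
    with \<open>d v = 1\<close> show False by simp
  qed
qed auto

lemma invariant_ideal_edges:
  assumes \<omega>: "\<omega> \<in> sets (edge_measure G)" and inv: "invariant T (L2_ideal G \<omega>)"
  obtains A where "closed_edges A" "L2_ideal G \<omega> = L2_ideal G (A \<times> {0..1})"
proof
  let ?A = "{e \<in> arcs G. AE x in unit_interval. (e, x) \<in> \<omega>}"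
  show "closed_edges ?A" by (rule invariant_ideal_closed_edges[OF assms])
  have "(AE x in unit_interval. (e, x) \<notin> \<omega> \<longrightarrow> f e x = 0) \<longleftrightarrow> e \<in> ?A \<or> (AE x in unit_interval. f e x = 0)"
    if e: "e \<in> arcs G" for e and f :: "'e \<Rightarrow> real \<Rightarrow> complex"
  proof (cases "e \<in> ?A")
    case True
    then have "AE x in unit_interval. (e, x) \<in> \<omega>" by blast
    then have "AE x in unit_interval. (e, x) \<notin> \<omega> \<longrightarrow> f e x = 0" by eventually_elim simp
    then show ?thesis using True by blast
  next
    case False
    then have "AE x in unit_interval. (e, x) \<notin> \<omega>"
      using invariant_ideal_edge_dichotomy[OF assms e] e by blast
    then have "(AE x in unit_interval. (e, x) \<notin> \<omega> \<longrightarrow> f e x = 0) \<longleftrightarrow> (AE x in unit_interval. f e x = 0)"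
      by (auto elim: eventually_elim2)
    then show ?thesis using False by blast
  qed
  then show "L2_ideal G \<omega> = L2_ideal G (?A \<times> {0..1})"
    unfolding set_eq_iff L2_ideal_edges_iff by (auto simp: L2_ideal_def AE_edges_iff)
qed

lemma nontrivial_invariant_ideal_iff:
  "nontrivial_ideal G I \<and> invariant T I \<longleftrightarrow>
     (\<exists>A. closed_edges A \<and> A \<noteq> {} \<and> I = L2_ideal G (A \<times> {0..1}))"
proof
  assume I: "nontrivial_ideal G I \<and> invariant T I"
  then obtain \<omega> where "\<omega> \<in> sets (edge_measure G)" "I = L2_ideal G \<omega>" by (auto simp: nontrivial_ideal_def)
  with I obtain A where A: "closed_edges A" "I = L2_ideal G (A \<times> {0..1})"
    using invariant_ideal_edges by metis
  with I have "A \<noteq> {}" using trivial_ideal_edges[of A] by (auto simp: closed_edges_def)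
  with A show "\<exists>A. closed_edges A \<and> A \<noteq> {} \<and> I = L2_ideal G (A \<times> {0..1})" by blast
next
  assume "\<exists>A. closed_edges A \<and> A \<noteq> {} \<and> I = L2_ideal G (A \<times> {0..1})"
  then show "nontrivial_ideal G I \<and> invariant T I"
    using nontrivial_ideal_edges closed_edges_invariant by (auto simp: closed_edges_def)
qed

end

section \<open>Finite spans as equivalence classes of edges\<close>

context countable_digraph
begin

text \<open>A single step of a path of finite weight. The relation is symmetric, so its reflexive
  transitive closure is an equivalence on the edges, with the finite spans as classes.\<close>

definition span_relation :: "('e \<times> 'e) set" where
  "span_relation = {(e, e'). e \<in> arcs G \<and> e' \<in> arcs G \<and>
     (\<exists>v\<in>verts G. edegree G v < \<infinity> \<and> incident G v e \<and> incident G v e')}"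

text \<open>Chains of related edges are read off a path position by position, and conversely a path
  is extended by one edge and one node. For \<open>e\<close> outside the graph the span would be
  empty, while the closure contains \<open>e\<close>.\<close>

lemma arcs_finite_span:
  assumes e: "e \<in> arcs G"
  shows "arcs (finite_span G e) = span_relation\<^sup>* `` {e}"
proof -
  have "(e, e') \<in> span_relation\<^sup>*" if p: "edge_path G e es vs e'" and w: "finite_weight G vs" for es vs e'
  proof -
    have len: "length es = Suc (length vs)" and es: "set es \<subseteq> arcs G" and vs: "set vs \<subseteq> verts G"
      and hd: "hd es = e" and last: "last es = e'"
      and inc: "\<And>i. i < length vs \<Longrightarrow> incident G (vs ! i) (es ! i) \<and> incident G (vs ! i) (es ! Suc i)"
      using p by (auto simp: edge_path_def)
    have "(e, es ! i) \<in> span_relation\<^sup>*" if "i \<le> length vs" for i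
      using that
    proof (induction i)
      case 0
      have "es \<noteq> []" using len by auto
      then show ?case using hd by (simp add: hd_conv_nth)
    next
      case (Suc i)
      then have i: "i < length vs" by simp
      have "(es ! i, es ! Suc i) \<in> span_relation"
      proof -
        have "es ! i \<in> arcs G" "es ! Suc i \<in> arcs G" "vs ! i \<in> verts G"
          using i len by (auto intro!: subsetD[OF es] subsetD[OF vs])
        moreover have "edegree G (vs ! i) < \<infinity>"
          using w nth_mem[OF i] unfolding finite_weight_def by blast
        ultimately show ?thesis unfolding span_relation_def using inc[OF i] by blast
      qed
      with Suc.IH i show ?case by (simp add: rtrancl_into_rtrancl)
    qed
    from this[of "length vs"] show ?thesis using last len by (metis diff_Suc_1 last_conv_nth length_0_conv nat.simps(3) order_refl)
  qed
  moreover have "\<exists>es vs. edge_path G e es vs e' \<and> finite_weight G vs" if "(e, e') \<in> span_relation\<^sup>*" for e'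
    using that
  proof (induction rule: rtrancl_induct)
    case base
    show ?case using e by (intro exI[of _ "[e]"] exI[of _ "[]"]) (auto simp: edge_path_def finite_weight_def)
  next
    case (step e1 e2)
    then obtain es vs where p: "edge_path G e es vs e1" and w: "finite_weight G vs" by blast
    from step(2) obtain v where v: "v \<in> verts G" "edegree G v < \<infinity>" "incident G v e1" "incident G v e2"
      and e2: "e2 \<in> arcs G"
      by (auto simp: span_relation_def)
    have len: "length es = Suc (length vs)" and l: "last es = e1" using p by (auto simp: edge_path_def)
    then have ne: "es \<noteq> []" by auto
    have last: "es ! length vs = e1" using l len by (simp add: last_conv_nth[OF ne])
    have "edge_path G e (es @ [e2]) (vs @ [v]) e2"
      unfolding edge_path_def
    proof (intro conjI allI impI)
      fix i assume "i < length (vs @ [v])"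
      then consider "i < length vs" | "i = length vs" by fastforce
      then show "incident G ((vs @ [v]) ! i) ((es @ [e2]) ! i)"
        "incident G ((vs @ [v]) ! i) ((es @ [e2]) ! Suc i)"
        using p v len last by (cases; auto simp: edge_path_def nth_append)+
    qed (use p e2 v ne in \<open>auto simp: edge_path_def\<close>)
    moreover have "finite_weight G (vs @ [v])" using w v by (auto simp: finite_weight_def)
    ultimately show ?case by blast
  qed
  ultimately show ?thesis by (auto simp: finite_span_def Let_def)
qed

text \<open>The nodes and incidence maps of a span are determined by its edges, so ideals, which see
  only edges, tell spans apart.\<close>

lemma finite_span_eq_iff:
  "finite_span G e = finite_span G e' \<longleftrightarrow> arcs (finite_span G e) = arcs (finite_span G e')"
  unfolding finite_span_def Let_def pre_digraph.simps by blast

lemma span_relation_sym: "sym (span_relation\<^sup>*)"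
  by (rule sym_rtrancl) (auto simp: sym_def span_relation_def)

lemma finite_span_subset_arcs: "e \<in> arcs G \<Longrightarrow> arcs (finite_span G e) \<subseteq> arcs G"
  by (auto simp: arcs_finite_span span_relation_def elim: rtranclE)

lemma finite_span_self: "e \<in> arcs G \<Longrightarrow> e \<in> arcs (finite_span G e)"
  by (simp add: arcs_finite_span)

lemma closed_edges_finite_span:
  assumes e: "e \<in> arcs G"
  shows "closed_edges (arcs (finite_span G e))"
  unfolding closed_edges_def
proof (intro conjI ballI impI finite_span_subset_arcs[OF e])
  fix e1 e2 v
  assume e1: "e1 \<in> arcs (finite_span G e)" and e2: "e2 \<in> arcs G" and "v \<in> verts G"
    and "edegree G v < \<infinity> \<and> incident G v e1 \<and> incident G v e2"
  then have "(e1, e2) \<in> span_relation"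
    using finite_span_subset_arcs[OF e] by (auto simp: span_relation_def)
  with e1 show "e2 \<in> arcs (finite_span G e)" unfolding arcs_finite_span[OF e] by auto
qed

lemma finite_span_subset_closed_edges:
  assumes A: "closed_edges A" and e: "e \<in> A"
  shows "arcs (finite_span G e) \<subseteq> A"
proof -
  have "e' \<in> A" if "(e, e') \<in> span_relation\<^sup>*" for e'
    using that
  proof (induction rule: rtrancl_induct)
    case (step e1 e2)
    then show ?case using A unfolding closed_edges_def span_relation_def by blast
  qed (rule e)
  moreover have "e \<in> arcs G" using A e by (auto simp: closed_edges_def)
  ultimately show ?thesis by (auto simp: arcs_finite_span)
qed

text \<open>From any \<open>e'\<close> in \<open>A\<close> a path leads back to \<open>e\<close>, as
  the relation is symmetric; closedness then pulls the whole span of \<open>e\<close> into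
  \<open>A\<close>.\<close>

lemma finite_span_minimal:
  assumes e: "e \<in> arcs G" and A: "closed_edges A" "A \<noteq> {}" "A \<subseteq> arcs (finite_span G e)"
  shows "A = arcs (finite_span G e)"
proof -
  obtain e' where e': "e' \<in> A" using A(2) by blast
  then have "(e, e') \<in> span_relation\<^sup>*" using A(3) by (auto simp: arcs_finite_span[OF e])
  then have "(e', e) \<in> span_relation\<^sup>*" using span_relation_sym by (auto dest: symD)
  moreover have "e' \<in> arcs G" using A(1) e' by (auto simp: closed_edges_def)
  ultimately have "e \<in> A" using finite_span_subset_closed_edges[OF A(1) e'] by (auto simp: arcs_finite_span)
  from finite_span_subset_closed_edges[OF A(1) this] A(3) show ?thesis by blast
qed

end

text \<open>A closed set contains the span of each of its edges, and a span contains no smaller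
  nonempty closed set.\<close>

lemma (in graph_heat_semigroup) minimal_invariant_ideal_iff:
  "minimal_invariant_ideal G T I \<longleftrightarrow>
     (\<exists>e\<in>arcs G. I = L2_ideal G (arcs (finite_span G e) \<times> {0..1}))"
proof
  assume I: "minimal_invariant_ideal G T I"
  then have "nontrivial_ideal G I \<and> invariant T I" by (simp add: minimal_invariant_ideal_def)
  then obtain A where A: "closed_edges A" "A \<noteq> {}" "I = L2_ideal G (A \<times> {0..1})"
    unfolding nontrivial_invariant_ideal_iff by blast
  from A(2) obtain e where "e \<in> A" by blast
  with A(1) have e: "e \<in> A" "e \<in> arcs G" unfolding closed_edges_def by blast+
  let ?S = "arcs (finite_span G e)"
  have "?S \<noteq> {}" using finite_span_self[OF e(2)] by blast
  then have "nontrivial_ideal G (L2_ideal G (?S \<times> {0..1})) \<and> invariant T (L2_ideal G (?S \<times> {0..1}))"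
    unfolding nontrivial_invariant_ideal_iff using closed_edges_finite_span[OF e(2)] by blast
  moreover have "L2_ideal G (?S \<times> {0..1}) \<subseteq> I"
    unfolding A(3) L2_ideal_edges_subset_iff[OF finite_span_subset_arcs[OF e(2)]]
    by (rule finite_span_subset_closed_edges[OF A(1) e(1)])
  ultimately have "L2_ideal G (?S \<times> {0..1}) = I"
    using I unfolding minimal_invariant_ideal_def by blast
  with e(2) show "\<exists>e\<in>arcs G. I = L2_ideal G (arcs (finite_span G e) \<times> {0..1})" by blast
next
  assume "\<exists>e\<in>arcs G. I = L2_ideal G (arcs (finite_span G e) \<times> {0..1})"
  then obtain e where e: "e \<in> arcs G" and I: "I = L2_ideal G (arcs (finite_span G e) \<times> {0..1})" by blast
  have "arcs (finite_span G e) \<noteq> {}" using finite_span_self[OF e] by blast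
  then have "nontrivial_ideal G I \<and> invariant T I"
    unfolding nontrivial_invariant_ideal_iff using closed_edges_finite_span[OF e] I by blast
  moreover have "J = I" if J: "nontrivial_ideal G J \<and> invariant T J" "J \<subseteq> I" for J
  proof -
    obtain A where A: "closed_edges A" "A \<noteq> {}" "J = L2_ideal G (A \<times> {0..1})"
      using J(1) unfolding nontrivial_invariant_ideal_iff by blast
    have "A \<subseteq> arcs G" using A(1) by (simp add: closed_edges_def)
    then have "A \<subseteq> arcs (finite_span G e)"
      using J(2) L2_ideal_edges_subset_iff unfolding A(3) I by blast
    from finite_span_minimal[OF e A(1,2) this] show ?thesis using A(3) I by simp
  qed
  ultimately show "minimal_invariant_ideal G T I" unfolding minimal_invariant_ideal_def by blast
qed

theorem corollary13:
  fixes G :: "('v, 'e) pre_digraph"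
    and T :: "real \<Rightarrow> ('e \<Rightarrow> real \<Rightarrow> complex) \<Rightarrow> 'e \<Rightarrow> real \<Rightarrow> complex"
  assumes "countable_digraph G"
    and "heat_semigroup G T"
  shows "{I. minimal_invariant_ideal G T I} \<approx> {finite_span G e |e. e \<in> arcs G}"
proof -
  interpret countable_digraph G by fact
  interpret graph_heat_semigroup G T
    using assms(2) by unfold_locales (simp_all add: heat_semigroup_def)
  \<comment> \<open>The map is defined on spans rather than edges, since different edges may have
    the same span.\<close>
  have "bij_betw (\<lambda>S. L2_ideal G (arcs S \<times> {0..1})) {finite_span G e |e. e \<in> arcs G}
      {I. minimal_invariant_ideal G T I}"
  proof (rule bij_betwI')
    fix S S' assume "S \<in> {finite_span G e |e. e \<in> arcs G}" "S' \<in> {finite_span G e |e. e \<in> arcs G}"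
    then obtain e e' where "e \<in> arcs G" "e' \<in> arcs G" "S = finite_span G e" "S' = finite_span G e'" by blast
    then show "L2_ideal G (arcs S \<times> {0..1}) = L2_ideal G (arcs S' \<times> {0..1}) \<longleftrightarrow> S = S'"
      by (simp add: L2_ideal_edges_eq_iff finite_span_subset_arcs finite_span_eq_iff)
  qed (auto simp: minimal_invariant_ideal_iff)
  then show ?thesis using eqpoll_def eqpoll_sym by blast
qed

end
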